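(* Let $T>0$ and $x\in\mathbb R^d$. Suppose that $b$ is jointly continuous and that there is $C_1>0$ with $|b(x,\mu,\zeta)-b(y,\nu,\zeta)|+|\sigma(x,\mu)-\sigma(y,\nu)|\le C_1(|x-y|+W_1(\mu,\nu))$; that there is $C_2>0$ with $|b(x,\mu,\zeta)|+|\sigma(x,\mu)|\le C_2$; that $c$ is jointly continuous and that there are $C_3,C_4>0$ with $|c(x,\mu,\zeta)-c(y,\nu,\zeta)|+|c_T(x,\mu)-c_T(y,\nu)|\le C_3(|x-y|+W_1(\mu,\nu))$ and $|c(x,\mu,\zeta)|+|c_T(x,\mu)|\le C_4$, all for all $x,y\in\mathbb R^d$, $\mu,\nu\in\mathcal P(\mathbb R^d)$, $\zeta\in\mathbb U$. Then there is a constant $\tilde C$, depending only on the model parameters and $T$, such that $$\sup_{m^h}\big|\mathcal J_T^{m^h}(x)-\mathcal J_{T,h}^{m^h}(x)\big|\le\tilde C\,h^{1/2},$$ where the supremum is over all non-anticipative policies $m^h$ that are piecewise constant on the Euler-Maruyama grid of step $h$ (constant on each $[kh,(k+1)h)$).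
   Context: Setting. $(\Omega,\mathfrak F,(\mathfrak F_t)_{t\ge 0},\mathbb P)$ is a filtered probability space satisfying the usual conditions, carrying a $d$-dimensional standard Brownian motion $W$. $\mathbb U$ is a compact metric space, $\mathrm V=\mathcal P(\mathbb U)$ is the space of Borel probability measures on $\mathbb U$ with the weak topology, $\mathcal P(\mathbb R^d)$ is the space of Borel probability measures on $\mathbb R^d$, $\mathscr L(X)$ is the law of $X$, and $W_1$ is the Wasserstein-1 distance (topology on $\mathcal P(\mathbb R^d)$: that of $W_1$). The data are $b:\mathbb R^d\times\mathcal P(\mathbb R^d)\times\mathbb U\to\mathbb R^d$, $\sigma:\mathbb R^d\times\mathcal P(\mathbb R^d)\to\mathbb R^{d\times d}$, $c:\mathbb R^d\times\mathcal P(\mathbb R^d)\times\mathbb U\to\mathbb R$, $c_T:\mathbb R^d\times\mathcal P(\mathbb R^d)\to\mathbb R$. For $v\in\mathrm V$ put $b(x,\mu,v)=\int_{\mathbb U}b(x,\mu,\zeta)v(d\zeta)$ and $c(x,\mu,v)=\int_{\mathbb U}c(x,\mu,\zeta)v(d\zeta)$. A policy is a $\mathrm V$-valued process $m$; it is non-anticipative if for all $s<t$, $W_t-W_s$ is independent of the completion of $\sigma(X_0,\mathscr L(X_0),m_r,W_r:r\le s)$. Continuous-time cost: $\mathcal J_T^{m}(x)=\mathbb E_x[\int_0^Tc(X_t,\mathscr L(X_t),m_t)dt+c_T(X_T,\mathscr L(X_T))]$, where $dX_t=b(X_t,\mathscr L(X_t),m_t)dt+\sigma(X_t,\mathscr L(X_t))dW_t$,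 $X_0=x$. Discrete-time cost: for $h>0$, $t_k=kh$, $\Delta W_k=W_{t_{k+1}}-W_{t_k}$, $N_T^h=\sup\{n:nh\le T\}$ and $m^h$ constant on each $[t_k,t_{k+1})$ with value $m^h_{t_k}$, $$X^h_{k+1}=X^h_k+b(X^h_k,\mathscr L(X^h_k),m^h_{t_k})h+\sigma(X^h_k,\mathscr L(X^h_k))\Delta W_k,\quad X^h_0=x,$$ $$\mathcal J_{T,h}^{m^h}(x)=\mathbb E_x\Big[\sum_{k=0}^{N_T^h-1}c(X^h_k,\mathscr L(X^h_k),m^h_{t_k})h+c_T(X^h_{N_T^h},\mathscr L(X^h_{N_T^h}))\Big].$$ *)

theory Defs
  imports "HOL-Probability.Probability"
begin

section \<open>Probability measures and the Wasserstein-1 distance\<close>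

abbreviation prob_measures :: "'a::topological_space measure set" where
  "prob_measures \<equiv> space (prob_algebra borel)"

definition law :: "'w measure \<Rightarrow> ('w \<Rightarrow> 'a::topological_space) \<Rightarrow> 'a measure" where
  "law M Y = distr M borel Y"

definition couplings :: "'a::topological_space measure \<Rightarrow> 'a measure \<Rightarrow> ('a \<times> 'a) measure set" where
  "couplings \<mu> \<nu> = {\<pi>. sets \<pi> = sets (borel \<Otimes>\<^sub>M borel) \<and> distr \<pi> borel fst = \<mu> \<and> distr \<pi> borel snd = \<nu>}"

text \<open>The distance takes values in the extended reals, since it is infinite between
  some pairs of measures that lack a first moment.\<close>

definition W1 :: "'a::metric_space measure \<Rightarrow> 'a measure \<Rightarrow> ennreal" where
  "W1 \<mu> \<nu> = (INF \<pi>\<in>couplings \<mu> \<nu>. \<integral>\<^sup>+ p. ennreal (dist (fst p) (snd p)) \<partial>\<pi>)"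

definition W1_topology :: "'a::metric_space measure topology" where
  "W1_topology = topology (\<lambda>S. S \<subseteq> prob_measures \<and>
     (\<forall>\<mu>\<in>S. \<exists>\<epsilon>>0. \<forall>\<nu>\<in>prob_measures. W1 \<mu> \<nu> < \<epsilon> \<longrightarrow> \<nu> \<in> S))"

lemma openin_W1_topology:
  "openin W1_topology S \<longleftrightarrow> S \<subseteq> prob_measures \<and>
     (\<forall>\<mu>\<in>S. \<exists>\<epsilon>>0. \<forall>\<nu>\<in>prob_measures. W1 \<mu> \<nu> < \<epsilon> \<longrightarrow> \<nu> \<in> S)"
proof -
  define P where "P = (prob_measures :: 'a measure set)"
  define L where "L = (\<lambda>S. S \<subseteq> P \<and> (\<forall>\<mu>\<in>S. \<exists>\<epsilon>>0. \<forall>\<nu>\<in>P. W1 \<mu> \<nu> < \<epsilon> \<longrightarrow> \<nu> \<in> S))"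
  have "L (S \<inter> S')" if S: "L S" and S': "L S'" for S S'
    unfolding L_def
  proof (intro conjI ballI)
    show "S \<inter> S' \<subseteq> P" using S unfolding L_def by auto
    fix \<mu> assume \<mu>: "\<mu> \<in> S \<inter> S'"
    obtain e where e: "e > 0" "\<forall>\<nu>\<in>P. W1 \<mu> \<nu> < e \<longrightarrow> \<nu> \<in> S"
      using S \<mu> unfolding L_def by auto
    obtain e' where e': "e' > 0" "\<forall>\<nu>\<in>P. W1 \<mu> \<nu> < e' \<longrightarrow> \<nu> \<in> S'"
      using S' \<mu> unfolding L_def by auto
    show "\<exists>\<epsilon>>0. \<forall>\<nu>\<in>P. W1 \<mu> \<nu> < \<epsilon> \<longrightarrow> \<nu> \<in> S \<inter> S'"
      using e e' by (intro exI[of _ "min e e'"]) simp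
  qed
  moreover have "L (\<Union>\<K>)" if K: "\<forall>S\<in>\<K>. L S" for \<K>
    unfolding L_def
  proof (intro conjI ballI)
    show "\<Union>\<K> \<subseteq> P" using K unfolding L_def by auto
    fix \<mu> assume "\<mu> \<in> \<Union>\<K>"
    then obtain S where S: "S \<in> \<K>" "\<mu> \<in> S" by auto
    then have "L S" using K by auto
    then obtain e where e: "e > 0" "\<forall>\<nu>\<in>P. W1 \<mu> \<nu> < e \<longrightarrow> \<nu> \<in> S"
      using S(2) unfolding L_def by auto
    show "\<exists>\<epsilon>>0. \<forall>\<nu>\<in>P. W1 \<mu> \<nu> < \<epsilon> \<longrightarrow> \<nu> \<in> \<Union>\<K>"
      using e S(1) by (intro exI[of _ e]) auto
  qed
  ultimately have "istopology L" by (simp add: istopology_def)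
  then show ?thesis unfolding W1_topology_def P_def[symmetric] L_def[symmetric]
    by (simp add: topology_inverse' L_def)
qed

definition jointly_continuous ::
  "('a::metric_space \<Rightarrow> 'a measure \<Rightarrow> 'u::topological_space \<Rightarrow> 'b::topological_space) \<Rightarrow> bool" where
  "jointly_continuous f \<longleftrightarrow>
     continuous_map (prod_topology euclidean (prod_topology W1_topology euclidean)) euclidean
       (\<lambda>(x, \<mu>, \<zeta>). f x \<mu> \<zeta>)"

definition relaxed ::
  "('a \<Rightarrow> 'a measure \<Rightarrow> 'u \<Rightarrow> 'b::{banach, second_countable_topology})
     \<Rightarrow> 'a \<Rightarrow> 'a measure \<Rightarrow> 'u measure \<Rightarrow> 'b" where
  "relaxed f x \<mu> v = (\<integral>\<zeta>. f x \<mu> \<zeta> \<partial>v)"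

section \<open>Filtered probability spaces and Brownian motion\<close>

text \<open>The time set is $[0,\infty)$. The library locale \<open>filtration\<close> is indexed by the whole type
  \<^typ>\<open>real\<close>; a filtration on $[0,\infty)$ is extended by its value at 0.\<close>

definition usual_conditions :: "'w measure \<Rightarrow> (real \<Rightarrow> 'w measure) \<Rightarrow> bool" where
  "usual_conditions M F \<longleftrightarrow>
     prob_space M \<and> complete_measure M \<and> filtration (space M) F \<and>
     (\<forall>t. subalgebra M (F t)) \<and> null_sets M \<subseteq> sets (F 0) \<and>
     (\<forall>t\<ge>0. sets (F t) = (\<Inter>u\<in>{t<..}. sets (F u)))"

definition preimages :: "'w measure \<Rightarrow> 'b measure \<Rightarrow> ('w \<Rightarrow> 'b) \<Rightarrow> 'w set set" where
  "preimages M N Y = {Y -` A \<inter> space M |A. A \<in> sets N}"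

definition standard_Brownian_motion ::
  "'w measure \<Rightarrow> (real \<Rightarrow> 'w measure) \<Rightarrow> (real \<Rightarrow> 'w \<Rightarrow> real ^ 'n) \<Rightarrow> bool" where
  "standard_Brownian_motion M F W \<longleftrightarrow>
     (\<forall>t\<ge>0. W t \<in> borel_measurable (F t)) \<and>
     (AE \<omega> in M. W 0 \<omega> = 0) \<and>
     (AE \<omega> in M. continuous_on {0..} (\<lambda>t. W t \<omega>)) \<and>
     (\<forall>s t. 0 \<le> s \<and> s < t \<longrightarrow>
        prob_space.indep_set M (preimages M borel (\<lambda>\<omega>. W t \<omega> - W s \<omega>)) (sets (F s)) \<and>
        prob_space.indep_vars M (\<lambda>_. borel) (\<lambda>i \<omega>. (W t \<omega> - W s \<omega>) $ i) UNIV \<and>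
        (\<forall>i. distributed M lborel (\<lambda>\<omega>. (W t \<omega> - W s \<omega>) $ i) (normal_density 0 (sqrt (t - s)))))"

section \<open>Policies\<close>

text \<open>The completion of $\sigma(X_0, \mathscr L(X_0), m_r, W_r : r \le s)$ is formed with the null
  sets of the complete space \<open>M\<close>. The \<open>\<sigma>\<close>-algebra of \<open>prob_algebra borel\<close>, generated by the
  evaluations $v \mapsto v(A)$, is the Borel \<open>\<sigma>\<close>-algebra of the weak topology over a compact
  metric space.\<close>

definition policy_filtration ::
  "'w measure \<Rightarrow> (real \<Rightarrow> 'w \<Rightarrow> 'a::topological_space) \<Rightarrow> ('w \<Rightarrow> 'a)
     \<Rightarrow> (real \<Rightarrow> 'w \<Rightarrow> 'u::topological_space measure) \<Rightarrow> real \<Rightarrow> 'w measure" where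
  "policy_filtration M W X0 m s = sigma (space M)
     (preimages M borel X0 \<union>
      preimages M (prob_algebra borel) (\<lambda>_. law M X0) \<union>
      (\<Union>r\<in>{0..s}. preimages M (prob_algebra borel) (m r) \<union> preimages M borel (W r)) \<union>
      null_sets M)"

definition policy :: "'w measure \<Rightarrow> (real \<Rightarrow> 'w \<Rightarrow> 'u::topological_space measure) \<Rightarrow> bool" where
  "policy M m \<longleftrightarrow> (\<forall>t\<ge>0. m t \<in> measurable M (prob_algebra borel))"

definition non_anticipative ::
  "'w measure \<Rightarrow> (real \<Rightarrow> 'w \<Rightarrow> 'a::real_normed_vector) \<Rightarrow> ('w \<Rightarrow> 'a)
     \<Rightarrow> (real \<Rightarrow> 'w \<Rightarrow> 'u::topological_space measure) \<Rightarrow> bool" where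
  "non_anticipative M W X0 m \<longleftrightarrow>
     (\<forall>s t. 0 \<le> s \<and> s < t \<longrightarrow>
        prob_space.indep_set M (preimages M borel (\<lambda>\<omega>. W t \<omega> - W s \<omega>))
          (sets (policy_filtration M W X0 m s)))"

definition piecewise_constant ::
  "'w measure \<Rightarrow> real \<Rightarrow> (real \<Rightarrow> 'w \<Rightarrow> 'u measure) \<Rightarrow> bool" where
  "piecewise_constant M h m \<longleftrightarrow>
     (\<forall>k::nat. \<forall>t\<in>{real k * h ..< real (Suc k) * h}. \<forall>\<omega>\<in>space M. m t \<omega> = m (real k * h) \<omega>)"

section \<open>The Ito integral of square-integrable integrands\<close>

text \<open>The triple \<open>(N, \<tau>, \<xi>)\<close> encodes the simple process
  $\sum_{i<N} \xi_i 1_{(\tau_i, \tau_{i+1}]}$.\<close>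

definition simple_process ::
  "'w measure \<Rightarrow> (real \<Rightarrow> 'w measure) \<Rightarrow> nat \<Rightarrow> (nat \<Rightarrow> real)
     \<Rightarrow> (nat \<Rightarrow> 'w \<Rightarrow> real ^ 'n ^ 'k) \<Rightarrow> bool" where
  "simple_process M G N \<tau> \<xi> \<longleftrightarrow>
     0 \<le> \<tau> 0 \<and> (\<forall>i<N. \<tau> i \<le> \<tau> (Suc i)) \<and>
     (\<forall>i<N. \<xi> i \<in> borel_measurable (G (\<tau> i)) \<and> bounded (\<xi> i ` space M))"

definition simple_value ::
  "nat \<Rightarrow> (nat \<Rightarrow> real) \<Rightarrow> (nat \<Rightarrow> 'w \<Rightarrow> real ^ 'n ^ 'k) \<Rightarrow> real \<Rightarrow> 'w \<Rightarrow> real ^ 'n ^ 'k" where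
  "simple_value N \<tau> \<xi> s \<omega> = (\<Sum>i<N. indicator {\<tau> i <.. \<tau> (Suc i)} s *\<^sub>R \<xi> i \<omega>)"

definition simple_integral ::
  "(real \<Rightarrow> 'w \<Rightarrow> real ^ 'n) \<Rightarrow> nat \<Rightarrow> (nat \<Rightarrow> real) \<Rightarrow> (nat \<Rightarrow> 'w \<Rightarrow> real ^ 'n ^ 'k)
     \<Rightarrow> real \<Rightarrow> 'w \<Rightarrow> real ^ 'k" where
  "simple_integral W N \<tau> \<xi> t \<omega> = (\<Sum>i<N. \<xi> i \<omega> *v (W (min t (\<tau> (Suc i))) \<omega> - W (min t (\<tau> i)) \<omega>))"

definition progressively_measurable ::
  "(real \<Rightarrow> 'w measure) \<Rightarrow> real \<Rightarrow> (real \<Rightarrow> 'w \<Rightarrow> 'b::topological_space) \<Rightarrow> bool" where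
  "progressively_measurable G t H \<longleftrightarrow>
     (\<forall>u\<in>{0..t}. (\<lambda>(s, \<omega>). H s \<omega>) \<in> borel_measurable (restrict_space borel {0..u} \<Otimes>\<^sub>M G u))"

text \<open>\<open>I\<close> is a version of $\int_0^t H_s\,dW_s$: the $L^2$ limit of the integrals of simple processes
  that approximate $H$ in $L^2([0,t] \times \Omega)$.\<close>

definition has_Ito_integral ::
  "'w measure \<Rightarrow> (real \<Rightarrow> 'w measure) \<Rightarrow> (real \<Rightarrow> 'w \<Rightarrow> real ^ 'n)
     \<Rightarrow> (real \<Rightarrow> 'w \<Rightarrow> real ^ 'n ^ 'k) \<Rightarrow> real \<Rightarrow> ('w \<Rightarrow> real ^ 'k) \<Rightarrow> bool" where
  "has_Ito_integral M G W H t I \<longleftrightarrow>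
     progressively_measurable G t H \<and> I \<in> borel_measurable M \<and>
     (\<exists>N \<tau> \<xi>.
        (\<forall>j::nat. simple_process M G (N j) (\<tau> j) (\<xi> j)) \<and>
        (\<lambda>j. \<integral>\<^sup>+ \<omega>. (\<integral>\<^sup>+ s\<in>{0..t}. ennreal ((norm (H s \<omega> - simple_value (N j) (\<tau> j) (\<xi> j) s \<omega>))\<^sup>2) \<partial>lborel) \<partial>M)
           \<longlonglongrightarrow> 0 \<and>
        (\<lambda>j. \<integral>\<^sup>+ \<omega>. ennreal ((norm (I \<omega> - simple_integral W (N j) (\<tau> j) (\<xi> j) t \<omega>))\<^sup>2) \<partial>M)
           \<longlonglongrightarrow> 0)"

section \<open>Controlled dynamics and costs\<close>

text \<open>\<open>X\<close> solves $dX_t = b(X_t, \mathscr L(X_t), m_t)\,dt + \sigma(X_t, \mathscr L(X_t))\,dW_t$,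
  $X_0 = x$, on $[0,T]$, driven by \<open>W\<close> and the policy \<open>m\<close> and adapted to their completed
  filtration (strong solution).\<close>

definition controlled_solution ::
  "'w measure \<Rightarrow> (real \<Rightarrow> 'w \<Rightarrow> real ^ 'n)
     \<Rightarrow> (real ^ 'n \<Rightarrow> (real ^ 'n) measure \<Rightarrow> 'u::topological_space \<Rightarrow> real ^ 'n)
     \<Rightarrow> (real ^ 'n \<Rightarrow> (real ^ 'n) measure \<Rightarrow> real ^ 'n ^ 'n)
     \<Rightarrow> real \<Rightarrow> real ^ 'n \<Rightarrow> (real \<Rightarrow> 'w \<Rightarrow> 'u measure) \<Rightarrow> (real \<Rightarrow> 'w \<Rightarrow> real ^ 'n) \<Rightarrow> bool" where
  "controlled_solution M W b \<sigma> T x m X \<longleftrightarrow>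
     (let G = policy_filtration M W (\<lambda>_. x) m;
          drift = (\<lambda>s \<omega>. relaxed b (X s \<omega>) (law M (X s)) (m s \<omega>))
      in (\<forall>t\<in>{0..T}. X t \<in> borel_measurable (G t)) \<and>
         (\<forall>\<omega>\<in>space M. continuous_on {0..T} (\<lambda>t. X t \<omega>)) \<and>
         (AE \<omega> in M. X 0 \<omega> = x) \<and>
         (\<forall>t\<in>{0..T}. \<exists>I.
            has_Ito_integral M G W (\<lambda>s \<omega>. \<sigma> (X s \<omega>) (law M (X s))) t I \<and>
            (AE \<omega> in M. set_integrable lborel {0..t} (\<lambda>s. drift s \<omega>) \<and>
               X t \<omega> = x + (LINT s:{0..t}|lborel. drift s \<omega>) + I \<omega>)))"

definition continuous_cost ::
  "'w measure \<Rightarrow> (real ^ 'n \<Rightarrow> (real ^ 'n) measure \<Rightarrow> 'u \<Rightarrow> real)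
     \<Rightarrow> (real ^ 'n \<Rightarrow> (real ^ 'n) measure \<Rightarrow> real)
     \<Rightarrow> real \<Rightarrow> (real \<Rightarrow> 'w \<Rightarrow> 'u measure) \<Rightarrow> (real \<Rightarrow> 'w \<Rightarrow> real ^ 'n) \<Rightarrow> real" where
  "continuous_cost M c c_T T m X =
     (\<integral>\<omega>. (LINT t:{0..T}|lborel. relaxed c (X t \<omega>) (law M (X t)) (m t \<omega>))
          + c_T (X T \<omega>) (law M (X T)) \<partial>M)"

primrec euler_maruyama ::
  "'w measure \<Rightarrow> (real \<Rightarrow> 'w \<Rightarrow> real ^ 'n)
     \<Rightarrow> (real ^ 'n \<Rightarrow> (real ^ 'n) measure \<Rightarrow> 'u \<Rightarrow> real ^ 'n)
     \<Rightarrow> (real ^ 'n \<Rightarrow> (real ^ 'n) measure \<Rightarrow> real ^ 'n ^ 'n)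
     \<Rightarrow> real \<Rightarrow> real ^ 'n \<Rightarrow> (real \<Rightarrow> 'w \<Rightarrow> 'u measure) \<Rightarrow> nat \<Rightarrow> 'w \<Rightarrow> real ^ 'n" where
  "euler_maruyama M W b \<sigma> h x m 0 = (\<lambda>\<omega>. x)"
| "euler_maruyama M W b \<sigma> h x m (Suc k) =
     (let Y = euler_maruyama M W b \<sigma> h x m k
      in (\<lambda>\<omega>. Y \<omega> + h *\<^sub>R relaxed b (Y \<omega>) (law M Y) (m (real k * h) \<omega>)
             + \<sigma> (Y \<omega>) (law M Y) *v (W (real (Suc k) * h) \<omega> - W (real k * h) \<omega>)))"

definition num_steps :: "real \<Rightarrow> real \<Rightarrow> nat" where
  "num_steps T h = Sup {n::nat. real n * h \<le> T}"

definition discrete_cost ::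
  "'w measure \<Rightarrow> (real \<Rightarrow> 'w \<Rightarrow> real ^ 'n)
     \<Rightarrow> (real ^ 'n \<Rightarrow> (real ^ 'n) measure \<Rightarrow> 'u \<Rightarrow> real ^ 'n)
     \<Rightarrow> (real ^ 'n \<Rightarrow> (real ^ 'n) measure \<Rightarrow> real ^ 'n ^ 'n)
     \<Rightarrow> (real ^ 'n \<Rightarrow> (real ^ 'n) measure \<Rightarrow> 'u \<Rightarrow> real)
     \<Rightarrow> (real ^ 'n \<Rightarrow> (real ^ 'n) measure \<Rightarrow> real)
     \<Rightarrow> real \<Rightarrow> real \<Rightarrow> real ^ 'n \<Rightarrow> (real \<Rightarrow> 'w \<Rightarrow> 'u measure) \<Rightarrow> real" where
  "discrete_cost M W b \<sigma> c c_T T h x m =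
     (let X = euler_maruyama M W b \<sigma> h x m; N = num_steps T h
      in \<integral>\<omega>. (\<Sum>k<N. relaxed c (X k \<omega>) (law M (X k)) (m (real k * h) \<omega>) * h)
              + c_T (X N \<omega>) (law M (X N)) \<partial>M)"

end

theory Submission
  imports Defs
begin

text \<open>
  The cost is a Lipschitz function of the state and of its law, so the theorem reduces to the strong
  error of the Euler--Maruyama scheme $Y$ driven by the same policy and the same Brownian motion:
  $E|X_s - Y_k|^2 \le C h$ for $s$ in the $k$-th grid cell. Couplings make the law argument
  harmless: $(X_s, Y_k)$ couples the two laws, hence $W_1(\mathscr L(X_s), \mathscr L(Y_k))^2$ is at
  most $E|X_s - Y_k|^2$. The policy is constant on each cell and enters both equations with the same
  value, so its difference never has to be estimated.

  The strong error has two ingredients. First, bounded coefficients give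
  $E|X_s - X_r|^2 \le K|s - r|$ (\<open>solution_increment_le\<close>). Second, $X_{kh} - Y_k$ is a drift
  integral plus a stochastic integral of coefficient differences; Cauchy--Schwarz bounds the first, the
  Ito isometry the second, and both are controlled by the errors of the earlier grid
  points (\<open>euler_error_recursion\<close>). The discrete Gronwall argument closes the
  recursion (\<open>euler_strong_error\<close>). The cost then loses a term of order $h^{1/2}$ for the
  running cost on complete cells, one for the terminal cost, and the incomplete last cell, whose
  length is at most $\min(h, T) \le \sqrt{Th}$ (\<open>cost_error\<close>).

  The Ito integral is defined as an $L^2$ limit of integrals of simple processes, with a
  different approximating sequence for each upper limit $t$. The isometry is therefore proved for
  finite sums $\sum_i \xi_i (W_{b_i} - W_{a_i})$ over arbitrary, possibly overlapping intervals: this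
  class contains the difference of any two simple integrals, and also the noise of the Euler
  scheme. The computation rests on the covariance of two weighted increments, which is
  proportional to the length of the overlap of their intervals (\<open>increment_covariance\<close>). It passes
  to limits in \<open>ito_limit_isometry\<close> up to a factor 9, which only enlarges the constant. The filtration
  is the one generated by the policy: non-anticipation says precisely that the increments of $W$ are
  independent of it.

  Second moments are integrals in \<open>ennreal\<close>, so that no finiteness has to be known in advance.
\<close>

section \<open>Squares and Cauchy--Schwarz in the extended reals\<close>

lemma norm_add_squared_le:
  fixes x y :: "'a::real_normed_vector"
  shows "ennreal ((norm (x + y))\<^sup>2) \<le> 2 * (ennreal ((norm x)\<^sup>2) + ennreal ((norm y)\<^sup>2))"
proof -
  have "(norm (x + y))\<^sup>2 \<le> (norm x + norm y)\<^sup>2"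
    by (intro power_mono norm_triangle_ineq) simp
  also have "\<dots> \<le> 2 * ((norm x)\<^sup>2 + (norm y)\<^sup>2)"
    using sum_squares_bound[of "norm x" "norm y"] by (simp add: power2_sum)
  finally have "ennreal ((norm (x + y))\<^sup>2) \<le> ennreal (2 * ((norm x)\<^sup>2 + (norm y)\<^sup>2))"
    by (rule ennreal_leI)
  then show ?thesis by (simp add: ennreal_mult' ennreal_plus[symmetric] del: ennreal_plus distrib_left_numeral)
qed

lemma norm_add3_squared_le:
  fixes x y z :: "'a::real_normed_vector"
  shows "ennreal ((norm (x + y + z))\<^sup>2)
    \<le> 3 * (ennreal ((norm x)\<^sup>2) + ennreal ((norm y)\<^sup>2) + ennreal ((norm z)\<^sup>2))"
proof -
  let ?a = "norm x" and ?b = "norm y" and ?c = "norm z"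
  have "(norm (x + y + z))\<^sup>2 \<le> (?a + ?b + ?c)\<^sup>2"
    by (intro power_mono norm_triangle_le add_right_mono norm_triangle_ineq) auto
  also have "\<dots> \<le> 3 * (?a\<^sup>2 + ?b\<^sup>2 + ?c\<^sup>2)"
    using sum_squares_bound[of ?a ?b] sum_squares_bound[of ?a ?c] sum_squares_bound[of ?b ?c]
    by (simp add: power2_eq_square algebra_simps)
  finally have "ennreal ((norm (x + y + z))\<^sup>2) \<le> ennreal (3 * (?a\<^sup>2 + ?b\<^sup>2 + ?c\<^sup>2))"
    by (rule ennreal_leI)
  then show ?thesis by (simp add: ennreal_mult' ennreal_plus[symmetric] del: ennreal_plus distrib_left_numeral)
qed

lemma ennreal_add_squared_le:
  fixes a b :: ennreal
  shows "(a + b)\<^sup>2 \<le> 2 * (a\<^sup>2 + b\<^sup>2)"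
proof (cases "a = \<top> \<or> b = \<top>")
  case True
  then show ?thesis by (auto simp: power2_eq_square ennreal_mult_top ennreal_top_mult)
next
  case False
  then obtain r s where rs: "a = ennreal r" "r \<ge> 0" "b = ennreal s" "s \<ge> 0"
    by (metis ennreal_cases)
  have "(r + s)\<^sup>2 \<le> 2 * (r\<^sup>2 + s\<^sup>2)"
    using sum_squares_bound[of r s] by (simp add: power2_sum)
  then have "ennreal ((r + s)\<^sup>2) \<le> ennreal (2 * (r\<^sup>2 + s\<^sup>2))" by (rule ennreal_leI)
  then show ?thesis using rs
    by (simp add: ennreal_mult' ennreal_power[symmetric])
qed

lemma nn_integral_squared_le:
  assumes [measurable]: "A \<in> sets M" "f \<in> borel_measurable M"
  shows "(\<integral>\<^sup>+ x\<in>A. f x \<partial>M)\<^sup>2 \<le> emeasure M A * (\<integral>\<^sup>+ x\<in>A. (f x)\<^sup>2 \<partial>M)"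
proof -
  have "(\<integral>\<^sup>+ x\<in>A. f x \<partial>M) = (\<integral>\<^sup>+ x. indicator A x * (f x * indicator A x) \<partial>M)"
    by (intro nn_integral_cong) (simp split: split_indicator)
  then have "(\<integral>\<^sup>+ x\<in>A. f x \<partial>M)\<^sup>2
      \<le> (\<integral>\<^sup>+ x. (indicator A x)\<^sup>2 \<partial>M) * (\<integral>\<^sup>+ x. (f x * indicator A x)\<^sup>2 \<partial>M)"
    using Cauchy_Schwarz_nn_integral[of "indicator A" M "\<lambda>x. f x * indicator A x"] by simp
  moreover have "(\<integral>\<^sup>+ x. (indicator A x)\<^sup>2 \<partial>M) = emeasure M A"
    by (simp add: power2_eq_square flip: indicator_inter_arith)
  moreover have "(\<integral>\<^sup>+ x. (f x * indicator A x)\<^sup>2 \<partial>M) = (\<integral>\<^sup>+ x\<in>A. (f x)\<^sup>2 \<partial>M)"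
    by (intro nn_integral_cong) (simp split: split_indicator)
  ultimately show ?thesis by simp
qed

lemma (in prob_space) nn_integral_squared_le_second_moment:
  assumes [measurable]: "f \<in> borel_measurable M"
  shows "(\<integral>\<^sup>+ x. f x \<partial>M)\<^sup>2 \<le> (\<integral>\<^sup>+ x. (f x)\<^sup>2 \<partial>M)"
  using Cauchy_Schwarz_nn_integral[of f M "\<lambda>_. 1"] by (simp add: emeasure_space_1)

section \<open>Step functions on the time grid\<close>

text \<open>The index $k$ of the cell $[kh, (k+1)h)$ that contains $s \<ge> 0$; negative times are sent
  to the first cell.\<close>

definition grid_index :: "real \<Rightarrow> real \<Rightarrow> nat" where
  "grid_index h s = nat \<lfloor>s / h\<rfloor>"

lemma grid_index_eq:
  assumes "h > 0" "real j * h \<le> s" "s < real (Suc j) * h"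
  shows "grid_index h s = j"
proof -
  have "real j \<le> s / h" "s / h < real j + 1"
    using assms by (simp_all add: pos_le_divide_eq pos_divide_less_eq add.commute)
  then have "\<lfloor>s / h\<rfloor> = int j" by (intro floor_unique) auto
  then show ?thesis by (simp add: grid_index_def)
qed

lemma grid_index_bounds:
  assumes "h > 0" "0 \<le> s"
  shows "real (grid_index h s) * h \<le> s" "s < real (Suc (grid_index h s)) * h"
proof -
  have "real (grid_index h s) \<le> s / h" "s / h < real (grid_index h s) + 1"
    using assms by (auto simp: grid_index_def)
  then show "real (grid_index h s) * h \<le> s" "s < real (Suc (grid_index h s)) * h"
    using assms by (simp_all add: pos_le_divide_eq pos_divide_less_eq add.commute)
qed

lemma grid_index_measurable [measurable]: "grid_index h \<in> measurable borel (count_space UNIV)"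
  unfolding grid_index_def by measurable

lemma step_function_eq_sum:
  fixes f :: "nat \<Rightarrow> 'b::real_vector"
  assumes "h > 0"
  shows "indicator {0..<real k * h} s *\<^sub>R f (grid_index h s)
    = (\<Sum>j<k. indicator {real j * h..<real (Suc j) * h} s *\<^sub>R f j)"
proof (induction k)
  case (Suc k)
  have kh: "real k * h \<le> real (Suc k) * h" "0 \<le> real k * h" using assms by auto
  consider "s < real k * h" | "real k * h \<le> s" "s < real (Suc k) * h" | "real (Suc k) * h \<le> s"
    by linarith
  then show ?case
  proof cases
    case 1 then show ?thesis using Suc kh by (auto simp: indicator_def)
  next
    case 2
    then have "grid_index h s = k" using assms by (rule_tac grid_index_eq)
    then show ?thesis using Suc 2 kh by (auto simp: indicator_def)
  next
    case 3 then show ?thesis using Suc kh by (auto simp: indicator_def)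
  qed
qed simp

lemma nn_integral_step_function:
  assumes "h > 0"
  shows "(\<integral>\<^sup>+ s\<in>{0..<real k * h}. f (grid_index h s) \<partial>lborel) = (\<Sum>j<k. ennreal h * f j)"
proof (induction k)
  case (Suc k)
  have kh: "real k * h \<le> real (Suc k) * h" "0 \<le> real k * h" using assms by auto
  have "(\<integral>\<^sup>+ s\<in>{0..<real (Suc k) * h}. f (grid_index h s) \<partial>lborel)
      = (\<integral>\<^sup>+ s. f (grid_index h s) * indicator {0..<real k * h} s
                 + f k * indicator {real k * h..<real (Suc k) * h} s \<partial>lborel)"
  proof (intro nn_integral_cong)
    fix s
    consider "s < real k * h" | "real k * h \<le> s" "s < real (Suc k) * h" | "real (Suc k) * h \<le> s"
      by linarith
    then show "f (grid_index h s) * indicator {0..<real (Suc k) * h} s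
      = f (grid_index h s) * indicator {0..<real k * h} s
                 + f k * indicator {real k * h..<real (Suc k) * h} s"
    proof cases
      case 1 then show ?thesis using kh by (auto simp: indicator_def)
    next
      case 2
      then have "grid_index h s = k" using assms by (rule_tac grid_index_eq)
      then show ?thesis using 2 kh by (auto simp: indicator_def)
    next
      case 3 then show ?thesis using kh by (auto simp: indicator_def)
    qed
  qed
  also have "\<dots> = (\<integral>\<^sup>+ s\<in>{0..<real k * h}. f (grid_index h s) \<partial>lborel)
      + (\<integral>\<^sup>+ s. f k * indicator {real k * h..<real (Suc k) * h} s \<partial>lborel)"
    by (intro nn_integral_add) auto
  also have "(\<integral>\<^sup>+ s. f k * indicator {real k * h..<real (Suc k) * h} s \<partial>lborel) = f k * ennreal h"
    using kh by (subst nn_integral_cmult_indicator) (auto simp: algebra_simps)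
  finally show ?case using Suc by (simp add: mult.commute)
qed simp

lemma
  fixes f :: "nat \<Rightarrow> 'b::{banach, second_countable_topology}"
  assumes "h > 0"
  shows set_integrable_step_function: "set_integrable lborel {0..<real k * h} (\<lambda>s. f (grid_index h s))"
    and set_integral_step_function:
      "(LINT s:{0..<real k * h}|lborel. f (grid_index h s)) = (\<Sum>j<k. h *\<^sub>R f j)"
proof -
  have le: "real j * h \<le> real (Suc j) * h" for j using assms by simp
  have int: "integrable lborel (\<lambda>s. indicator {real j * h..<real (Suc j) * h} s *\<^sub>R f j)" for j
    using le[of j] by (intro integrable_indicator) auto
  show "set_integrable lborel {0..<real k * h} (\<lambda>s. f (grid_index h s))"
    unfolding set_integrable_def step_function_eq_sum[OF assms] by (intro Bochner_Integration.integrable_sum int)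
  have "(LINT s:{0..<real k * h}|lborel. f (grid_index h s))
      = (\<Sum>j<k. LINT s|lborel. indicator {real j * h..<real (Suc j) * h} s *\<^sub>R f j)"
    unfolding set_lebesgue_integral_def step_function_eq_sum[OF assms]
    using int by (intro Bochner_Integration.integral_sum) auto
  also have "\<dots> = (\<Sum>j<k. h *\<^sub>R f j)"
  proof (intro sum.cong refl)
    fix j
    have "(LINT s|lborel. indicator {real j * h..<real (Suc j) * h} s *\<^sub>R f j)
      = measure lborel {real j * h..<real (Suc j) * h} *\<^sub>R f j"
      using le[of j] by (subst integral_scaleR_left) simp_all
    also have "measure lborel {real j * h..<real (Suc j) * h} = h"
      using le[of j] by (simp del: of_nat_Suc) (simp add: algebra_simps)
    finally show "(LINT s|lborel. indicator {real j * h..<real (Suc j) * h} s *\<^sub>R f j) = h *\<^sub>R f j" .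
  qed
  finally show "(LINT s:{0..<real k * h}|lborel. f (grid_index h s)) = (\<Sum>j<k. h *\<^sub>R f j)" .
qed

section \<open>Measurability of Caratheodory functions\<close>

text \<open>\<open>Y\<close> is a pointwise limit of functions with finitely many values, and on each level set the
  parameter is frozen. The parameter is sometimes the state and sometimes the time; with
  \<open>Y = snd\<close> the lemma turns continuity in time into joint measurability.\<close>

lemma borel_measurable_Caratheodory:
  fixes f :: "'e::{metric_space, second_countable_topology} \<Rightarrow> 'b \<Rightarrow> 'c::metric_space"
  assumes cont: "\<And>\<omega>. \<omega> \<in> space N \<Longrightarrow> continuous_on UNIV (\<lambda>x. f x \<omega>)"
    and meas: "\<And>x. f x \<in> borel_measurable N"
    and Y: "Y \<in> borel_measurable N"
  shows "(\<lambda>\<omega>. f (Y \<omega>) \<omega>) \<in> borel_measurable N"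
proof -
  obtain S where S: "\<And>i. simple_function N (S i)"
      "\<And>\<omega>. \<omega> \<in> space N \<Longrightarrow> (\<lambda>i. S i \<omega>) \<longlonglongrightarrow> Y \<omega>"
    using borel_measurable_implies_sequence_metric[OF Y, of undefined] by blast
  show ?thesis
  proof (rule borel_measurable_LIMSEQ_metric)
    fix i
    show "(\<lambda>\<omega>. f (S i \<omega>) \<omega>) \<in> borel_measurable N"
    proof (rule measurable_compose_countable'[where f = f and I = "S i ` space N"])
      show "S i \<in> measurable N (count_space (S i ` space N))"
        using S(1)[of i] unfolding simple_function_def
        by (subst measurable_count_space_eq2) auto
      show "countable (S i ` space N)"
        using S(1)[of i] by (simp add: simple_function_def countable_finite)
    qed (rule meas)
  next
    fix \<omega> assume "\<omega> \<in> space N"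
    then show "(\<lambda>i. f (S i \<omega>) \<omega>) \<longlonglongrightarrow> f (Y \<omega>) \<omega>"
      by (intro continuous_on_tendsto_compose[OF cont S(2)]) auto
  qed
qed

section \<open>Couplings of laws\<close>

lemma law_in_prob_measures:
  assumes "prob_space M" "Y \<in> borel_measurable M"
  shows "law M Y \<in> prob_measures"
  using assms by (auto simp: law_def space_prob_algebra intro: prob_space.prob_space_distr)

text \<open>The joint law of \<open>X\<close> and \<open>Y\<close> is one of the couplings over which the infimum is taken.\<close>

lemma W1_law_le:
  fixes X Y :: "'w \<Rightarrow> 'a::{metric_space, second_countable_topology}"
  assumes [measurable]: "X \<in> borel_measurable M" "Y \<in> borel_measurable M"
  shows "W1 (law M X) (law M Y) \<le> (\<integral>\<^sup>+ \<omega>. ennreal (dist (X \<omega>) (Y \<omega>)) \<partial>M)"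
proof -
  let ?\<pi> = "distr M (borel \<Otimes>\<^sub>M borel) (\<lambda>\<omega>. (X \<omega>, Y \<omega>))"
  have "?\<pi> \<in> couplings (law M X) (law M Y)"
    by (auto simp: couplings_def law_def distr_distr comp_def)
  then have "W1 (law M X) (law M Y) \<le> (\<integral>\<^sup>+ p. ennreal (dist (fst p) (snd p)) \<partial>?\<pi>)"
    unfolding W1_def by (rule INF_lower)
  also have "\<dots> = (\<integral>\<^sup>+ \<omega>. ennreal (dist (X \<omega>) (Y \<omega>)) \<partial>M)"
    by (subst nn_integral_distr) auto
  finally show ?thesis .
qed

lemma W1_self:
  fixes \<mu> :: "'a::{metric_space, second_countable_topology} measure"
  assumes "\<mu> \<in> prob_measures"
  shows "W1 \<mu> \<mu> = 0"
proof -
  have sets [measurable_cong]: "sets \<mu> = sets borel" using assms by (simp add: space_prob_algebra)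
  have "law \<mu> (\<lambda>x. x) = \<mu>" unfolding law_def by (rule distr_id2) (rule sets[symmetric])
  then show ?thesis using W1_law_le[of "\<lambda>x. x" \<mu> "\<lambda>x. x"] by simp
qed

lemma W1_law_squared_le:
  fixes X Y :: "'w \<Rightarrow> 'a::{real_normed_vector, second_countable_topology}"
  assumes "prob_space M" and [measurable]: "X \<in> borel_measurable M" "Y \<in> borel_measurable M"
  shows "(W1 (law M X) (law M Y))\<^sup>2 \<le> (\<integral>\<^sup>+ \<omega>. ennreal ((norm (X \<omega> - Y \<omega>))\<^sup>2) \<partial>M)"
proof -
  interpret prob_space M by fact
  have "(W1 (law M X) (law M Y))\<^sup>2 \<le> (\<integral>\<^sup>+ \<omega>. ennreal (norm (X \<omega> - Y \<omega>)) \<partial>M)\<^sup>2"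
    using W1_law_le[of X M Y] by (intro power_mono) (auto simp: dist_norm)
  also have "\<dots> \<le> (\<integral>\<^sup>+ \<omega>. (ennreal (norm (X \<omega> - Y \<omega>)))\<^sup>2 \<partial>M)"
    by (rule nn_integral_squared_le_second_moment) simp
  finally show ?thesis by (simp add: ennreal_power)
qed

section \<open>Averages over relaxed controls\<close>

text \<open>Every probability measure is a point of the space \<open>W1_topology\<close>, so the section
  $\zeta \mapsto (x, \mu, \zeta)$ is continuous.\<close>

lemma jointly_continuous_imp_measurable:
  assumes "jointly_continuous f" "\<mu> \<in> prob_measures"
  shows "f x \<mu> \<in> borel_measurable borel"
proof -
  have "openin W1_topology (prob_measures :: 'a measure set)"
    by (auto simp: openin_W1_topology intro!: exI[of _ "1::ennreal"])
  then have top: "\<mu> \<in> topspace W1_topology" using assms(2) openin_subset by blast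
  have "continuous_map euclidean (prod_topology euclidean (prod_topology W1_topology euclidean))
     (\<lambda>\<zeta>. (x, \<mu>, \<zeta>))"
    using top by (auto simp: continuous_map_pairwise comp_def)
  from continuous_map_compose[OF this] have "continuous_map euclidean euclidean (f x \<mu>)"
    using assms(1) by (fastforce simp: jointly_continuous_def comp_def)
  then show ?thesis by (intro borel_measurable_continuous_onI) (simp add: continuous_map_iff_continuous2)
qed

lemma prob_measures_D:
  assumes "v \<in> space (prob_algebra N)"
  shows "prob_space v" "sets v = sets N"
  using assms by (auto simp: space_prob_algebra)

lemma integrable_bounded_prob_measures:
  fixes g :: "'u::topological_space \<Rightarrow> 'b::{banach, second_countable_topology}"
  assumes "v \<in> prob_measures" "g \<in> borel_measurable borel" "\<And>\<zeta>. norm (g \<zeta>) \<le> C"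
  shows "integrable v g"
proof -
  interpret prob_space v using assms(1) by (rule prob_measures_D)
  have [measurable_cong]: "sets v = sets borel" using assms(1) by (rule prob_measures_D)
  show ?thesis using assms(2,3) by (intro integrable_const_bound[of g C]) auto
qed

lemma norm_relaxed_le:
  assumes "v \<in> prob_measures" "f x \<mu> \<in> borel_measurable borel" "\<And>\<zeta>. norm (f x \<mu> \<zeta>) \<le> C"
  shows "norm (relaxed f x \<mu> v) \<le> C"
proof -
  interpret prob_space v using assms(1) by (rule prob_measures_D)
  have "norm (relaxed f x \<mu> v) \<le> (\<integral>\<zeta>. norm (f x \<mu> \<zeta>) \<partial>v)" unfolding relaxed_def
    by (rule integral_norm_bound)
  also have "\<dots> \<le> (\<integral>\<zeta>. C \<partial>v)" using integrable_bounded_prob_measures[OF assms]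
    by (intro integral_mono assms(3)) auto
  finally show ?thesis by (simp add: prob_space)
qed

lemma norm_relaxed_diff_le:
  fixes L :: ennreal
  assumes v: "v \<in> prob_measures"
    and f: "f x \<mu> \<in> borel_measurable borel" "\<And>\<zeta>. norm (f x \<mu> \<zeta>) \<le> C"
    and g: "f y \<nu> \<in> borel_measurable borel" "\<And>\<zeta>. norm (f y \<nu> \<zeta>) \<le> C"
    and L: "\<And>\<zeta>. ennreal (norm (f x \<mu> \<zeta> - f y \<nu> \<zeta>)) \<le> L"
  shows "ennreal (norm (relaxed f x \<mu> v - relaxed f y \<nu> v)) \<le> L"
proof (cases L)
  case (real l)
  interpret prob_space v using v by (rule prob_measures_D)
  note int = integrable_bounded_prob_measures[OF v f] integrable_bounded_prob_measures[OF v g]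
  have "norm (relaxed f x \<mu> v - relaxed f y \<nu> v) = norm (\<integral>\<zeta>. f x \<mu> \<zeta> - f y \<nu> \<zeta> \<partial>v)"
    unfolding relaxed_def using int by (subst Bochner_Integration.integral_diff) auto
  also have "\<dots> \<le> (\<integral>\<zeta>. norm (f x \<mu> \<zeta> - f y \<nu> \<zeta>) \<partial>v)" by (rule integral_norm_bound)
  also have "\<dots> \<le> (\<integral>\<zeta>. l \<partial>v)" using int L real by (intro integral_mono) auto
  finally show ?thesis using real by (simp add: prob_space)
qed simp

lemma relaxed_measurable:
  fixes f :: "'a \<Rightarrow> 'a measure \<Rightarrow> 'u::topological_space \<Rightarrow> 'b::{banach, second_countable_topology}"
  assumes "f x \<mu> \<in> borel_measurable borel" "m \<in> measurable N (prob_algebra borel)"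
  shows "(\<lambda>\<omega>. relaxed f x \<mu> (m \<omega>)) \<in> borel_measurable N"
  unfolding relaxed_def
  using measurable_compose[OF measurable_prob_algebraD[OF assms(2)] integral_measurable_subprob_algebra[OF assms(1)]] .

section \<open>Moments of independent Gaussian increments\<close>

text \<open>The relation between a filtration and a Brownian motion on which stochastic integration
  rests. It is used with the filtration generated by a policy, which may differ from the one of the
  underlying filtered space.\<close>

locale adapted_increments = prob_space M
  for M :: "'w measure" and G :: "real \<Rightarrow> 'w measure" and W :: "real \<Rightarrow> 'w \<Rightarrow> real ^ 'n" +
  assumes space_G: "\<And>s. space (G s) = space M"
    and sets_G: "\<And>s. 0 \<le> s \<Longrightarrow> sets (G s) \<subseteq> sets M"
    and G_mono: "\<And>s t. 0 \<le> s \<Longrightarrow> s \<le> t \<Longrightarrow> sets (G s) \<subseteq> sets (G t)"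
    and W_adapted: "\<And>s. 0 \<le> s \<Longrightarrow> W s \<in> borel_measurable (G s)"
    and increments_indep: "\<And>s t. 0 \<le> s \<Longrightarrow> s < t \<Longrightarrow>
      indep_set (preimages M borel (\<lambda>\<omega>. W t \<omega> - W s \<omega>)) (sets (G s))"
    and increments_components: "\<And>s t. 0 \<le> s \<Longrightarrow> s < t \<Longrightarrow>
      indep_vars (\<lambda>_. borel) (\<lambda>i \<omega>. (W t \<omega> - W s \<omega>) $ i) UNIV"
    and increments_normal: "\<And>s t i. 0 \<le> s \<Longrightarrow> s < t \<Longrightarrow>
      distributed M lborel (\<lambda>\<omega>. (W t \<omega> - W s \<omega>) $ i) (normal_density 0 (sqrt (t - s)))"
begin

lemma G_measurable_mono:
  "f \<in> measurable (G s) N \<Longrightarrow> 0 \<le> s \<Longrightarrow> s \<le> t \<Longrightarrow> f \<in> measurable (G t) N"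
  using G_mono[of s t] space_G by (auto simp: measurable_def)

lemma G_measurable_M: "f \<in> measurable (G s) N \<Longrightarrow> 0 \<le> s \<Longrightarrow> f \<in> measurable M N"
  using sets_G[of s] space_G by (auto simp: measurable_def)

lemma W_measurable: "0 \<le> s \<Longrightarrow> W s \<in> borel_measurable M"
  by (rule G_measurable_M[OF W_adapted])

lemma component_measurable:
  fixes f :: "'a \<Rightarrow> 'b::euclidean_space ^ 'm"
  assumes "f \<in> borel_measurable N"
  shows "(\<lambda>\<omega>. f \<omega> $ i) \<in> borel_measurable N"
  by (rule borel_measurable_continuous_on[OF _ assms]) (intro continuous_intros)

lemma increment_component_adapted:
  assumes "0 \<le> s" "0 \<le> t" "s \<le> u" "t \<le> u"
  shows "(\<lambda>\<omega>. (W t \<omega> - W s \<omega>) $ i) \<in> borel_measurable (G u)"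
  using assms by (intro component_measurable borel_measurable_diff G_measurable_mono[OF W_adapted]) auto

lemma indep_past_increment:
  fixes Z :: "'w \<Rightarrow> real"
  assumes st: "0 \<le> s" "s < t" and Z: "Z \<in> borel_measurable (G s)"
    and f: "f \<in> borel_measurable borel"
  shows "indep_var borel Z borel (\<lambda>\<omega>. f (W t \<omega> - W s \<omega>))"
proof -
  let ?V = "\<lambda>\<omega>. W t \<omega> - W s \<omega>"
  have V: "?V \<in> borel_measurable M"
    using st W_measurable[of s] W_measurable[of t] by simp
  have fV: "(\<lambda>\<omega>. f (?V \<omega>)) \<in> borel_measurable M"
    using measurable_compose[OF V f] .
  have pre: "preimages M borel ?V = sets (vimage_algebra (space M) ?V borel)"
    by (auto simp: preimages_def sets_vimage_algebra2)
  have 1: "sigma_sets (space M) {Z -` A \<inter> space M |A. A \<in> sets borel} \<subseteq> sets (G s)"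
  proof -
    have "{Z -` A \<inter> space M |A. A \<in> sets borel} \<subseteq> sets (G s)"
      using measurable_sets[OF Z] unfolding space_G by blast
    from sets.sigma_sets_subset[OF this] show ?thesis unfolding space_G .
  qed
  have "sigma_sets (space M) {(\<lambda>\<omega>. f (?V \<omega>)) -` A \<inter> space M |A. A \<in> sets borel}
      \<subseteq> sets (vimage_algebra (space M) ?V borel)"
  proof -
    have "(\<lambda>\<omega>. f (?V \<omega>)) \<in> measurable (vimage_algebra (space M) ?V borel) borel"
      by (rule measurable_compose[OF measurable_vimage_algebra1 f]) simp
    then have "{(\<lambda>\<omega>. f (?V \<omega>)) -` A \<inter> space M |A. A \<in> sets borel} \<subseteq> sets (vimage_algebra (space M) ?V borel)"
      by (auto dest!: measurable_sets)
    then show ?thesis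
      using sets.sigma_sets_subset[of _ "vimage_algebra (space M) ?V borel"] by simp
  qed
  then have 2: "sigma_sets (space M) {(\<lambda>\<omega>. f (?V \<omega>)) -` A \<inter> space M |A. A \<in> sets borel} \<subseteq> preimages M borel ?V"
    unfolding pre .
  show ?thesis
    unfolding indep_var_eq indep_sets2_eq
  proof (intro conjI ballI)
    show "random_variable borel Z" "random_variable borel (\<lambda>\<omega>. f (?V \<omega>))"
      using fV G_measurable_M[OF Z st(1)] by auto
    show "sigma_sets (space M) {Z -` A \<inter> space M |A. A \<in> sets borel} \<subseteq> events"
      using 1 sets_G[OF st(1)] by blast
    show "sigma_sets (space M) {(\<lambda>\<omega>. f (?V \<omega>)) -` A \<inter> space M |A. A \<in> sets borel} \<subseteq> events"
      using 2 indep_setD_ev1[OF increments_indep[OF st]] by blast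
    fix A B assume "A \<in> sigma_sets (space M) {Z -` A \<inter> space M |A. A \<in> sets borel}"
      "B \<in> sigma_sets (space M) {(\<lambda>\<omega>. f (?V \<omega>)) -` A \<inter> space M |A. A \<in> sets borel}"
    then have "prob (B \<inter> A) = prob B * prob A"
      using 1 2 by (intro indep_setD[OF increments_indep[OF st]]) auto
    then show "prob (A \<inter> B) = prob A * prob B" by (simp add: Int_commute mult.commute)
  qed
qed

lemma increment_moments:
  assumes st: "0 \<le> s" "s \<le> t"
  shows "integrable M (\<lambda>\<omega>. (W t \<omega> - W s \<omega>) $ i)"
    and "expectation (\<lambda>\<omega>. (W t \<omega> - W s \<omega>) $ i) = 0"
    and "integrable M (\<lambda>\<omega>. ((W t \<omega> - W s \<omega>) $ i)\<^sup>2)"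
    and "expectation (\<lambda>\<omega>. ((W t \<omega> - W s \<omega>) $ i)\<^sup>2) = t - s"
proof -
  let ?D = "\<lambda>\<omega>. (W t \<omega> - W s \<omega>) $ i"
  have "integrable M ?D \<and> expectation ?D = 0 \<and> integrable M (\<lambda>\<omega>. (?D \<omega>)\<^sup>2) \<and> expectation (\<lambda>\<omega>. (?D \<omega>)\<^sup>2) = t - s"
  proof (cases "s = t")
    case False
    then have lt: "s < t" "0 < sqrt (t - s)" using st by auto
    note N = increments_normal[OF st(1) lt(1), of i]
    have E: "expectation ?D = 0" using normal_distributed_expectation[OF lt(2) N] .
    have I1: "integrable M ?D"
      using distributed_integrable[OF N, of "\<lambda>x. x"] integrable_normal_moment_nz_1[OF lt(2), of 0] by simp
    have I2: "integrable M (\<lambda>\<omega>. (?D \<omega>)\<^sup>2)"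
      using distributed_integrable[OF N, of "\<lambda>x. x\<^sup>2"] integrable_normal_moment[OF lt(2), of 0 2] by simp
    have "expectation (\<lambda>\<omega>. (?D \<omega>)\<^sup>2) = t - s"
      using normal_distributed_variance[OF lt(2) N] lt unfolding E by simp
    then show ?thesis using E I1 I2 by blast
  qed simp
  then show "integrable M ?D" "expectation ?D = 0" "integrable M (\<lambda>\<omega>. (?D \<omega>)\<^sup>2)"
    "expectation (\<lambda>\<omega>. (?D \<omega>)\<^sup>2) = t - s" by auto
qed

lemma increment_product_moments:
  assumes st: "0 \<le> s" "s \<le> t"
  shows "integrable M (\<lambda>\<omega>. (W t \<omega> - W s \<omega>) $ i * (W t \<omega> - W s \<omega>) $ j)"
    and "expectation (\<lambda>\<omega>. (W t \<omega> - W s \<omega>) $ i * (W t \<omega> - W s \<omega>) $ j) = (if i = j then t - s else 0)"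
proof -
  let ?D = "\<lambda>i \<omega>. (W t \<omega> - W s \<omega>) $ i"
  have "integrable M (\<lambda>\<omega>. ?D i \<omega> * ?D j \<omega>) \<and> expectation (\<lambda>\<omega>. ?D i \<omega> * ?D j \<omega>) = (if i = j then t - s else 0)"
  proof (cases "i = j \<or> s = t")
    case True
    then show ?thesis using increment_moments[OF st, of i] by (auto simp: power2_eq_square)
  next
    case False
    then have lt: "s < t" using st by auto
    have ind: "indep_var borel (?D i) borel (?D j)"
      using indep_vars_sum[of "{j}" i, OF _ _ indep_vars_subset[OF increments_components[OF st(1) lt]]] False
      by simp
    show ?thesis
      using indep_var_integrable[OF ind increment_moments(1)[OF st] increment_moments(1)[OF st]]
        indep_var_lebesgue_integral[OF ind increment_moments(1)[OF st] increment_moments(1)[OF st]]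
        increment_moments(2)[OF st] False by simp
  qed
  then show "integrable M (\<lambda>\<omega>. ?D i \<omega> * ?D j \<omega>)"
    "expectation (\<lambda>\<omega>. ?D i \<omega> * ?D j \<omega>) = (if i = j then t - s else 0)" by auto
qed

text \<open>The martingale property: an increment is orthogonal to whatever is known when it starts.\<close>

lemma past_times_increment:
  fixes Z :: "'w \<Rightarrow> real"
  assumes st: "0 \<le> s" "s \<le> t" and Z: "Z \<in> borel_measurable (G s)" "integrable M Z"
  shows "integrable M (\<lambda>\<omega>. Z \<omega> * (W t \<omega> - W s \<omega>) $ i)"
    and "expectation (\<lambda>\<omega>. Z \<omega> * (W t \<omega> - W s \<omega>) $ i) = 0"
proof -
  have "integrable M (\<lambda>\<omega>. Z \<omega> * (W t \<omega> - W s \<omega>) $ i)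
     \<and> expectation (\<lambda>\<omega>. Z \<omega> * (W t \<omega> - W s \<omega>) $ i) = 0"
  proof (cases "s = t")
    case False
    then have lt: "s < t" using st by auto
    have ind: "indep_var borel Z borel (\<lambda>\<omega>. (W t \<omega> - W s \<omega>) $ i)"
      by (rule indep_past_increment[OF st(1) lt Z(1)]) (intro component_measurable measurable_ident_sets[OF refl])
    show ?thesis
      using indep_var_integrable[OF ind Z(2) increment_moments(1)[OF st]]
        indep_var_lebesgue_integral[OF ind Z(2) increment_moments(1)[OF st]]
        increment_moments(2)[OF st] by simp
  qed simp
  then show "integrable M (\<lambda>\<omega>. Z \<omega> * (W t \<omega> - W s \<omega>) $ i)"
    and "expectation (\<lambda>\<omega>. Z \<omega> * (W t \<omega> - W s \<omega>) $ i) = 0" by auto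
qed

lemma past_times_increment_product:
  fixes Z :: "'w \<Rightarrow> real"
  assumes st: "0 \<le> s" "s \<le> t" and Z: "Z \<in> borel_measurable (G s)" "integrable M Z"
  shows "integrable M (\<lambda>\<omega>. Z \<omega> * ((W t \<omega> - W s \<omega>) $ i * (W t \<omega> - W s \<omega>) $ j))"
    and "expectation (\<lambda>\<omega>. Z \<omega> * ((W t \<omega> - W s \<omega>) $ i * (W t \<omega> - W s \<omega>) $ j))
      = (if i = j then (t - s) * expectation Z else 0)"
proof -
  let ?P = "\<lambda>\<omega>. (W t \<omega> - W s \<omega>) $ i * (W t \<omega> - W s \<omega>) $ j"
  have "integrable M (\<lambda>\<omega>. Z \<omega> * ?P \<omega>)
     \<and> expectation (\<lambda>\<omega>. Z \<omega> * ?P \<omega>) = (if i = j then (t - s) * expectation Z else 0)"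
  proof (cases "s = t")
    case False
    then have lt: "s < t" using st by auto
    have ind: "indep_var borel Z borel ?P"
      by (rule indep_past_increment[OF st(1) lt Z(1), where f = "\<lambda>v. v $ i * v $ j"])
         (intro component_measurable measurable_ident_sets[OF refl] borel_measurable_times)
    show ?thesis
      using indep_var_integrable[OF ind Z(2) increment_product_moments(1)[OF st]]
        indep_var_lebesgue_integral[OF ind Z(2) increment_product_moments(1)[OF st]]
        increment_product_moments(2)[OF st] by simp
  qed simp
  then show "integrable M (\<lambda>\<omega>. Z \<omega> * ?P \<omega>)"
    and "expectation (\<lambda>\<omega>. Z \<omega> * ?P \<omega>) = (if i = j then (t - s) * expectation Z else 0)" by auto
qed

definition overlap :: "real \<Rightarrow> real \<Rightarrow> real \<Rightarrow> real \<Rightarrow> real" where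
  "overlap a b a' b' = measure lborel ({a<..b} \<inter> {a'<..b'})"

lemma overlap_eq: "overlap a b a' b' = max 0 (min b b' - max a a')"
  unfolding overlap_def Int_greaterThanAtMost by (cases "max a a' \<le> min b b'") auto

lemma bounded_times_integrable:
  fixes Z Y :: "'w \<Rightarrow> real"
  assumes "Z \<in> borel_measurable M" "\<And>\<omega>. \<omega> \<in> space M \<Longrightarrow> \<bar>Z \<omega>\<bar> \<le> B" "integrable M Y"
  shows "integrable M (\<lambda>\<omega>. Z \<omega> * Y \<omega>)"
proof (rule Bochner_Integration.integrable_bound[of _ "\<lambda>\<omega>. B * Y \<omega>"])
  show "AE \<omega> in M. norm (Z \<omega> * Y \<omega>) \<le> norm (B * Y \<omega>)"
    using assms(2) by (intro AE_I2) (fastforce simp: abs_mult intro!: mult_right_mono)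
qed (use assms in auto)

text \<open>Weighted increments over disjoint intervals are orthogonal, because the later one has mean zero
  given the past. Both intervals are therefore cut down to their common part, on which the two
  weights are known at the start and the product of the increments has mean equal to the length of
  that part, or 0 for different components.\<close>

lemma increment_covariance_ordered:
  fixes \<alpha> \<beta> :: "'w \<Rightarrow> real"
  assumes ab: "0 \<le> a" "a \<le> b" and ab': "a \<le> a'" "a' \<le> b'"
    and \<alpha>: "\<alpha> \<in> borel_measurable (G a)" "\<And>\<omega>. \<omega> \<in> space M \<Longrightarrow> \<bar>\<alpha> \<omega>\<bar> \<le> A"
    and \<beta>: "\<beta> \<in> borel_measurable (G a')" "\<And>\<omega>. \<omega> \<in> space M \<Longrightarrow> \<bar>\<beta> \<omega>\<bar> \<le> B"
  shows "integrable M (\<lambda>\<omega>. (\<alpha> \<omega> * (W b \<omega> - W a \<omega>) $ i) * (\<beta> \<omega> * (W b' \<omega> - W a' \<omega>) $ j))"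
    and "expectation (\<lambda>\<omega>. (\<alpha> \<omega> * (W b \<omega> - W a \<omega>) $ i) * (\<beta> \<omega> * (W b' \<omega> - W a' \<omega>) $ j))
      = (if i = j then overlap a b a' b' * expectation (\<lambda>\<omega>. \<alpha> \<omega> * \<beta> \<omega>) else 0)"
proof -
  define D where "D = (\<lambda>i s t \<omega>. (W t \<omega> - W s \<omega>) $ i)"
  (* (a, p] is the part of the first interval before a'; (a', q] is the part after a', empty if b <= a'; (a', r] is the overlap. *)
  define p where "p = min b a'"
  define q where "q = max b a'"
  define r where "r = min q b'"
  have ord: "a \<le> p" "p \<le> a'" "a' \<le> q" "a' \<le> r" "r \<le> q" "r \<le> b'" "0 \<le> a'" "0 \<le> r" "0 \<le> p" "0 \<le> q"
    using ab ab' by (auto simp: p_def q_def r_def)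
  have \<alpha>': "\<alpha> \<in> borel_measurable (G a')" by (rule G_measurable_mono[OF \<alpha>(1)]) (use ab ab' in auto)
  have \<alpha>\<beta>: "(\<lambda>\<omega>. \<alpha> \<omega> * \<beta> \<omega>) \<in> borel_measurable (G a')"
    using \<alpha>' \<beta>(1) by simp
  have meas: "\<alpha> \<in> borel_measurable M" "\<beta> \<in> borel_measurable M"
    using G_measurable_M \<alpha> \<beta> ord ab by blast+
  have \<alpha>\<beta>_bd: "\<bar>\<alpha> \<omega> * \<beta> \<omega>\<bar> \<le> A * B" if "\<omega> \<in> space M" for \<omega>
    unfolding abs_mult using \<alpha>(2)[OF that] \<beta>(2)[OF that]
    by (intro mult_mono) (auto intro: order_trans[OF abs_ge_zero])
  have \<alpha>\<beta>_int: "integrable M (\<lambda>\<omega>. \<alpha> \<omega> * \<beta> \<omega>)"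
    using \<alpha>\<beta>_bd meas by (intro integrable_const_bound[of _ "A * B"]) auto
  have bD: "integrable M (\<lambda>\<omega>. \<alpha> \<omega> * \<beta> \<omega> * D k s t \<omega>)" if "0 \<le> s" "s \<le> t" for k s t
    unfolding D_def using increment_moments(1)[OF that] meas \<alpha>\<beta>_bd
    by (intro bounded_times_integrable) auto
  have adapt: "(\<lambda>\<omega>. \<alpha> \<omega> * \<beta> \<omega> * D k s t \<omega>) \<in> borel_measurable (G u)"
    if "0 \<le> s" "s \<le> u" "0 \<le> t" "t \<le> u" "a' \<le> u" for k s t u
    unfolding D_def using that ord
    by (intro borel_measurable_times increment_component_adapted G_measurable_mono[OF \<alpha>'] G_measurable_mono[OF \<beta>(1)]) auto
  have t1: "integrable M (\<lambda>\<omega>. \<alpha> \<omega> * \<beta> \<omega> * D i a p \<omega> * D j a' b' \<omega>)"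
     "expectation (\<lambda>\<omega>. \<alpha> \<omega> * \<beta> \<omega> * D i a p \<omega> * D j a' b' \<omega>) = 0"
    using past_times_increment[of a' b' "\<lambda>\<omega>. \<alpha> \<omega> * \<beta> \<omega> * D i a p \<omega>" j] adapt[of a a' p i] bD[of a p i] ord ab ab'
    unfolding D_def by auto
  have t2: "integrable M (\<lambda>\<omega>. \<alpha> \<omega> * \<beta> \<omega> * D i a' r \<omega> * D j r b' \<omega>)"
     "expectation (\<lambda>\<omega>. \<alpha> \<omega> * \<beta> \<omega> * D i a' r \<omega> * D j r b' \<omega>) = 0"
    using past_times_increment[of r b' "\<lambda>\<omega>. \<alpha> \<omega> * \<beta> \<omega> * D i a' r \<omega>" j] adapt[of a' r r i] bD[of a' r i] ord ab ab'
    unfolding D_def by auto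
  have t3: "integrable M (\<lambda>\<omega>. \<alpha> \<omega> * \<beta> \<omega> * D j a' r \<omega> * D i r q \<omega>)"
     "expectation (\<lambda>\<omega>. \<alpha> \<omega> * \<beta> \<omega> * D j a' r \<omega> * D i r q \<omega>) = 0"
    using past_times_increment[of r q "\<lambda>\<omega>. \<alpha> \<omega> * \<beta> \<omega> * D j a' r \<omega>" i] adapt[of a' r r j] bD[of a' r j] ord ab ab'
    unfolding D_def by auto
  have t4: "integrable M (\<lambda>\<omega>. \<alpha> \<omega> * \<beta> \<omega> * (D i a' r \<omega> * D j a' r \<omega>))"
     "expectation (\<lambda>\<omega>. \<alpha> \<omega> * \<beta> \<omega> * (D i a' r \<omega> * D j a' r \<omega>))
       = (if i = j then (r - a') * expectation (\<lambda>\<omega>. \<alpha> \<omega> * \<beta> \<omega>) else 0)"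
    using past_times_increment_product[of a' r "\<lambda>\<omega>. \<alpha> \<omega> * \<beta> \<omega>" i j] \<alpha>\<beta> \<alpha>\<beta>_int ord by (auto simp: D_def)
  (* At most one of the two intervals reaches beyond r, so the product of their remainders vanishes. *)
  have split: "(\<alpha> \<omega> * D i a b \<omega>) * (\<beta> \<omega> * D j a' b' \<omega>)
      = \<alpha> \<omega> * \<beta> \<omega> * D i a p \<omega> * D j a' b' \<omega> + \<alpha> \<omega> * \<beta> \<omega> * D i a' r \<omega> * D j r b' \<omega>
        + \<alpha> \<omega> * \<beta> \<omega> * D j a' r \<omega> * D i r q \<omega> + \<alpha> \<omega> * \<beta> \<omega> * (D i a' r \<omega> * D j a' r \<omega>)" for \<omega>
  proof -
    have "D i a b \<omega> = D i a p \<omega> + D i a' r \<omega> + D i r q \<omega>"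
      by (cases "b \<le> a'") (auto simp: D_def p_def q_def min_def max_def)
    moreover have "D j a' b' \<omega> = D j a' r \<omega> + D j r b' \<omega>" by (simp add: D_def)
    moreover have "r = q \<or> r = b'" by (auto simp: r_def)
    then have "D i r q \<omega> = 0 \<or> D j r b' \<omega> = 0" by (auto simp: D_def)
    ultimately show ?thesis by (elim disjE) (auto simp: algebra_simps)
  qed
  have ov: "overlap a b a' b' = r - a'"
    using ab ab' by (auto simp: overlap_eq r_def q_def max_def min_def)
  show "integrable M (\<lambda>\<omega>. (\<alpha> \<omega> * (W b \<omega> - W a \<omega>) $ i) * (\<beta> \<omega> * (W b' \<omega> - W a' \<omega>) $ j))"
    unfolding split[unfolded D_def] using t1 t2 t3 t4 unfolding D_def by (intro Bochner_Integration.integrable_add)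
  show "expectation (\<lambda>\<omega>. (\<alpha> \<omega> * (W b \<omega> - W a \<omega>) $ i) * (\<beta> \<omega> * (W b' \<omega> - W a' \<omega>) $ j))
      = (if i = j then overlap a b a' b' * expectation (\<lambda>\<omega>. \<alpha> \<omega> * \<beta> \<omega>) else 0)"
    using t1 t2 t3 t4 unfolding split[unfolded D_def] unfolding D_def
    by (simp add: ov)
qed

lemma increment_covariance:
  fixes \<alpha> \<beta> :: "'w \<Rightarrow> real"
  assumes ab: "0 \<le> a" "a \<le> b" and ab': "0 \<le> a'" "a' \<le> b'"
    and \<alpha>: "\<alpha> \<in> borel_measurable (G a)" "\<And>\<omega>. \<omega> \<in> space M \<Longrightarrow> \<bar>\<alpha> \<omega>\<bar> \<le> A"
    and \<beta>: "\<beta> \<in> borel_measurable (G a')" "\<And>\<omega>. \<omega> \<in> space M \<Longrightarrow> \<bar>\<beta> \<omega>\<bar> \<le> B"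
  shows "integrable M (\<lambda>\<omega>. (\<alpha> \<omega> * (W b \<omega> - W a \<omega>) $ i) * (\<beta> \<omega> * (W b' \<omega> - W a' \<omega>) $ j))" (is ?I)
    and "expectation (\<lambda>\<omega>. (\<alpha> \<omega> * (W b \<omega> - W a \<omega>) $ i) * (\<beta> \<omega> * (W b' \<omega> - W a' \<omega>) $ j))
      = (if i = j then overlap a b a' b' * expectation (\<lambda>\<omega>. \<alpha> \<omega> * \<beta> \<omega>) else 0)" (is ?E)
proof -
  have "?I \<and> ?E"
  proof (cases "a \<le> a'")
    case True
    then show ?thesis using increment_covariance_ordered[OF ab True ab'(2) \<alpha> \<beta>] by simp
  next
    case False
    then have "a' \<le> a" by simp
    from increment_covariance_ordered[OF ab' this ab(2) \<beta> \<alpha>, of j i]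
    show ?thesis by (simp add: overlap_def Int_commute mult.commute)
  qed
  then show ?I ?E by auto
qed

end

section \<open>Mean-square distances\<close>

definition mean_sq_dist :: "'a measure \<Rightarrow> ('a \<Rightarrow> 'b::real_normed_vector) \<Rightarrow> ('a \<Rightarrow> 'b) \<Rightarrow> ennreal" where
  "mean_sq_dist N f g = (\<integral>\<^sup>+ x. ennreal ((norm (f x - g x))\<^sup>2) \<partial>N)"

lemma mean_sq_dist_commute: "mean_sq_dist N f g = mean_sq_dist N g f"
  by (simp add: mean_sq_dist_def norm_minus_commute)

lemma mean_sq_dist_triangle3:
  fixes f g g' k :: "'a \<Rightarrow> 'b::{real_normed_vector, second_countable_topology}"
  assumes [measurable]: "f \<in> borel_measurable N" "g \<in> borel_measurable N" "g' \<in> borel_measurable N" "k \<in> borel_measurable N"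
  shows "mean_sq_dist N f k \<le> 3 * (mean_sq_dist N f g + mean_sq_dist N g g' + mean_sq_dist N g' k)"
proof -
  have "mean_sq_dist N f k \<le> (\<integral>\<^sup>+ x. 3 * (ennreal ((norm (f x - g x))\<^sup>2) + ennreal ((norm (g x - g' x))\<^sup>2)
      + ennreal ((norm (g' x - k x))\<^sup>2)) \<partial>N)"
    unfolding mean_sq_dist_def
  proof (rule nn_integral_mono)
    fix x
    show "ennreal ((norm (f x - k x))\<^sup>2) \<le> 3 * (ennreal ((norm (f x - g x))\<^sup>2)
        + ennreal ((norm (g x - g' x))\<^sup>2) + ennreal ((norm (g' x - k x))\<^sup>2))"
      using norm_add3_squared_le[of "f x - g x" "g x - g' x" "g' x - k x"] by simp
  qed
  also have "\<dots> = 3 * (mean_sq_dist N f g + mean_sq_dist N g g' + mean_sq_dist N g' k)"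
    unfolding mean_sq_dist_def by (subst nn_integral_cmult, measurable) (simp add: nn_integral_add)
  finally show ?thesis .
qed

lemma mean_sq_dist_triangle:
  fixes f g k :: "'a \<Rightarrow> 'b::{real_normed_vector, second_countable_topology}"
  assumes [measurable]: "f \<in> borel_measurable N" "g \<in> borel_measurable N" "k \<in> borel_measurable N"
  shows "mean_sq_dist N f k \<le> 2 * (mean_sq_dist N f g + mean_sq_dist N g k)"
proof -
  have "mean_sq_dist N f k \<le> (\<integral>\<^sup>+ x. 2 * (ennreal ((norm (f x - g x))\<^sup>2) + ennreal ((norm (g x - k x))\<^sup>2)) \<partial>N)"
    unfolding mean_sq_dist_def
  proof (rule nn_integral_mono)
    fix x
    show "ennreal ((norm (f x - k x))\<^sup>2) \<le> 2 * (ennreal ((norm (f x - g x))\<^sup>2)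
        + ennreal ((norm (g x - k x))\<^sup>2))"
      using norm_add_squared_le[of "f x - g x" "g x - k x"] by simp
  qed
  also have "\<dots> = 2 * (mean_sq_dist N f g + mean_sq_dist N g k)"
    unfolding mean_sq_dist_def by (subst nn_integral_cmult, measurable) (simp add: nn_integral_add)
  finally show ?thesis .
qed

lemma power2_norm_vec: "(norm (v :: real ^ 'k))\<^sup>2 = (\<Sum>k\<in>UNIV. (v $ k)\<^sup>2)"
  unfolding power2_norm_eq_inner inner_vec_def by (simp add: power2_eq_square)

lemma power2_norm_matrix: "(norm (m :: real ^ 'n ^ 'k))\<^sup>2 = (\<Sum>k\<in>UNIV. \<Sum>l\<in>UNIV. (m $ k $ l)\<^sup>2)"
  unfolding power2_norm_eq_inner inner_vec_def by (simp add: power2_eq_square)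

section \<open>Elementary stochastic integrals\<close>

context adapted_increments
begin

text \<open>Sums of weighted increments over arbitrary intervals $(a_i, b_i]$. In contrast to a simple
  process, which lives on one partition, the intervals may overlap, so that differences of elementary
  processes are elementary without passing to a common refinement.\<close>

definition elementary ::
  "'i set \<Rightarrow> ('i \<Rightarrow> real) \<Rightarrow> ('i \<Rightarrow> real) \<Rightarrow> ('i \<Rightarrow> 'w \<Rightarrow> real ^ 'n ^ 'k) \<Rightarrow> bool" where
  "elementary A a b \<xi> \<longleftrightarrow> finite A \<and>
     (\<forall>i\<in>A. 0 \<le> a i \<and> a i \<le> b i \<and> \<xi> i \<in> borel_measurable (G (a i)) \<and> bounded (\<xi> i ` space M))"

definition elementary_process ::
  "'i set \<Rightarrow> ('i \<Rightarrow> real) \<Rightarrow> ('i \<Rightarrow> real) \<Rightarrow> ('i \<Rightarrow> 'w \<Rightarrow> real ^ 'n ^ 'k) \<Rightarrow> 'w \<times> real \<Rightarrow> real ^ 'n ^ 'k" where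
  "elementary_process A a b \<xi> p = (\<Sum>i\<in>A. indicator {a i<..b i} (snd p) *\<^sub>R \<xi> i (fst p))"

definition elementary_integral ::
  "'i set \<Rightarrow> ('i \<Rightarrow> real) \<Rightarrow> ('i \<Rightarrow> real) \<Rightarrow> ('i \<Rightarrow> 'w \<Rightarrow> real ^ 'n ^ 'k) \<Rightarrow> 'w \<Rightarrow> real ^ 'k" where
  "elementary_integral A a b \<xi> \<omega> = (\<Sum>i\<in>A. \<xi> i \<omega> *v (W (b i) \<omega> - W (a i) \<omega>))"

lemma elementary_coeff_measurable:
  assumes "elementary A a b \<xi>" "i \<in> A"
  shows "\<xi> i \<in> borel_measurable M"
  using assms G_measurable_M[of "\<xi> i" "a i"] by (auto simp: elementary_def)

lemma elementary_process_measurable: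
  assumes "elementary A a b \<xi>"
  shows "elementary_process A a b \<xi> \<in> borel_measurable (M \<Otimes>\<^sub>M lborel)"
proof -
  have [measurable]: "(\<lambda>p. \<xi> i (fst p)) \<in> borel_measurable (M \<Otimes>\<^sub>M lborel)" if "i \<in> A" for i
    using elementary_coeff_measurable[OF assms that] by measurable
  show ?thesis unfolding elementary_process_def by measurable
qed

lemma matrix_vector_measurable:
  fixes f :: "'a \<Rightarrow> real ^ 'n ^ 'k" and g :: "'a \<Rightarrow> real ^ 'n"
  assumes "f \<in> borel_measurable N" "g \<in> borel_measurable N"
  shows "(\<lambda>x. f x *v g x) \<in> borel_measurable N"
proof -
  have "continuous_on UNIV (\<lambda>p :: (real ^ 'n ^ 'k) \<times> (real ^ 'n). fst p *v snd p)"
    unfolding matrix_vector_mult_def by (intro continuous_intros)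
  from borel_measurable_continuous_Pair[OF assms this] show ?thesis by simp
qed

lemma elementary_integral_measurable:
  assumes "elementary A a b \<xi>"
  shows "elementary_integral A a b \<xi> \<in> borel_measurable M"
  unfolding elementary_integral_def
proof (intro borel_measurable_sum matrix_vector_measurable borel_measurable_diff W_measurable)
  fix i assume "i \<in> A"
  then show "\<xi> i \<in> borel_measurable M" "0 \<le> a i" "0 \<le> b i"
    using assms elementary_coeff_measurable[OF assms] by (auto simp: elementary_def)
qed

lemma sum_covariance:
  fixes \<alpha> :: "'p \<Rightarrow> 'w \<Rightarrow> real" and d :: "'p \<Rightarrow> 'n"
  assumes P: "finite P" "\<And>p. p \<in> P \<Longrightarrow> 0 \<le> a p \<and> a p \<le> b p"
    and \<alpha>: "\<And>p. p \<in> P \<Longrightarrow> \<alpha> p \<in> borel_measurable (G (a p))"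
    and B: "\<And>p \<omega>. p \<in> P \<Longrightarrow> \<omega> \<in> space M \<Longrightarrow> \<bar>\<alpha> p \<omega>\<bar> \<le> B p"
  shows "integrable M (\<lambda>\<omega>. (\<Sum>p\<in>P. \<alpha> p \<omega> * (W (b p) \<omega> - W (a p) \<omega>) $ d p)\<^sup>2)"
    and "expectation (\<lambda>\<omega>. (\<Sum>p\<in>P. \<alpha> p \<omega> * (W (b p) \<omega> - W (a p) \<omega>) $ d p)\<^sup>2)
      = (\<Sum>p\<in>P. \<Sum>q\<in>P. if d p = d q
           then overlap (a p) (b p) (a q) (b q) * expectation (\<lambda>\<omega>. \<alpha> p \<omega> * \<alpha> q \<omega>) else 0)"
proof -
  let ?D = "\<lambda>p \<omega>. \<alpha> p \<omega> * (W (b p) \<omega> - W (a p) \<omega>) $ d p"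
  have sq: "(\<Sum>p\<in>P. ?D p \<omega>)\<^sup>2 = (\<Sum>p\<in>P. \<Sum>q\<in>P. ?D p \<omega> * ?D q \<omega>)" for \<omega>
    by (simp only: power2_eq_square sum_product)
  have cov: "integrable M (\<lambda>\<omega>. ?D p \<omega> * ?D q \<omega>)"
    "expectation (\<lambda>\<omega>. ?D p \<omega> * ?D q \<omega>) = (if d p = d q
           then overlap (a p) (b p) (a q) (b q) * expectation (\<lambda>\<omega>. \<alpha> p \<omega> * \<alpha> q \<omega>) else 0)"
    if "p \<in> P" "q \<in> P" for p q
    using increment_covariance[of "a p" "b p" "a q" "b q" "\<alpha> p" "B p" "\<alpha> q" "B q" "d p" "d q"] P \<alpha> B that
    by auto
  show "integrable M (\<lambda>\<omega>. (\<Sum>p\<in>P. ?D p \<omega>)\<^sup>2)"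
    unfolding sq by (intro Bochner_Integration.integrable_sum cov(1))
  show "expectation (\<lambda>\<omega>. (\<Sum>p\<in>P. ?D p \<omega>)\<^sup>2) = (\<Sum>p\<in>P. \<Sum>q\<in>P. if d p = d q
           then overlap (a p) (b p) (a q) (b q) * expectation (\<lambda>\<omega>. \<alpha> p \<omega> * \<alpha> q \<omega>) else 0)"
    unfolding sq
    by (subst Bochner_Integration.integral_sum, intro Bochner_Integration.integrable_sum cov(1), assumption+,
        intro sum.cong refl, subst Bochner_Integration.integral_sum, intro cov(1), assumption+,
        intro sum.cong refl cov(2))
qed

text \<open>The squared sum on either side expands into pairs $(i, j)$, and each pair contributes the length
  of the overlap of its intervals times the expected Frobenius product of its coefficients: on the left
  by the covariance of increments, on the right by integrating the product of two indicators over time.\<close>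

lemma elementary_isometry:
  assumes el: "elementary A a b (\<xi> :: 'i \<Rightarrow> 'w \<Rightarrow> real ^ 'n ^ 'k)"
  shows "(\<integral>\<^sup>+ \<omega>. ennreal ((norm (elementary_integral A a b \<xi> \<omega>))\<^sup>2) \<partial>M)
    = (\<integral>\<^sup>+ p. ennreal ((norm (elementary_process A a b \<xi> p))\<^sup>2) \<partial>(M \<Otimes>\<^sub>M lborel))"
proof -
  have fin: "finite A" and ab: "\<And>i. i \<in> A \<Longrightarrow> 0 \<le> a i \<and> a i \<le> b i"
    and \<xi>_meas: "\<And>i. i \<in> A \<Longrightarrow> \<xi> i \<in> borel_measurable (G (a i))"
    and "\<forall>i\<in>A. \<exists>B. \<forall>\<omega>\<in>space M. norm (\<xi> i \<omega>) \<le> B"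
    using el by (auto simp: elementary_def bounded_iff)
  then obtain B where B: "\<And>i \<omega>. i \<in> A \<Longrightarrow> \<omega> \<in> space M \<Longrightarrow> norm (\<xi> i \<omega>) \<le> B i" by metis
  have B0: "0 \<le> B i" if "i \<in> A" for i
    using B[OF that] not_empty by (meson ex_in_conv norm_ge_zero order_trans)
  have Bc: "\<bar>\<xi> i \<omega> $ k $ l\<bar> \<le> B i" if "i \<in> A" "\<omega> \<in> space M" for i \<omega> k l
    using B[OF that] component_le_norm_cart[of "\<xi> i \<omega> $ k" l] Finite_Cartesian_Product.norm_nth_le[of "\<xi> i \<omega>" k] by linarith
  have comp: "(\<lambda>\<omega>. \<xi> i \<omega> $ k $ l) \<in> borel_measurable (G (a i))" if "i \<in> A" for i k l
    using \<xi>_meas[OF that] by (intro component_measurable)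
  have compM: "(\<lambda>\<omega>. \<xi> i \<omega> $ k $ l) \<in> borel_measurable M" if "i \<in> A" for i k l
    using G_measurable_M[OF comp[OF that]] ab[OF that] by blast
  have cint: "integrable M (\<lambda>\<omega>. \<xi> i \<omega> $ k $ l * \<xi> j \<omega> $ k $ l)" if "i \<in> A" "j \<in> A" for i j k l
  proof (rule integrable_const_bound[of _ "B i * B j"])
    show "AE \<omega> in M. norm (\<xi> i \<omega> $ k $ l * \<xi> j \<omega> $ k $ l) \<le> B i * B j"
      using Bc B0 that by (intro AE_I2) (auto simp: abs_mult intro!: mult_mono)
    show "(\<lambda>\<omega>. \<xi> i \<omega> $ k $ l * \<xi> j \<omega> $ k $ l) \<in> borel_measurable M"
      using compM that by (intro borel_measurable_times)
  qed
  let ?ov = "\<lambda>i j. overlap (a i) (b i) (a j) (b j)"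
  (* The integral over time of the squared elementary process, for a fixed outcome. *)
  define R where "R = (\<lambda>\<omega>. \<Sum>k\<in>UNIV. \<Sum>l\<in>UNIV. \<Sum>i\<in>A. \<Sum>j\<in>A. ?ov i j * (\<xi> i \<omega> $ k $ l * \<xi> j \<omega> $ k $ l))"
  have R_int: "integrable M R" unfolding R_def
    by (intro Bochner_Integration.integrable_sum integrable_mult_right cint)
  have ER: "expectation R = (\<Sum>k\<in>UNIV. \<Sum>l\<in>UNIV. \<Sum>i\<in>A. \<Sum>j\<in>A. ?ov i j * expectation (\<lambda>\<omega>. \<xi> i \<omega> $ k $ l * \<xi> j \<omega> $ k $ l))"
    unfolding R_def
    by (simp add: Bochner_Integration.integral_sum Bochner_Integration.integrable_sum integrable_mult_right cint)

  have time: "(\<integral>\<^sup>+ s. ennreal ((norm (elementary_process A a b \<xi> (\<omega>, s)))\<^sup>2) \<partial>lborel) = ennreal (R \<omega>)"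
    and R_nonneg: "0 \<le> R \<omega>" for \<omega>
  proof -
    have sq: "(norm (elementary_process A a b \<xi> (\<omega>, s)))\<^sup>2
      = (\<Sum>k\<in>UNIV. \<Sum>l\<in>UNIV. \<Sum>i\<in>A. \<Sum>j\<in>A. indicator ({a i<..b i} \<inter> {a j<..b j}) s *\<^sub>R (\<xi> i \<omega> $ k $ l * \<xi> j \<omega> $ k $ l))" for s
      unfolding power2_norm_matrix elementary_process_def
      by (simp add: power2_eq_square sum_product indicator_inter_arith mult_ac del: Int_greaterThanAtMost)
    have ind: "integrable lborel (indicator ({a i<..b i} \<inter> {a j<..b j}) :: real \<Rightarrow> real)" for i j
      by (intro integrable_real_indicator emeasure_bounded_finite) auto
    have int: "integrable lborel (\<lambda>s. indicator ({a i<..b i} \<inter> {a j<..b j}) s *\<^sub>R (c::real))" for i j c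
      using ind by (intro integrable_scaleR_left)
    have val: "(\<integral>s. indicator ({a i<..b i} \<inter> {a j<..b j}) s *\<^sub>R (c::real) \<partial>lborel) = ?ov i j * c" for i j c
      using ind[of i j] by (subst integral_scaleR_left) (simp_all add: overlap_def del: Int_greaterThanAtMost)
    have I: "integrable lborel (\<lambda>s. (norm (elementary_process A a b \<xi> (\<omega>, s)))\<^sup>2)"
      unfolding sq by (intro Bochner_Integration.integrable_sum int)
    have V: "(\<integral>s. (norm (elementary_process A a b \<xi> (\<omega>, s)))\<^sup>2 \<partial>lborel) = R \<omega>"
      unfolding sq R_def
      by (simp only: Bochner_Integration.integral_sum Bochner_Integration.integrable_sum int val)
    show "(\<integral>\<^sup>+ s. ennreal ((norm (elementary_process A a b \<xi> (\<omega>, s)))\<^sup>2) \<partial>lborel) = ennreal (R \<omega>)"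
      using nn_integral_eq_integral[OF I] V by simp
    show "0 \<le> R \<omega>" unfolding V[symmetric] by (rule Bochner_Integration.integral_nonneg) simp
  qed

  (* A row of a coefficient matrix times an increment is itself a sum over components, so each entry of the integral is a sum over pairs of an interval and a component. *)
  let ?P = "A \<times> (UNIV :: 'n set)"
  have entry: "elementary_integral A a b \<xi> \<omega> $ k
      = (\<Sum>p\<in>?P. \<xi> (fst p) \<omega> $ k $ snd p * (W (b (fst p)) \<omega> - W (a (fst p)) \<omega>) $ snd p)" for \<omega> k
    by (simp add: elementary_integral_def matrix_vector_mult_def sum.cartesian_product' )
  note cov = sum_covariance[of ?P "\<lambda>p. a (fst p)" "\<lambda>p. b (fst p)" "\<lambda>p \<omega>. \<xi> (fst p) \<omega> $ k $ snd p"
        "\<lambda>p. B (fst p)" snd for k]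
  have covI: "integrable M (\<lambda>\<omega>. (elementary_integral A a b \<xi> \<omega> $ k)\<^sup>2)" for k
    unfolding entry by (rule cov(1)) (use fin ab comp Bc in auto)
  have covE: "expectation (\<lambda>\<omega>. (elementary_integral A a b \<xi> \<omega> $ k)\<^sup>2)
     = (\<Sum>l\<in>UNIV. \<Sum>i\<in>A. \<Sum>j\<in>A. ?ov i j * expectation (\<lambda>\<omega>. \<xi> i \<omega> $ k $ l * \<xi> j \<omega> $ k $ l))" for k
  proof -
    have "expectation (\<lambda>\<omega>. (elementary_integral A a b \<xi> \<omega> $ k)\<^sup>2)
      = (\<Sum>p\<in>?P. \<Sum>q\<in>?P. if snd p = snd q then ?ov (fst p) (fst q) * expectation (\<lambda>\<omega>. \<xi> (fst p) \<omega> $ k $ snd p * \<xi> (fst q) \<omega> $ k $ snd q) else 0)"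
      unfolding entry by (rule cov(2)) (use fin ab comp Bc in auto)
    also have "\<dots> = (\<Sum>i\<in>A. \<Sum>l\<in>UNIV. \<Sum>j\<in>A. \<Sum>l'\<in>UNIV. if l = l' then ?ov i j * expectation (\<lambda>\<omega>. \<xi> i \<omega> $ k $ l * \<xi> j \<omega> $ k $ l') else 0)"
      by (simp add: sum.cartesian_product')
    also have "\<dots> = (\<Sum>i\<in>A. \<Sum>l\<in>UNIV. \<Sum>j\<in>A. ?ov i j * expectation (\<lambda>\<omega>. \<xi> i \<omega> $ k $ l * \<xi> j \<omega> $ k $ l))"
      by (simp add: sum.delta)
    finally show ?thesis by (simp add: sum.swap[of _ UNIV A])
  qed
  have I: "integrable M (\<lambda>\<omega>. (norm (elementary_integral A a b \<xi> \<omega>))\<^sup>2)"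
    unfolding power2_norm_vec by (intro Bochner_Integration.integrable_sum covI)
  have E: "expectation (\<lambda>\<omega>. (norm (elementary_integral A a b \<xi> \<omega>))\<^sup>2) = expectation R"
    unfolding power2_norm_vec ER by (simp add: Bochner_Integration.integral_sum covI covE)
  have meas: "(\<lambda>p. ennreal ((norm (elementary_process A a b \<xi> p))\<^sup>2)) \<in> borel_measurable (M \<Otimes>\<^sub>M lborel)"
    using elementary_process_measurable[OF el] by measurable
  have "(\<integral>\<^sup>+ \<omega>. ennreal ((norm (elementary_integral A a b \<xi> \<omega>))\<^sup>2) \<partial>M) = ennreal (expectation R)"
    using nn_integral_eq_integral[OF I] E by simp
  also have "\<dots> = (\<integral>\<^sup>+ \<omega>. ennreal (R \<omega>) \<partial>M)"
    using nn_integral_eq_integral[OF R_int] R_nonneg by simp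
  also have "\<dots> = (\<integral>\<^sup>+ \<omega>. \<integral>\<^sup>+ s. ennreal ((norm (elementary_process A a b \<xi> (\<omega>, s)))\<^sup>2) \<partial>lborel \<partial>M)"
    by (simp add: time)
  also have "\<dots> = (\<integral>\<^sup>+ p. ennreal ((norm (elementary_process A a b \<xi> p))\<^sup>2) \<partial>(M \<Otimes>\<^sub>M lborel))"
    using lborel.nn_integral_fst[OF meas] by simp
  finally show ?thesis .
qed

text \<open>The difference is again elementary, indexed by the disjoint union of the two index sets.\<close>

lemma elementary_isometry_diff:
  fixes \<xi> :: "'i \<Rightarrow> 'w \<Rightarrow> real ^ 'n ^ 'k" and \<xi>' :: "'j \<Rightarrow> 'w \<Rightarrow> real ^ 'n ^ 'k"
  assumes el: "elementary A a b \<xi>" and el': "elementary A' a' b' \<xi>'"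
  shows "mean_sq_dist M (elementary_integral A a b \<xi>) (elementary_integral A' a' b' \<xi>')
    = mean_sq_dist (M \<Otimes>\<^sub>M lborel) (elementary_process A a b \<xi>) (elementary_process A' a' b' \<xi>')"
proof -
  let ?A = "A <+> A'" and ?a = "case_sum a a'" and ?b = "case_sum b b'"
  let ?\<xi> = "case_sum \<xi> (\<lambda>j \<omega>. - \<xi>' j \<omega>)"
  have fin: "finite A" "finite A'" using el el' by (auto simp: elementary_def)
  have bd: "bounded ((\<lambda>\<omega>. - \<xi>' j \<omega>) ` space M)" if "j \<in> A'" for j
    using el' that bounded_uminus[of "\<xi>' j ` space M"] by (auto simp: elementary_def image_image)
  have "elementary ?A ?a ?b ?\<xi>"
    using el el' bd by (auto simp: elementary_def elim!: PlusE)
  from elementary_isometry[OF this]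
  have "(\<integral>\<^sup>+ \<omega>. ennreal ((norm (elementary_integral ?A ?a ?b ?\<xi> \<omega>))\<^sup>2) \<partial>M)
    = (\<integral>\<^sup>+ p. ennreal ((norm (elementary_process ?A ?a ?b ?\<xi> p))\<^sup>2) \<partial>(M \<Otimes>\<^sub>M lborel))" .
  moreover have "elementary_integral ?A ?a ?b ?\<xi> \<omega> = elementary_integral A a b \<xi> \<omega> - elementary_integral A' a' b' \<xi>' \<omega>" for \<omega>
  proof -
    have "(- m) *v v = - (m *v v)" for m :: "real ^ 'n ^ 'k" and v
      by (simp add: vec_eq_iff matrix_vector_mult_def sum_negf)
    then show ?thesis using fin by (simp add: elementary_integral_def sum.Plus sum_negf)
  qed
  moreover have "elementary_process ?A ?a ?b ?\<xi> p = elementary_process A a b \<xi> p - elementary_process A' a' b' \<xi>' p" for p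
    unfolding elementary_process_def sum.Plus[OF fin] by (simp add: sum_negf)
  ultimately show ?thesis by (simp add: mean_sq_dist_def)
qed

section \<open>Limits of elementary stochastic integrals\<close>

text \<open>The integrand is a process on all times; an integral up to time $t$ corresponds to an integrand
  that vanishes after $t$. This puts integrals with different upper limits on the same footing.\<close>

definition ito_limit :: "('w \<times> real \<Rightarrow> real ^ 'n ^ 'k) \<Rightarrow> ('w \<Rightarrow> real ^ 'k) \<Rightarrow> bool" where
  "ito_limit K I \<longleftrightarrow> K \<in> borel_measurable (M \<Otimes>\<^sub>M lborel) \<and> I \<in> borel_measurable M \<and>
     (\<forall>\<epsilon>>0::real. \<exists>(A :: nat set) a b \<xi>. elementary A a b \<xi> \<and>
        mean_sq_dist (M \<Otimes>\<^sub>M lborel) K (elementary_process A a b \<xi>) \<le> ennreal \<epsilon> \<and>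
        mean_sq_dist M I (elementary_integral A a b \<xi>) \<le> ennreal \<epsilon>)"

lemma ito_limit_elementary:
  fixes A :: "nat set"
  assumes "elementary A a b \<xi>"
  shows "ito_limit (elementary_process A a b \<xi>) (elementary_integral A a b \<xi>)"
  unfolding ito_limit_def
  using assms elementary_process_measurable[OF assms] elementary_integral_measurable[OF assms]
  by (intro conjI allI impI exI[of _ A] exI[of _ a] exI[of _ b] exI[of _ \<xi>]) (auto simp: mean_sq_dist_def)

text \<open>Each of the two triangle inequalities, one for the integrals and one for the integrands, has
  three terms and costs a factor 3 for the squares; the approximation errors are arbitrarily small.\<close>

lemma ito_limit_isometry:
  assumes KI: "ito_limit K I" and KI': "ito_limit K' I'"
  shows "mean_sq_dist M I I' \<le> 9 * mean_sq_dist (M \<Otimes>\<^sub>M lborel) K K'"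
proof (rule ennreal_le_epsilon)
  fix e :: real assume "0 < e"
  (* Accuracy e/24 suffices, as the approximation errors enter the estimate 2 * 3 + 2 * 9 = 24 times. *)
  then have e: "e / 24 > 0" by simp
  let ?N = "M \<Otimes>\<^sub>M lborel"
  obtain A a b \<xi> where 1: "elementary (A::nat set) a b \<xi>"
      "mean_sq_dist ?N K (elementary_process A a b \<xi>) \<le> ennreal (e / 24)" "mean_sq_dist M I (elementary_integral A a b \<xi>) \<le> ennreal (e / 24)"
    using KI e unfolding ito_limit_def by blast
  obtain A' a' b' \<xi>' where 2: "elementary (A'::nat set) a' b' \<xi>'"
      "mean_sq_dist ?N K' (elementary_process A' a' b' \<xi>') \<le> ennreal (e / 24)" "mean_sq_dist M I' (elementary_integral A' a' b' \<xi>') \<le> ennreal (e / 24)"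
    using KI' e unfolding ito_limit_def by blast
  have meas: "K \<in> borel_measurable ?N" "K' \<in> borel_measurable ?N" "I \<in> borel_measurable M" "I' \<in> borel_measurable M"
    using KI KI' by (auto simp: ito_limit_def)
  have "mean_sq_dist M I I' \<le> 3 * (mean_sq_dist M I (elementary_integral A a b \<xi>)
      + mean_sq_dist M (elementary_integral A a b \<xi>) (elementary_integral A' a' b' \<xi>') + mean_sq_dist M (elementary_integral A' a' b' \<xi>') I')"
    by (intro mean_sq_dist_triangle3 meas elementary_integral_measurable 1 2)
  also have "\<dots> \<le> 3 * (ennreal (e / 24)
      + 3 * (ennreal (e / 24) + mean_sq_dist ?N K K' + ennreal (e / 24)) + ennreal (e / 24))"
  proof (intro mult_left_mono add_mono 1(3))
    show "mean_sq_dist M (elementary_integral A' a' b' \<xi>') I' \<le> ennreal (e / 24)" using 2(3) by (simp add: mean_sq_dist_commute)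
    have "mean_sq_dist M (elementary_integral A a b \<xi>) (elementary_integral A' a' b' \<xi>')
       = mean_sq_dist ?N (elementary_process A a b \<xi>) (elementary_process A' a' b' \<xi>')"
      by (rule elementary_isometry_diff[OF 1(1) 2(1)])
    also have "\<dots> \<le> 3 * (mean_sq_dist ?N (elementary_process A a b \<xi>) K + mean_sq_dist ?N K K' + mean_sq_dist ?N K' (elementary_process A' a' b' \<xi>'))"
      by (intro mean_sq_dist_triangle3 meas elementary_process_measurable 1 2)
    also have "\<dots> \<le> 3 * (ennreal (e / 24) + mean_sq_dist ?N K K' + ennreal (e / 24))"
      using 1(2) 2(2) by (intro mult_left_mono add_mono) (simp_all add: mean_sq_dist_commute)
    finally show "mean_sq_dist M (elementary_integral A a b \<xi>) (elementary_integral A' a' b' \<xi>')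
      \<le> 3 * (ennreal (e / 24) + mean_sq_dist ?N K K' + ennreal (e / 24))" .
  qed simp
  also have "\<dots> = 9 * mean_sq_dist ?N K K' + 24 * ennreal (e / 24)"
    by (simp add: distrib_left algebra_simps flip: mult.assoc)
       (simp add: add_ac flip: distrib_right)
  also have "24 * ennreal (e / 24) = ennreal e"
    using \<open>0 < e\<close> by (simp add: ennreal_mult'[symmetric] flip: ennreal_numeral)
  finally show "mean_sq_dist M I I' \<le> 9 * mean_sq_dist ?N K K' + ennreal e" .
qed

text \<open>Stopping a simple process at $t$ cuts its intervals at $t$. Intervals that start at or after
  $t$ are dropped: their increments vanish, while their coefficients need not be known at time $t$.\<close>

lemma has_Ito_integral_imp_ito_limit:
  assumes t: "0 \<le> t" and ito: "has_Ito_integral M G W H t I"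
  shows "ito_limit (\<lambda>p. indicator {0..t} (snd p) *\<^sub>R H (snd p) (fst p)) I"
proof -
  let ?K = "\<lambda>p. indicator {0..t} (snd p) *\<^sub>R H (snd p) (fst p)"
  have I: "I \<in> borel_measurable M" using ito by (simp add: has_Ito_integral_def)
  have prog: "(\<lambda>(s, \<omega>). H s \<omega>) \<in> borel_measurable (restrict_space borel {0..t} \<Otimes>\<^sub>M G t)"
    using ito t by (auto simp: has_Ito_integral_def progressively_measurable_def)
  have id: "(\<lambda>\<omega>. \<omega>) \<in> measurable M (G t)"
    using sets_G[OF t] space_G[of t] by (auto simp: measurable_def dest: sets.sets_into_space)
  have K: "?K \<in> borel_measurable (M \<Otimes>\<^sub>M lborel)"
  proof -
    let ?S = "{p \<in> space (M \<Otimes>\<^sub>M lborel). snd p \<in> {0..t}}"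
    have S: "?S \<in> sets (M \<Otimes>\<^sub>M lborel)" by measurable
    have "(\<lambda>p. (snd p, fst p)) \<in> measurable (restrict_space (M \<Otimes>\<^sub>M lborel) ?S) (restrict_space borel {0..t} \<Otimes>\<^sub>M G t)"
    proof (rule measurable_Pair)
      show "snd \<in> measurable (restrict_space (M \<Otimes>\<^sub>M lborel) ?S) (restrict_space borel {0..t})"
        by (intro measurable_restrict_space2 measurable_restrict_space1) (auto simp: space_restrict_space)
      show "fst \<in> measurable (restrict_space (M \<Otimes>\<^sub>M lborel) ?S) (G t)"
        by (intro measurable_restrict_space1 measurable_compose[OF measurable_fst id])
    qed
    from measurable_compose[OF this prog]
    have "(\<lambda>p. H (snd p) (fst p)) \<in> borel_measurable (restrict_space (M \<Otimes>\<^sub>M lborel) ?S)" by simp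
    then have "(\<lambda>p. indicator ?S p *\<^sub>R H (snd p) (fst p)) \<in> borel_measurable (M \<Otimes>\<^sub>M lborel)"
      using S by (subst (asm) borel_measurable_restrict_space_iff) auto
    then show ?thesis
      by (rule measurable_cong[THEN iffD1, rotated]) (auto simp: indicator_def)
  qed
  obtain N \<tau> \<xi> where S: "\<And>j. simple_process M G (N j) (\<tau> j) (\<xi> j)"
    and lim1: "(\<lambda>j. \<integral>\<^sup>+ \<omega>. (\<integral>\<^sup>+ s\<in>{0..t}. ennreal ((norm (H s \<omega> - simple_value (N j) (\<tau> j) (\<xi> j) s \<omega>))\<^sup>2) \<partial>lborel) \<partial>M)
           \<longlonglongrightarrow> 0"
    and lim2: "(\<lambda>j. \<integral>\<^sup>+ \<omega>. ennreal ((norm (I \<omega> - simple_integral W (N j) (\<tau> j) (\<xi> j) t \<omega>))\<^sup>2) \<partial>M)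
           \<longlonglongrightarrow> 0"
    using ito unfolding has_Ito_integral_def by blast
  show ?thesis unfolding ito_limit_def
  proof (intro conjI allI impI K I)
    fix \<epsilon> :: real assume "0 < \<epsilon>"
    then have "ennreal \<epsilon> > 0" by simp
    from eventually_conj[OF order_tendstoD(2)[OF lim1 this] order_tendstoD(2)[OF lim2 this]]
    obtain j where j: "(\<integral>\<^sup>+ \<omega>. (\<integral>\<^sup>+ s\<in>{0..t}. ennreal ((norm (H s \<omega> - simple_value (N j) (\<tau> j) (\<xi> j) s \<omega>))\<^sup>2) \<partial>lborel) \<partial>M) < \<epsilon>"
      "(\<integral>\<^sup>+ \<omega>. ennreal ((norm (I \<omega> - simple_integral W (N j) (\<tau> j) (\<xi> j) t \<omega>))\<^sup>2) \<partial>M) < \<epsilon>"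
      by (auto simp: eventually_sequentially)
    have pos: "0 \<le> \<tau> j i" if "i \<le> N j" for i
      using that
    proof (induction i)
      case 0 then show ?case using S[of j] by (simp add: simple_process_def)
    next
      case (Suc i)
      then have "0 \<le> \<tau> j i" "\<tau> j i \<le> \<tau> j (Suc i)" using S[of j] by (auto simp: simple_process_def)
      then show ?case by linarith
    qed
    let ?A = "{i. i < N j \<and> \<tau> j i < t}" and ?b = "\<lambda>i. min t (\<tau> j (Suc i))"
    have el: "elementary ?A (\<tau> j) ?b (\<xi> j)"
      using S[of j] pos by (auto simp: elementary_def simple_process_def)
    have int: "elementary_integral ?A (\<tau> j) ?b (\<xi> j) \<omega> = simple_integral W (N j) (\<tau> j) (\<xi> j) t \<omega>" for \<omega>
      unfolding elementary_integral_def simple_integral_def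
    proof (rule sum.mono_neutral_cong_left)
      show "\<forall>i\<in>{..<N j} - ?A. \<xi> j i \<omega> *v (W (min t (\<tau> j (Suc i))) \<omega> - W (min t (\<tau> j i)) \<omega>) = 0"
      proof
        fix i assume i: "i \<in> {..<N j} - ?A"
        then have "\<tau> j i \<le> \<tau> j (Suc i)" "t \<le> \<tau> j i" using S[of j] by (auto simp: simple_process_def)
        then show "\<xi> j i \<omega> *v (W (min t (\<tau> j (Suc i))) \<omega> - W (min t (\<tau> j i)) \<omega>) = 0"
          by (simp add: min_def matrix_vector_mult_0_right)
      qed
    qed (auto simp: min_def)
    have proc: "?K (\<omega>, s) - elementary_process ?A (\<tau> j) ?b (\<xi> j) (\<omega>, s)
        = indicator {0..t} s *\<^sub>R (H s \<omega> - simple_value (N j) (\<tau> j) (\<xi> j) s \<omega>)" for \<omega> s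
    proof (cases "s \<in> {0..t}")
      case True
      have "elementary_process ?A (\<tau> j) ?b (\<xi> j) (\<omega>, s) = simple_value (N j) (\<tau> j) (\<xi> j) s \<omega>"
        unfolding elementary_process_def simple_value_def
        using True by (intro sum.mono_neutral_cong_left) (auto simp: indicator_def)
      then show ?thesis using True by simp
    next
      case False
      then have "elementary_process ?A (\<tau> j) ?b (\<xi> j) (\<omega>, s) = 0"
        unfolding elementary_process_def
      proof (intro sum.neutral ballI)
        fix i assume "i \<in> ?A"
        then have "0 \<le> \<tau> j i" using pos[of i] by simp
        then have "s \<notin> {\<tau> j i<..?b i}" using False by auto
        then show "indicator {\<tau> j i<..?b i} (snd (\<omega>, s)) *\<^sub>R \<xi> j i (fst (\<omega>, s)) = 0" by simp
      qed
      then show ?thesis using False by simp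
    qed
    have "mean_sq_dist (M \<Otimes>\<^sub>M lborel) ?K (elementary_process ?A (\<tau> j) ?b (\<xi> j))
      = (\<integral>\<^sup>+ \<omega>. \<integral>\<^sup>+ s. ennreal ((norm (?K (\<omega>, s) - elementary_process ?A (\<tau> j) ?b (\<xi> j) (\<omega>, s)))\<^sup>2) \<partial>lborel \<partial>M)"
      unfolding mean_sq_dist_def
      by (intro lborel.nn_integral_fst[symmetric]
            measurable_compose[OF borel_measurable_diff[OF K elementary_process_measurable[OF el]],
              of "\<lambda>x. ennreal ((norm x)\<^sup>2)"]) measurable
    also have "\<dots> = (\<integral>\<^sup>+ \<omega>. (\<integral>\<^sup>+ s\<in>{0..t}. ennreal ((norm (H s \<omega> - simple_value (N j) (\<tau> j) (\<xi> j) s \<omega>))\<^sup>2) \<partial>lborel) \<partial>M)"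
      unfolding proc by (intro nn_integral_cong) (simp split: split_indicator)
    finally have "mean_sq_dist (M \<Otimes>\<^sub>M lborel) ?K (elementary_process ?A (\<tau> j) ?b (\<xi> j)) \<le> ennreal \<epsilon>"
      using j(1) by simp
    moreover have "mean_sq_dist M I (elementary_integral ?A (\<tau> j) ?b (\<xi> j)) \<le> ennreal \<epsilon>"
      unfolding mean_sq_dist_def int using j(2) by simp
    ultimately show "\<exists>(A :: nat set) a b \<xi>. elementary A a b \<xi> \<and>
        mean_sq_dist (M \<Otimes>\<^sub>M lborel) ?K (elementary_process A a b \<xi>) \<le> ennreal \<epsilon> \<and>
        mean_sq_dist M I (elementary_integral A a b \<xi>) \<le> ennreal \<epsilon>"
      using el by blast
  qed
qed

end

section \<open>Lipschitz coefficients\<close>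

text \<open>The assumption shared by drift and running cost. Averaging over a relaxed control preserves
  the bound and the Lipschitz estimate, since both are uniform in the control.\<close>

definition Lipschitz_coefficient ::
  "(('a::euclidean_space) \<Rightarrow> 'a measure \<Rightarrow> 'u::topological_space \<Rightarrow> 'b::{banach, second_countable_topology})
     \<Rightarrow> real \<Rightarrow> real \<Rightarrow> bool" where
  "Lipschitz_coefficient f L C \<longleftrightarrow>
     (\<forall>\<mu>\<in>prob_measures. \<forall>x. f x \<mu> \<in> borel_measurable borel) \<and>
     (\<forall>\<mu>\<in>prob_measures. \<forall>x \<zeta>. norm (f x \<mu> \<zeta>) \<le> C) \<and>
     (\<forall>\<mu>\<in>prob_measures. \<forall>\<nu>\<in>prob_measures. \<forall>x y \<zeta>.
        ennreal (norm (f x \<mu> \<zeta> - f y \<nu> \<zeta>)) \<le> ennreal L * (ennreal (norm (x - y)) + W1 \<mu> \<nu>))"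

lemma Lipschitz_coefficient_norm_le:
  assumes "Lipschitz_coefficient f L C" "\<mu> \<in> prob_measures" "v \<in> prob_measures"
  shows "norm (relaxed f x \<mu> v) \<le> C"
  using assms by (intro norm_relaxed_le) (auto simp: Lipschitz_coefficient_def)

lemma Lipschitz_coefficient_diff_le:
  assumes "Lipschitz_coefficient f L C" "\<mu> \<in> prob_measures" "\<nu> \<in> prob_measures" "v \<in> prob_measures"
  shows "ennreal (norm (relaxed f x \<mu> v - relaxed f y \<nu> v)) \<le> ennreal L * (ennreal (norm (x - y)) + W1 \<mu> \<nu>)"
  using assms by (intro norm_relaxed_diff_le[where C = C]) (auto simp: Lipschitz_coefficient_def)

lemma continuous_on_ennreal_Lipschitz:
  fixes f :: "'a::real_normed_vector \<Rightarrow> 'b::real_normed_vector"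
  assumes "\<And>x y. ennreal (norm (f x - f y)) \<le> ennreal L * ennreal (norm (x - y))" "0 \<le> L"
  shows "continuous_on UNIV f"
proof (rule lipschitz_on_continuous_on[of L], rule lipschitz_onI)
  fix x y
  have "ennreal (norm (f x - f y)) \<le> ennreal (L * norm (x - y))"
    using assms by (simp add: ennreal_mult)
  then show "dist (f x) (f y) \<le> L * dist x y"
    using assms(2) by (simp add: dist_norm ennreal_le_iff)
qed fact

lemma Lipschitz_coefficient_continuous:
  assumes "Lipschitz_coefficient f L C" "0 \<le> L" "\<mu> \<in> prob_measures" "v \<in> prob_measures"
  shows "continuous_on UNIV (\<lambda>x. relaxed f x \<mu> v)"
proof (rule continuous_on_ennreal_Lipschitz[of _ L])
  show "ennreal (norm (relaxed f x \<mu> v - relaxed f y \<mu> v)) \<le> ennreal L * ennreal (norm (x - y))" for x y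
    using Lipschitz_coefficient_diff_le[OF assms(1,3,3,4), of x y] W1_self[OF assms(3)] by simp
qed fact

text \<open>The average is continuous in the state and measurable in the control measure, hence a
  Caratheodory function of the two.\<close>

lemma relaxed_along_measurable:
  assumes f: "Lipschitz_coefficient f L C" "0 \<le> L" and \<mu>: "\<mu> \<in> prob_measures"
    and Y: "Y \<in> borel_measurable N" and m: "m \<in> measurable N (prob_algebra borel)"
  shows "(\<lambda>\<omega>. relaxed f (Y \<omega>) \<mu> (m \<omega>)) \<in> borel_measurable N"
proof (rule borel_measurable_Caratheodory[OF _ _ Y])
  show "continuous_on UNIV (\<lambda>x. relaxed f x \<mu> (m \<omega>))" if "\<omega> \<in> space N" for \<omega>
    using measurable_space[OF m that] by (intro Lipschitz_coefficient_continuous[OF f \<mu>])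
  show "(\<lambda>\<omega>. relaxed f x \<mu> (m \<omega>)) \<in> borel_measurable N" for x
    using f \<mu> by (intro relaxed_measurable m) (auto simp: Lipschitz_coefficient_def)
qed

lemma ennreal_squared_le_of_Lipschitz:
  fixes w :: ennreal
  assumes "ennreal r \<le> ennreal L * (ennreal s + w)" "0 \<le> r" "0 \<le> L" "0 \<le> s" "w\<^sup>2 \<le> q"
  shows "ennreal (r\<^sup>2) \<le> ennreal (2 * L\<^sup>2) * (ennreal (s\<^sup>2) + q)"
proof -
  have "ennreal (r\<^sup>2) = (ennreal r)\<^sup>2" using assms by (simp add: ennreal_power)
  also have "\<dots> \<le> (ennreal L * (ennreal s + w))\<^sup>2" using assms(1) by (intro power_mono) auto
  also have "\<dots> = ennreal (L\<^sup>2) * (ennreal s + w)\<^sup>2" using assms by (simp add: power_mult_distrib ennreal_power)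
  also have "\<dots> \<le> ennreal (L\<^sup>2) * (2 * ((ennreal s)\<^sup>2 + w\<^sup>2))"
    by (intro mult_left_mono ennreal_add_squared_le) simp
  also have "\<dots> \<le> ennreal (L\<^sup>2) * (2 * (ennreal (s\<^sup>2) + q))"
    using assms by (intro mult_left_mono add_mono) (auto simp: ennreal_power)
  also have "\<dots> = ennreal (2 * L\<^sup>2) * (ennreal (s\<^sup>2) + q)"
    by (simp add: ennreal_mult' mult_ac del: distrib_left_numeral)
  finally show ?thesis .
qed

section \<open>Strong error of the Euler--Maruyama scheme\<close>

text \<open>A solution \<open>X\<close> on \<open>{0..T}\<close> for the grid policy \<open>m\<close>, together with the data of the Euler
  scheme of step \<open>h\<close> driven by the same \<open>m\<close> and \<open>W\<close>.\<close>

locale euler_approximation = adapted_increments M G W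
  for M :: "'w measure" and G :: "real \<Rightarrow> 'w measure" and W :: "real \<Rightarrow> 'w \<Rightarrow> real ^ 'n" +
  fixes b :: "real ^ 'n \<Rightarrow> (real ^ 'n) measure \<Rightarrow> 'u::topological_space \<Rightarrow> real ^ 'n"
    and \<sigma> :: "real ^ 'n \<Rightarrow> (real ^ 'n) measure \<Rightarrow> real ^ 'n ^ 'n"
    and m :: "real \<Rightarrow> 'w \<Rightarrow> 'u measure" and X :: "real \<Rightarrow> 'w \<Rightarrow> real ^ 'n"
    and x :: "real ^ 'n" and T h C1 C2 :: real
  assumes T: "0 < T" and h: "0 < h" and C1: "0 < C1" and C2: "0 < C2"
    and b: "Lipschitz_coefficient b C1 C2"
    and \<sigma>_Lipschitz: "\<And>y z \<mu> \<nu>. \<mu> \<in> prob_measures \<Longrightarrow> \<nu> \<in> prob_measures \<Longrightarrow>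
      ennreal (norm (\<sigma> y \<mu> - \<sigma> z \<nu>)) \<le> ennreal C1 * (ennreal (norm (y - z)) + W1 \<mu> \<nu>)"
    and \<sigma>_le: "\<And>y \<mu>. \<mu> \<in> prob_measures \<Longrightarrow> norm (\<sigma> y \<mu>) \<le> C2"
    and m_adapted: "\<And>r s. 0 \<le> r \<Longrightarrow> r \<le> s \<Longrightarrow> m r \<in> measurable (G s) (prob_algebra borel)"
    and m_piecewise: "piecewise_constant M h m"
    and X_adapted: "\<And>t. t \<in> {0..T} \<Longrightarrow> X t \<in> borel_measurable (G t)"
    and X_continuous: "\<And>\<omega>. \<omega> \<in> space M \<Longrightarrow> continuous_on {0..T} (\<lambda>t. X t \<omega>)"
    and X_solution: "\<And>t. t \<in> {0..T} \<Longrightarrow> \<exists>I.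
      has_Ito_integral M G W (\<lambda>s \<omega>. \<sigma> (X s \<omega>) (law M (X s))) t I \<and>
      (AE \<omega> in M. set_integrable lborel {0..t} (\<lambda>s. relaxed b (X s \<omega>) (law M (X s)) (m s \<omega>)) \<and>
         X t \<omega> = x + (LINT s:{0..t}|lborel. relaxed b (X s \<omega>) (law M (X s)) (m s \<omega>)) + I \<omega>)"
begin

abbreviation Y :: "nat \<Rightarrow> 'w \<Rightarrow> real ^ 'n" where "Y \<equiv> euler_maruyama M W b \<sigma> h x m"

abbreviation drift :: "real \<Rightarrow> 'w \<Rightarrow> real ^ 'n" where
  "drift s \<omega> \<equiv> relaxed b (X s \<omega>) (law M (X s)) (m s \<omega>)"

abbreviation euler_drift :: "nat \<Rightarrow> 'w \<Rightarrow> real ^ 'n" where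
  "euler_drift j \<omega> \<equiv> relaxed b (Y j \<omega>) (law M (Y j)) (m (real j * h) \<omega>)"

abbreviation euler_noise :: "nat \<Rightarrow> 'w \<Rightarrow> real ^ 'n ^ 'n" where
  "euler_noise j \<omega> \<equiv> \<sigma> (Y j \<omega>) (law M (Y j))"

lemma grid_nonneg: "0 \<le> real k * h" using h by simp

lemma grid_mono: "j \<le> k \<Longrightarrow> real j * h \<le> real k * h"
  using h by (intro mult_right_mono) auto

lemma m_prob: "0 \<le> s \<Longrightarrow> \<omega> \<in> space M \<Longrightarrow> m s \<omega> \<in> prob_measures"
  using measurable_space[OF m_adapted[of s s]] space_G by blast

lemma m_grid:
  assumes "0 \<le> s" "\<omega> \<in> space M"
  shows "m s \<omega> = m (real (grid_index h s) * h) \<omega>"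
  using m_piecewise grid_index_bounds[OF h assms(1)] assms unfolding piecewise_constant_def by auto

lemma X_measurable: "t \<in> {0..T} \<Longrightarrow> X t \<in> borel_measurable M"
  using G_measurable_M[OF X_adapted] by simp

lemma law_X: "t \<in> {0..T} \<Longrightarrow> law M (X t) \<in> prob_measures"
  by (intro law_in_prob_measures X_measurable prob_space_axioms)

lemma \<sigma>_measurable: "\<mu> \<in> prob_measures \<Longrightarrow> (\<lambda>y. \<sigma> y \<mu>) \<in> borel_measurable borel"
  using \<sigma>_Lipschitz[of \<mu> \<mu>] W1_self[of \<mu>] C1
  by (intro borel_measurable_continuous_onI continuous_on_ennreal_Lipschitz[of _ C1]) auto

lemma Y_adapted: "Y k \<in> borel_measurable (G (real k * h))"
proof (induction k)
  case 0 show ?case by simp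
next
  case (Suc k)
  let ?t = "real k * h" and ?t' = "real (Suc k) * h"
  have tt': "?t \<le> ?t'" "0 \<le> ?t" "0 \<le> ?t'" using grid_mono[of k "Suc k"] grid_nonneg[of k] grid_nonneg[of "Suc k"] by auto
  have Y': "Y k \<in> borel_measurable (G ?t')" by (rule G_measurable_mono[OF Suc tt'(2,1)])
  have law: "law M (Y k) \<in> prob_measures"
    using G_measurable_M[OF Suc tt'(2)] by (intro law_in_prob_measures prob_space_axioms)
  have "euler_drift k \<in> borel_measurable (G ?t')"
    using b C1 law Y' m_adapted[OF tt'(2,1)] by (intro relaxed_along_measurable[of _ C1 C2]) auto
  moreover have "euler_noise k \<in> borel_measurable (G ?t')"
    by (rule measurable_compose[OF Y' \<sigma>_measurable[OF law]])
  moreover have "(\<lambda>\<omega>. W ?t' \<omega> - W ?t \<omega>) \<in> borel_measurable (G ?t')"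
    using tt' W_adapted[of ?t'] G_measurable_mono[OF W_adapted[of ?t], of ?t'] by (intro borel_measurable_diff)
  ultimately show ?case using Y'
    unfolding euler_maruyama.simps Let_def
    by (intro borel_measurable_add borel_measurable_scaleR matrix_vector_measurable) auto
qed

lemma Y_measurable: "Y k \<in> borel_measurable M"
  using G_measurable_M[OF Y_adapted grid_nonneg] .

lemma law_Y: "law M (Y k) \<in> prob_measures"
  by (intro law_in_prob_measures Y_measurable prob_space_axioms)

lemma norm_drift_le: "s \<in> {0..T} \<Longrightarrow> \<omega> \<in> space M \<Longrightarrow> norm (drift s \<omega>) \<le> C2"
  using Lipschitz_coefficient_norm_le[OF b law_X m_prob] by simp

text \<open>Freezing the path outside \<open>{0..T}\<close> makes it continuous on the whole line, and so jointly
  measurable in outcome and time.\<close>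

definition X_extended :: "'w \<times> real \<Rightarrow> real ^ 'n" where
  "X_extended p = X (max 0 (min T (snd p))) (fst p)"

lemma clamp_in: "max 0 (min T s) \<in> {0..T}" using T by auto

lemma X_extended_eq: "s \<in> {0..T} \<Longrightarrow> X_extended (\<omega>, s) = X s \<omega>"
  by (simp add: X_extended_def)

lemma clamped_path_continuous:
  assumes "\<omega> \<in> space M" shows "continuous_on UNIV (\<lambda>t. X (max 0 (min T t)) \<omega>)"
proof (rule continuous_on_compose2[OF X_continuous[OF assms]])
  show "continuous_on UNIV (\<lambda>t. max 0 (min T t))" by (intro continuous_intros)
qed (use T in auto)

lemma X_extended_measurable: "X_extended \<in> borel_measurable (M \<Otimes>\<^sub>M lborel)"
proof -
  have "(\<lambda>p. X (max 0 (min T (snd p))) (fst p)) \<in> borel_measurable (M \<Otimes>\<^sub>M lborel)"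
  proof (rule borel_measurable_Caratheodory[where f = "\<lambda>t p. X (max 0 (min T t)) (fst p)" and Y = snd])
    show "(\<lambda>p. X (max 0 (min T t)) (fst p)) \<in> borel_measurable (M \<Otimes>\<^sub>M lborel)" for t
      by (rule measurable_compose[OF measurable_fst X_measurable[OF clamp_in]])
    show "continuous_on UNIV (\<lambda>t. X (max 0 (min T t)) (fst p))" if "p \<in> space (M \<Otimes>\<^sub>M lborel)" for p
      using that by (intro clamped_path_continuous) (auto simp: space_pair_measure)
  qed simp
  then show ?thesis by (simp add: X_extended_def[abs_def])
qed

text \<open>The drift over $(r, s]$ is at most $C_2(s-r)$, with square at most $C_2^2 T(s-r)$; the noise
  contributes $9 C_2^2 (s-r)$; the factor 2 comes from squaring their sum.\<close>

definition increment_const :: real where "increment_const = 2 * (C2\<^sup>2 * T + 9 * C2\<^sup>2)"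

lemma increment_const_nonneg: "0 \<le> increment_const" using T by (simp add: increment_const_def)

text \<open>The difference of the stochastic integrals up to $s$ and up to $r$ has the integrand
  $\sigma 1_{(r,s]}$, to which the isometry for limits applies.\<close>

lemma solution_increment_le:
  assumes rs: "0 \<le> r" "r \<le> s" "s \<le> T"
  shows "mean_sq_dist M (X s) (X r) \<le> ennreal (increment_const * (s - r))"
proof -
  let ?H = "\<lambda>s \<omega>. \<sigma> (X s \<omega>) (law M (X s))"
  have mem: "s \<in> {0..T}" "r \<in> {0..T}" using rs by auto
  obtain I where I: "has_Ito_integral M G W ?H s I"
    "AE \<omega> in M. set_integrable lborel {0..s} (\<lambda>u. drift u \<omega>) \<and>
         X s \<omega> = x + (LINT u:{0..s}|lborel. drift u \<omega>) + I \<omega>"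
    using X_solution[OF mem(1)] by blast
  obtain J where J: "has_Ito_integral M G W ?H r J"
    "AE \<omega> in M. set_integrable lborel {0..r} (\<lambda>u. drift u \<omega>) \<and>
         X r \<omega> = x + (LINT u:{0..r}|lborel. drift u \<omega>) + J \<omega>"
    using X_solution[OF mem(2)] by blast
  have IJ: "I \<in> borel_measurable M" "J \<in> borel_measurable M"
    using I J by (auto simp: has_Ito_integral_def)
  have s0: "0 \<le> s" using rs by simp
  have "mean_sq_dist M I J \<le> 9 * mean_sq_dist (M \<Otimes>\<^sub>M lborel) (\<lambda>p. indicator {0..s} (snd p) *\<^sub>R ?H (snd p) (fst p))
     (\<lambda>p. indicator {0..r} (snd p) *\<^sub>R ?H (snd p) (fst p))"
    by (rule ito_limit_isometry[OF has_Ito_integral_imp_ito_limit[OF s0 I(1)]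
          has_Ito_integral_imp_ito_limit[OF rs(1) J(1)]])
  also have "\<dots> \<le> 9 * (\<integral>\<^sup>+ p. ennreal (C2\<^sup>2) * indicator (space M \<times> {r<..s}) p \<partial>(M \<Otimes>\<^sub>M lborel))"
    unfolding mean_sq_dist_def
  proof (intro mult_left_mono nn_integral_mono)
    fix p :: "'w \<times> real" assume "p \<in> space (M \<Otimes>\<^sub>M lborel)"
    then have \<omega>: "fst p \<in> space M" by (auto simp: space_pair_measure)
    show "ennreal ((norm (indicator {0..s} (snd p) *\<^sub>R ?H (snd p) (fst p)
        - indicator {0..r} (snd p) *\<^sub>R ?H (snd p) (fst p)))\<^sup>2)
      \<le> ennreal (C2\<^sup>2) * indicator (space M \<times> {r<..s}) p"
    proof (cases "snd p \<in> {r<..s}")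
      case True
      then have "snd p \<in> {0..T}" "snd p \<in> {0..s}" "snd p \<notin> {0..r}" using rs by auto
      moreover have "p \<in> space M \<times> {r<..s}" using True \<omega> by (cases p) auto
      ultimately show ?thesis
        using \<sigma>_le[OF law_X[OF \<open>snd p \<in> {0..T}\<close>], of "X (snd p) (fst p)"] C2
        by (simp add: power_mono ennreal_leI)
    next
      case False
      then have "(snd p \<in> {0..s}) = (snd p \<in> {0..r})" using rs by auto
      then show ?thesis by (simp add: indicator_def)
    qed
  qed simp
  also have "(\<integral>\<^sup>+ p. ennreal (C2\<^sup>2) * indicator (space M \<times> {r<..s}) p \<partial>(M \<Otimes>\<^sub>M lborel)) = ennreal (C2\<^sup>2) * ennreal (s - r)"
    using rs by (subst nn_integral_cmult_indicator)
      (auto simp: lborel.emeasure_pair_measure_Times emeasure_space_1)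
  finally have ito: "mean_sq_dist M I J \<le> 9 * (ennreal (C2\<^sup>2) * ennreal (s - r))" .
  have "mean_sq_dist M (X s) (X r) \<le> (\<integral>\<^sup>+ \<omega>. 2 * (ennreal ((C2 * (s - r))\<^sup>2) + ennreal ((norm (I \<omega> - J \<omega>))\<^sup>2)) \<partial>M)"
    unfolding mean_sq_dist_def
  proof (rule nn_integral_mono_AE)
    show "AE \<omega> in M. ennreal ((norm (X s \<omega> - X r \<omega>))\<^sup>2)
      \<le> 2 * (ennreal ((C2 * (s - r))\<^sup>2) + ennreal ((norm (I \<omega> - J \<omega>))\<^sup>2))"
      using I(2) J(2) AE_space
    proof eventually_elim
      case (elim \<omega>)
      let ?f = "\<lambda>u. indicator {0..s} u *\<^sub>R drift u \<omega> - indicator {0..r} u *\<^sub>R drift u \<omega>"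
      define D where "D = (LINT u|lborel. ?f u)"
      have f: "integrable lborel ?f" using elim by (auto simp: set_integrable_def)
      have D: "D = (LINT u:{0..s}|lborel. drift u \<omega>) - (LINT u:{0..r}|lborel. drift u \<omega>)"
        using elim unfolding D_def set_lebesgue_integral_def
        by (intro Bochner_Integration.integral_diff) (auto simp: set_integrable_def)
      have "ennreal (norm D) \<le> (\<integral>\<^sup>+ u. ennreal (norm (?f u)) \<partial>lborel)"
        unfolding D_def by (rule integral_norm_bound_ennreal[OF f])
      also have "\<dots> \<le> (\<integral>\<^sup>+ u. ennreal C2 * indicator {r<..s} u \<partial>lborel)"
      proof (rule nn_integral_mono)
        fix u
        show "ennreal (norm (?f u)) \<le> ennreal C2 * indicator {r<..s} u"
        proof (cases "u \<in> {r<..s}")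
          case True
          then have "u \<in> {0..T}" "u \<in> {0..s}" "u \<notin> {0..r}" using rs by auto
          then show ?thesis using True norm_drift_le[of u \<omega>] elim by (simp add: ennreal_leI)
        next
          case False
          then have "(u \<in> {0..s}) = (u \<in> {0..r})" using rs by auto
          then show ?thesis by (simp add: indicator_def)
        qed
      qed
      also have "\<dots> = ennreal (C2 * (s - r))"
        using rs C2 by (subst nn_integral_cmult_indicator) (auto simp: ennreal_mult)
      finally have "norm D \<le> C2 * (s - r)" using rs C2 by (simp add: ennreal_le_iff)
      then have D_le: "ennreal ((norm D)\<^sup>2) \<le> ennreal ((C2 * (s - r))\<^sup>2)" by (intro ennreal_leI power_mono) auto
      have "X s \<omega> - X r \<omega> = D + (I \<omega> - J \<omega>)" using elim D by simp
      then have "ennreal ((norm (X s \<omega> - X r \<omega>))\<^sup>2)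
        \<le> 2 * (ennreal ((norm D)\<^sup>2) + ennreal ((norm (I \<omega> - J \<omega>))\<^sup>2))"
        using norm_add_squared_le[of D "I \<omega> - J \<omega>"] by (simp only:)
      also have "\<dots> \<le> 2 * (ennreal ((C2 * (s - r))\<^sup>2) + ennreal ((norm (I \<omega> - J \<omega>))\<^sup>2))"
        by (intro mult_left_mono add_right_mono D_le) simp
      finally show ?case .
    qed
  qed
  also have "\<dots> = 2 * (ennreal ((C2 * (s - r))\<^sup>2) + mean_sq_dist M I J)"
    using IJ unfolding mean_sq_dist_def
    by (subst nn_integral_cmult, measurable) (simp add: nn_integral_add emeasure_space_1)
  also have "\<dots> \<le> 2 * (ennreal ((C2 * (s - r))\<^sup>2) + 9 * (ennreal (C2\<^sup>2) * ennreal (s - r)))"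
    using ito by (intro mult_left_mono add_left_mono) auto
  also have "\<dots> = ennreal (2 * ((C2 * (s - r))\<^sup>2 + 9 * (C2\<^sup>2 * (s - r))))"
    using rs by (simp add: ennreal_mult del: distrib_left_numeral)
  also have "\<dots> \<le> ennreal (increment_const * (s - r))"
  proof (rule ennreal_leI)
    have "(s - r) * (s - r) \<le> T * (s - r)" using rs by (intro mult_right_mono) auto
    then have "C2\<^sup>2 * ((s - r) * (s - r)) \<le> C2\<^sup>2 * (T * (s - r))" by (intro mult_left_mono) auto
    then show "2 * ((C2 * (s - r))\<^sup>2 + 9 * (C2\<^sup>2 * (s - r))) \<le> increment_const * (s - r)"
      unfolding increment_const_def by (simp add: power2_eq_square algebra_simps)
  qed
  finally show ?thesis .
qed


text \<open>By \<open>solution_minus_euler_le\<close> and \<open>W1_solution_euler_le\<close> this bounds both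
  $E|X_s - Y_j|^2$ and $W_1(\mathscr L(X_s), \mathscr L(Y_j))^2$ for all $s \le T$ in the $j$-th cell. Being
  constant on cells, it is measurable in time for trivial reasons.\<close>

definition sq_error_bound :: "nat \<Rightarrow> ennreal" where
  "sq_error_bound j = 2 * (ennreal (increment_const * h) + mean_sq_dist M (X (real j * h)) (Y j))"

lemma solution_minus_euler_le:
  assumes "real j * h \<le> s" "s \<le> real (Suc j) * h" "s \<le> T"
  shows "mean_sq_dist M (X s) (Y j) \<le> sq_error_bound j"
proof -
  have s: "0 \<le> s" "s \<in> {0..T}" "real j * h \<in> {0..T}" using assms grid_nonneg[of j] by auto
  have "mean_sq_dist M (X s) (Y j) \<le> 2 * (mean_sq_dist M (X s) (X (real j * h)) + mean_sq_dist M (X (real j * h)) (Y j))"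
    by (intro mean_sq_dist_triangle X_measurable Y_measurable s)
  also have "mean_sq_dist M (X s) (X (real j * h)) \<le> ennreal (increment_const * (s - real j * h))"
    using assms grid_nonneg by (intro solution_increment_le)
  also have "\<dots> \<le> ennreal (increment_const * h)"
    using assms increment_const_nonneg by (intro ennreal_leI mult_left_mono) (auto simp: algebra_simps)
  finally show ?thesis unfolding sq_error_bound_def by (simp add: mult_left_mono add_right_mono)
qed

lemma W1_solution_euler_le:
  assumes "real j * h \<le> s" "s \<le> real (Suc j) * h" "s \<le> T"
  shows "(W1 (law M (X s)) (law M (Y j)))\<^sup>2 \<le> sq_error_bound j"
proof -
  have "s \<in> {0..T}" using assms grid_nonneg[of j] by auto
  then have "(W1 (law M (X s)) (law M (Y j)))\<^sup>2 \<le> mean_sq_dist M (X s) (Y j)"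
    unfolding mean_sq_dist_def by (intro W1_law_squared_le prob_space_axioms X_measurable Y_measurable)
  then show ?thesis using solution_minus_euler_le[OF assms] by (rule order_trans)
qed

text \<open>Up to the factor $2 C_1^2$, this dominates the squared differences of both coefficients, with
  the Wasserstein distance already replaced by its bound.\<close>

definition sq_gap :: "'w \<times> real \<Rightarrow> ennreal" where
  "sq_gap p = ennreal ((norm (X_extended p - Y (grid_index h (snd p)) (fst p)))\<^sup>2) + sq_error_bound (grid_index h (snd p))"

lemma Y_grid_measurable: "(\<lambda>p. Y (grid_index h (snd p)) (fst p)) \<in> borel_measurable (M \<Otimes>\<^sub>M lborel)"
proof (rule measurable_compose_countable[where f = "\<lambda>j p. Y j (fst p)"])
  show "(\<lambda>p. Y j (fst p)) \<in> borel_measurable (M \<Otimes>\<^sub>M lborel)" for j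
    by (rule measurable_compose[OF measurable_fst Y_measurable])
  show "(\<lambda>p. grid_index h (snd p)) \<in> measurable (M \<Otimes>\<^sub>M lborel) (count_space UNIV)"
    by measurable
qed

lemma sq_gap_measurable: "sq_gap \<in> borel_measurable (M \<Otimes>\<^sub>M lborel)"
proof -
  note [measurable] = Y_grid_measurable X_extended_measurable
  have [measurable]: "(\<lambda>p::'w \<times> real. sq_error_bound (grid_index h (snd p))) \<in> borel_measurable (M \<Otimes>\<^sub>M lborel)"
    by (rule measurable_compose_countable[where f = "\<lambda>j p. sq_error_bound j"]) measurable
  show ?thesis unfolding sq_gap_def[abs_def] by measurable
qed

lemma coefficient_gap:
  assumes s: "0 \<le> s" "s \<le> T" and \<omega>: "\<omega> \<in> space M"
  shows "ennreal ((norm (drift s \<omega> - euler_drift (grid_index h s) \<omega>))\<^sup>2) \<le> ennreal (2 * C1\<^sup>2) * sq_gap (\<omega>, s)"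
    and "ennreal ((norm (\<sigma> (X s \<omega>) (law M (X s)) - euler_noise (grid_index h s) \<omega>))\<^sup>2)
      \<le> ennreal (2 * C1\<^sup>2) * sq_gap (\<omega>, s)"
proof -
  let ?j = "grid_index h s"
  have sT: "s \<in> {0..T}" using s by auto
  note g = grid_index_bounds[OF h s(1)]
  have W: "(W1 (law M (X s)) (law M (Y ?j)))\<^sup>2 \<le> sq_error_bound ?j"
    using g s by (intro W1_solution_euler_le) auto
  have sq_gap: "sq_gap (\<omega>, s) = ennreal ((norm (X s \<omega> - Y ?j \<omega>))\<^sup>2) + sq_error_bound ?j"
    by (simp add: sq_gap_def X_extended_eq[OF sT])
  have "ennreal (norm (drift s \<omega> - euler_drift ?j \<omega>))
      \<le> ennreal C1 * (ennreal (norm (X s \<omega> - Y ?j \<omega>)) + W1 (law M (X s)) (law M (Y ?j)))"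
    using Lipschitz_coefficient_diff_le[OF b law_X[OF sT] law_Y[of ?j] m_prob[OF s(1) \<omega>]] m_grid[OF s(1) \<omega>]
    by simp
  from ennreal_squared_le_of_Lipschitz[OF this _ _ _ W] C1
  show "ennreal ((norm (drift s \<omega> - euler_drift ?j \<omega>))\<^sup>2) \<le> ennreal (2 * C1\<^sup>2) * sq_gap (\<omega>, s)"
    unfolding sq_gap by simp
  have "ennreal (norm (\<sigma> (X s \<omega>) (law M (X s)) - euler_noise ?j \<omega>))
      \<le> ennreal C1 * (ennreal (norm (X s \<omega> - Y ?j \<omega>)) + W1 (law M (X s)) (law M (Y ?j)))"
    by (rule \<sigma>_Lipschitz[OF law_X[OF sT] law_Y])
  from ennreal_squared_le_of_Lipschitz[OF this _ _ _ W] C1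
  show "ennreal ((norm (\<sigma> (X s \<omega>) (law M (X s)) - euler_noise ?j \<omega>))\<^sup>2) \<le> ennreal (2 * C1\<^sup>2) * sq_gap (\<omega>, s)"
    unfolding sq_gap by simp
qed

text \<open>By Tonelli's theorem, the expectation at time $s$ comes first, and it is at most twice the
  error bound of the cell of $s$.\<close>

lemma sq_gap_integral_le:
  assumes k: "real k * h \<le> T"
  shows "(\<integral>\<^sup>+ \<omega>. (\<integral>\<^sup>+ s\<in>{0..<real k * h}. sq_gap (\<omega>, s) \<partial>lborel) \<partial>M) \<le> (\<Sum>j<k. ennreal h * (2 * sq_error_bound j))"
proof -
  interpret P: pair_sigma_finite M lborel ..
  note [measurable] = sq_gap_measurable
  have "(\<integral>\<^sup>+ \<omega>. (\<integral>\<^sup>+ s\<in>{0..<real k * h}. sq_gap (\<omega>, s) \<partial>lborel) \<partial>M)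
     = (\<integral>\<^sup>+ s. \<integral>\<^sup>+ \<omega>. sq_gap (\<omega>, s) * indicator {0..<real k * h} s \<partial>M \<partial>lborel)"
    by (rule P.Fubini'[symmetric]) measurable
  also have "\<dots> \<le> (\<integral>\<^sup>+ s\<in>{0..<real k * h}. 2 * sq_error_bound (grid_index h s) \<partial>lborel)"
  proof (rule nn_integral_mono)
    fix s
    show "(\<integral>\<^sup>+ \<omega>. sq_gap (\<omega>, s) * indicator {0..<real k * h} s \<partial>M) \<le> 2 * sq_error_bound (grid_index h s) * indicator {0..<real k * h} s"
    proof (cases "s \<in> {0..<real k * h}")
      case True
      then have s: "0 \<le> s" "s \<le> T" "s \<in> {0..T}" using k by auto
      note [measurable] = X_measurable[OF s(3)] Y_measurable
      have "(\<integral>\<^sup>+ \<omega>. sq_gap (\<omega>, s) \<partial>M) = mean_sq_dist M (X s) (Y (grid_index h s)) + sq_error_bound (grid_index h s)"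
        unfolding sq_gap_def fst_conv snd_conv X_extended_eq[OF s(3)] mean_sq_dist_def
        by (simp add: nn_integral_add emeasure_space_1)
      also have "\<dots> \<le> sq_error_bound (grid_index h s) + sq_error_bound (grid_index h s)"
        using grid_index_bounds[OF h s(1)] s by (intro add_right_mono solution_minus_euler_le) auto
      finally show ?thesis using True by (simp add: mult_2)
    qed simp
  qed
  also have "\<dots> = (\<Sum>j<k. ennreal h * (2 * sq_error_bound j))"
    by (rule nn_integral_step_function[OF h])
  finally show ?thesis .
qed

lemma euler_closed_form:
  "Y k \<omega> = x + (\<Sum>j<k. h *\<^sub>R euler_drift j \<omega>)
     + elementary_integral {..<k} (\<lambda>j. real j * h) (\<lambda>j. real (Suc j) * h) euler_noise \<omega>"
  by (induction k) (simp_all add: elementary_integral_def Let_def)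

lemma euler_noise_elementary:
  "elementary {..<k} (\<lambda>j. real j * h) (\<lambda>j. real (Suc j) * h) euler_noise"
  unfolding elementary_def
proof (intro conjI ballI)
  fix j
  show "0 \<le> real j * h" by (rule grid_nonneg)
  show "real j * h \<le> real (Suc j) * h" by (rule grid_mono) simp
  show "euler_noise j \<in> borel_measurable (G (real j * h))"
    by (rule measurable_compose[OF Y_adapted \<sigma>_measurable[OF law_Y]])
  show "bounded (euler_noise j ` space M)"
    using \<sigma>_le[OF law_Y] by (auto simp: bounded_iff)
qed simp

text \<open>Cauchy--Schwarz in time, after writing the Euler drift as the integral of a step function.\<close>

lemma drift_error_le:
  assumes k: "real k * h \<le> T" and \<omega>: "\<omega> \<in> space M"
    and int: "set_integrable lborel {0..real k * h} (\<lambda>s. drift s \<omega>)"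
  shows "ennreal ((norm ((LINT s:{0..real k * h}|lborel. drift s \<omega>) - (\<Sum>j<k. h *\<^sub>R euler_drift j \<omega>)))\<^sup>2)
    \<le> ennreal T * (\<integral>\<^sup>+ s\<in>{0..<real k * h}. ennreal (2 * C1\<^sup>2) * sq_gap (\<omega>, s) \<partial>lborel)"
proof -
  let ?A = "{0..<real k * h}"
  let ?f = "\<lambda>s. indicator ?A s *\<^sub>R (drift s \<omega> - euler_drift (grid_index h s) \<omega>)"
  have diff: "({0..real k * h} - ?A) \<union> (?A - {0..real k * h}) \<subseteq> {real k * h}" by auto
  have 1: "set_integrable lborel ?A (\<lambda>s. drift s \<omega>)"
    using int set_integrable_discrete_difference[OF _ diff, where M = lborel and f = "\<lambda>s. drift s \<omega>"] by simp
  have 2: "(LINT s:{0..real k * h}|lborel. drift s \<omega>) = (LINT s:?A|lborel. drift s \<omega>)"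
    by (rule set_integral_discrete_difference[OF _ diff]) auto
  note 3 = set_integrable_step_function[OF h, of k "\<lambda>j. euler_drift j \<omega>"]
  have eq: "(LINT s:{0..real k * h}|lborel. drift s \<omega>) - (\<Sum>j<k. h *\<^sub>R euler_drift j \<omega>) = (LINT s|lborel. ?f s)"
    unfolding 2 set_integral_step_function[OF h, of k "\<lambda>j. euler_drift j \<omega>", symmetric]
    using set_integral_diff(2)[OF 1 3] by (simp add: set_lebesgue_integral_def)
  have f: "integrable lborel ?f"
    using set_integral_diff(1)[OF 1 3] by (simp add: set_integrable_def)
  have fm: "(\<lambda>s. ennreal (norm (?f s))) \<in> borel_measurable lborel"
    using borel_measurable_integrable[OF f] by measurable
  have "ennreal (norm (LINT s|lborel. ?f s)) \<le> (\<integral>\<^sup>+ s. ennreal (norm (?f s)) \<partial>lborel)"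
    by (rule integral_norm_bound_ennreal[OF f])
  also have "\<dots> = (\<integral>\<^sup>+ s\<in>?A. ennreal (norm (?f s)) \<partial>lborel)"
    by (intro nn_integral_cong) (simp split: split_indicator)
  finally have "(ennreal (norm (LINT s|lborel. ?f s)))\<^sup>2 \<le> (\<integral>\<^sup>+ s\<in>?A. ennreal (norm (?f s)) \<partial>lborel)\<^sup>2"
    by (rule power_mono) simp
  also have "\<dots> \<le> emeasure lborel ?A * (\<integral>\<^sup>+ s\<in>?A. (ennreal (norm (?f s)))\<^sup>2 \<partial>lborel)"
    by (rule nn_integral_squared_le[OF _ fm]) simp
  also have "\<dots> \<le> ennreal T * (\<integral>\<^sup>+ s\<in>?A. ennreal (2 * C1\<^sup>2) * sq_gap (\<omega>, s) \<partial>lborel)"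
  proof (rule mult_mono)
    show "emeasure lborel ?A \<le> ennreal T" using k grid_nonneg[of k] by (simp add: ennreal_leI)
    show "(\<integral>\<^sup>+ s\<in>?A. (ennreal (norm (?f s)))\<^sup>2 \<partial>lborel) \<le> (\<integral>\<^sup>+ s\<in>?A. ennreal (2 * C1\<^sup>2) * sq_gap (\<omega>, s) \<partial>lborel)"
    proof (rule nn_integral_mono)
      fix s
      show "(ennreal (norm (?f s)))\<^sup>2 * indicator ?A s \<le> ennreal (2 * C1\<^sup>2) * sq_gap (\<omega>, s) * indicator ?A s"
        using coefficient_gap(1)[OF _ _ \<omega>, of s] k by (cases "s \<in> ?A") (auto simp: ennreal_power)
    qed
  qed auto
  finally show ?thesis unfolding eq by (simp add: ennreal_power)
qed

text \<open>The noise of the scheme is the elementary integral of $\sigma$ frozen at the grid points. Its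
  intervals are left-open whereas the cells of \<open>grid_index\<close> are right-open; the two step functions agree
  off the grid, hence almost everywhere in time.\<close>

lemma noise_error_le:
  assumes k: "real k * h \<le> T"
    and I: "has_Ito_integral M G W (\<lambda>s \<omega>. \<sigma> (X s \<omega>) (law M (X s))) (real k * h) I"
  shows "mean_sq_dist M I (elementary_integral {..<k} (\<lambda>j. real j * h) (\<lambda>j. real (Suc j) * h) euler_noise)
    \<le> 9 * (\<integral>\<^sup>+ \<omega>. (\<integral>\<^sup>+ s\<in>{0..<real k * h}. ennreal (2 * C1\<^sup>2) * sq_gap (\<omega>, s) \<partial>lborel) \<partial>M)"
proof -
  let ?K = "\<lambda>p. indicator {0..real k * h} (snd p) *\<^sub>R \<sigma> (X (snd p) (fst p)) (law M (X (snd p)))"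
  let ?E = "elementary_process {..<k} (\<lambda>j. real j * h) (\<lambda>j. real (Suc j) * h) euler_noise"
  have lim: "ito_limit ?K I" by (rule has_Ito_integral_imp_ito_limit[OF grid_nonneg I])
  have K: "?K \<in> borel_measurable (M \<Otimes>\<^sub>M lborel)" using lim by (simp add: ito_limit_def)
  note E = elementary_process_measurable[OF euler_noise_elementary[of k]]
  have "mean_sq_dist M I (elementary_integral {..<k} (\<lambda>j. real j * h) (\<lambda>j. real (Suc j) * h) euler_noise)
      \<le> 9 * mean_sq_dist (M \<Otimes>\<^sub>M lborel) ?K ?E"
    by (rule ito_limit_isometry[OF lim ito_limit_elementary[OF euler_noise_elementary]])
  also have "mean_sq_dist (M \<Otimes>\<^sub>M lborel) ?K ?E = (\<integral>\<^sup>+ \<omega>. \<integral>\<^sup>+ s. ennreal ((norm (?K (\<omega>, s) - ?E (\<omega>, s)))\<^sup>2) \<partial>lborel \<partial>M)"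
    unfolding mean_sq_dist_def
    by (intro lborel.nn_integral_fst[symmetric]
          measurable_compose[OF borel_measurable_diff[OF K E], of "\<lambda>x. ennreal ((norm x)\<^sup>2)"]) measurable
  also have "\<dots> \<le> (\<integral>\<^sup>+ \<omega>. (\<integral>\<^sup>+ s\<in>{0..<real k * h}. ennreal (2 * C1\<^sup>2) * sq_gap (\<omega>, s) \<partial>lborel) \<partial>M)"
  proof (rule nn_integral_mono, rule nn_integral_mono_AE)
    fix \<omega> assume \<omega>: "\<omega> \<in> space M"
    let ?le = "\<lambda>s. ennreal ((norm (?K (\<omega>, s) - ?E (\<omega>, s)))\<^sup>2)
        \<le> ennreal (2 * C1\<^sup>2) * sq_gap (\<omega>, s) * indicator {0..<real k * h} s"
    have off_grid: "?le s" if s: "s \<notin> range (\<lambda>j. real j * h)" for s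
    proof -
      have ne: "s \<noteq> real j * h" for j using s by blast
      have "?E (\<omega>, s) = (\<Sum>j<k. indicator {real j * h..<real (Suc j) * h} s *\<^sub>R euler_noise j \<omega>)"
        unfolding elementary_process_def fst_conv snd_conv
      proof (intro sum.cong refl arg_cong2[where f = scaleR])
        fix j
        show "indicator {real j * h<..real (Suc j) * h} s = (indicator {real j * h..<real (Suc j) * h} s :: real)"
          using ne[of j] ne[of "Suc j"] by (auto simp: indicator_def)
      qed
      also have "\<dots> = indicator {0..<real k * h} s *\<^sub>R euler_noise (grid_index h s) \<omega>"
        by (rule step_function_eq_sum[OF h, symmetric])
      finally have E_eq: "?E (\<omega>, s) = indicator {0..<real k * h} s *\<^sub>R euler_noise (grid_index h s) \<omega>" .
      have K_eq: "?K (\<omega>, s) = indicator {0..<real k * h} s *\<^sub>R \<sigma> (X s \<omega>) (law M (X s))"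
        using ne[of k] by (auto simp: indicator_def)
      show ?thesis using coefficient_gap(2)[OF _ _ \<omega>, of s] k unfolding E_eq K_eq
        by (cases "s \<in> {0..<real k * h}") auto
    qed
    have "range (\<lambda>j. real j * h) \<in> null_sets lborel"
      by (rule countable_imp_null_set_lborel) simp
    from AE_not_in[OF this] show "AE s in lborel. ?le s"
      by eventually_elim (rule off_grid)
  qed
  finally show ?thesis by (simp add: mult_left_mono)
qed

text \<open>The factor 16 collects $2$ from splitting drift and noise, $2 C_1^2$ from the Lipschitz
  estimate, $2$ from \<open>sq_gap_integral_le\<close> and $2$ from \<open>sq_error_bound\<close>; $T$ comes from the drift
  and $9$ from the noise.\<close>

definition growth_const :: real where "growth_const = 16 * C1\<^sup>2 * (T + 9)"

lemma growth_const_nonneg: "0 \<le> growth_const" using T by (simp add: growth_const_def)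

lemma euler_error_recursion:
  assumes k: "real k * h \<le> T"
  shows "mean_sq_dist M (X (real k * h)) (Y k)
    \<le> ennreal (growth_const * h) * (\<Sum>j<k. ennreal (increment_const * h) + mean_sq_dist M (X (real j * h)) (Y j))"
proof -
  let ?t = "real k * h"
  let ?S = "elementary_integral {..<k} (\<lambda>j. real j * h) (\<lambda>j. real (Suc j) * h) euler_noise"
  let ?U = "\<integral>\<^sup>+ \<omega>. (\<integral>\<^sup>+ s\<in>{0..<?t}. ennreal (2 * C1\<^sup>2) * sq_gap (\<omega>, s) \<partial>lborel) \<partial>M"
  have t: "?t \<in> {0..T}" using k grid_nonneg by auto
  obtain I where I: "has_Ito_integral M G W (\<lambda>s \<omega>. \<sigma> (X s \<omega>) (law M (X s))) ?t I"
    "AE \<omega> in M. set_integrable lborel {0..?t} (\<lambda>s. drift s \<omega>) \<and>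
         X ?t \<omega> = x + (LINT s:{0..?t}|lborel. drift s \<omega>) + I \<omega>"
    using X_solution[OF t] by blast
  have Im: "I \<in> borel_measurable M" using I by (auto simp: has_Ito_integral_def)
  note Sm = elementary_integral_measurable[OF euler_noise_elementary[of k]]
  note [measurable] = sq_gap_measurable
  have um: "(\<lambda>\<omega>. \<integral>\<^sup>+ s\<in>{0..<?t}. ennreal (2 * C1\<^sup>2) * sq_gap (\<omega>, s) \<partial>lborel) \<in> borel_measurable M"
    by measurable
  have dm: "(\<lambda>\<omega>. ennreal ((norm (I \<omega> - ?S \<omega>))\<^sup>2)) \<in> borel_measurable M"
    by (rule measurable_compose[OF borel_measurable_diff[OF Im Sm], of "\<lambda>x. ennreal ((norm x)\<^sup>2)"]) measurable
  have "mean_sq_dist M (X ?t) (Y k) \<le> (\<integral>\<^sup>+ \<omega>. 2 * (ennreal T * (\<integral>\<^sup>+ s\<in>{0..<?t}. ennreal (2 * C1\<^sup>2) * sq_gap (\<omega>, s) \<partial>lborel)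
     + ennreal ((norm (I \<omega> - ?S \<omega>))\<^sup>2)) \<partial>M)"
    unfolding mean_sq_dist_def
  proof (rule nn_integral_mono_AE)
    show "AE \<omega> in M. ennreal ((norm (X ?t \<omega> - Y k \<omega>))\<^sup>2)
      \<le> 2 * (ennreal T * (\<integral>\<^sup>+ s\<in>{0..<?t}. ennreal (2 * C1\<^sup>2) * sq_gap (\<omega>, s) \<partial>lborel)
        + ennreal ((norm (I \<omega> - ?S \<omega>))\<^sup>2))"
      using I(2) AE_space
    proof eventually_elim
      case (elim \<omega>)
      let ?D = "(LINT s:{0..?t}|lborel. drift s \<omega>) - (\<Sum>j<k. h *\<^sub>R euler_drift j \<omega>)"
      have "X ?t \<omega> - Y k \<omega> = ?D + (I \<omega> - ?S \<omega>)"
        using elim euler_closed_form[of k \<omega>] by simp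
      then have "ennreal ((norm (X ?t \<omega> - Y k \<omega>))\<^sup>2) \<le> 2 * (ennreal ((norm ?D)\<^sup>2) + ennreal ((norm (I \<omega> - ?S \<omega>))\<^sup>2))"
        using norm_add_squared_le[of ?D "I \<omega> - ?S \<omega>"] by (simp only:)
      also have "\<dots> \<le> 2 * (ennreal T * (\<integral>\<^sup>+ s\<in>{0..<?t}. ennreal (2 * C1\<^sup>2) * sq_gap (\<omega>, s) \<partial>lborel)
        + ennreal ((norm (I \<omega> - ?S \<omega>))\<^sup>2))"
        using elim by (intro mult_left_mono add_right_mono drift_error_le[OF k]) auto
      finally show ?case .
    qed
  qed
  also have "\<dots> = 2 * (ennreal T * ?U + mean_sq_dist M I ?S)"
    unfolding mean_sq_dist_def using um dm
    by (simp add: nn_integral_add nn_integral_cmult del: distrib_left_numeral)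
  also have "\<dots> \<le> 2 * (ennreal T * ?U + 9 * ?U)"
    by (intro mult_left_mono add_left_mono noise_error_le[OF k I(1)]) simp
  also have "\<dots> = ennreal (2 * (T + 9)) * ?U"
    using T by (simp add: ennreal_mult distrib_left distrib_right mult.assoc del: distrib_left_numeral)
  also have "?U = ennreal (2 * C1\<^sup>2) * (\<integral>\<^sup>+ \<omega>. (\<integral>\<^sup>+ s\<in>{0..<?t}. sq_gap (\<omega>, s) \<partial>lborel) \<partial>M)"
  proof -
    have "?U = (\<integral>\<^sup>+ \<omega>. ennreal (2 * C1\<^sup>2) * (\<integral>\<^sup>+ s\<in>{0..<?t}. sq_gap (\<omega>, s) \<partial>lborel) \<partial>M)"
    proof (rule nn_integral_cong)
      fix \<omega> assume "\<omega> \<in> space M"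
      then have [measurable]: "(\<lambda>s. sq_gap (\<omega>, s)) \<in> borel_measurable lborel"
        using measurable_compose[OF measurable_Pair1' sq_gap_measurable] by blast
      show "(\<integral>\<^sup>+ s\<in>{0..<?t}. ennreal (2 * C1\<^sup>2) * sq_gap (\<omega>, s) \<partial>lborel)
        = ennreal (2 * C1\<^sup>2) * (\<integral>\<^sup>+ s\<in>{0..<?t}. sq_gap (\<omega>, s) \<partial>lborel)"
        by (subst nn_integral_cmult[symmetric]) (simp_all add: mult.assoc)
    qed
    then show ?thesis by (simp add: nn_integral_cmult)
  qed
  also have "ennreal (2 * (T + 9)) * \<dots> \<le> ennreal (2 * (T + 9)) * (ennreal (2 * C1\<^sup>2) * (\<Sum>j<k. ennreal h * (2 * sq_error_bound j)))"
    by (intro mult_left_mono sq_gap_integral_le[OF k]) auto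
  also have "\<dots> = ennreal (growth_const * h) * (\<Sum>j<k. ennreal (increment_const * h) + mean_sq_dist M (X (real j * h)) (Y j))"
  proof -
    have "(\<Sum>j<k. ennreal h * (2 * sq_error_bound j)) = ennreal (4 * h) * (\<Sum>j<k. ennreal (increment_const * h) + mean_sq_dist M (X (real j * h)) (Y j))"
      unfolding sq_error_bound_def sum_distrib_left using h
      by (intro sum.cong refl) (simp add: ennreal_mult mult_ac flip: mult.assoc del: distrib_left_numeral)
    moreover have "ennreal (2 * (T + 9)) * (ennreal (2 * C1\<^sup>2) * ennreal (4 * h)) = ennreal (growth_const * h)"
      using T h unfolding growth_const_def
      by (subst ennreal_mult[symmetric], simp, simp, subst ennreal_mult[symmetric], simp, simp)
         (simp add: algebra_simps)
    ultimately show ?thesis by (simp only: mult.assoc[symmetric])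
  qed
  finally show ?thesis .
qed

definition grid_error_const :: real where "grid_error_const = growth_const * increment_const * T * exp (growth_const * T)"

lemma grid_error_const_nonneg: "0 \<le> grid_error_const" using growth_const_nonneg increment_const_nonneg T by (simp add: grid_error_const_def)

text \<open>Discrete Gronwall inequality. The geometric bound is proved by induction in \<open>ennreal\<close>, so it
  yields the finiteness of the errors along the way.\<close>

theorem euler_strong_error:
  assumes k: "real k * h \<le> T"
  shows "mean_sq_dist M (X (real k * h)) (Y k) \<le> ennreal (grid_error_const * h)"
proof -
  define A where "A = growth_const * increment_const * T * h"
  have A: "0 \<le> A" using growth_const_nonneg increment_const_nonneg T h by (simp add: A_def)
  have Bh: "0 \<le> growth_const * h" using growth_const_nonneg h by simp
  have geometric: "mean_sq_dist M (X (real j * h)) (Y j) \<le> ennreal (A * (1 + growth_const * h) ^ j)" if "j \<le> k" for j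
    using that
  proof (induction j rule: less_induct)
    case (less j)
    have jT: "real j * h \<le> T" using less.prems grid_mono[of j k] k by simp
    have "mean_sq_dist M (X (real j * h)) (Y j)
        \<le> ennreal (growth_const * h) * (\<Sum>i<j. ennreal (increment_const * h) + mean_sq_dist M (X (real i * h)) (Y i))"
      by (rule euler_error_recursion[OF jT])
    also have "\<dots> \<le> ennreal (growth_const * h) * (\<Sum>i<j. ennreal (increment_const * h + A * (1 + growth_const * h) ^ i))"
    proof (intro mult_left_mono sum_mono)
      fix i assume "i \<in> {..<j}"
      then have "mean_sq_dist M (X (real i * h)) (Y i) \<le> ennreal (A * (1 + growth_const * h) ^ i)"
        using less by auto
      moreover have "0 \<le> increment_const * h" "0 \<le> A * (1 + growth_const * h) ^ i" using A Bh increment_const_nonneg h by simp_all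
      ultimately show "ennreal (increment_const * h) + mean_sq_dist M (X (real i * h)) (Y i) \<le> ennreal (increment_const * h + A * (1 + growth_const * h) ^ i)"
        by (simp add: add_left_mono)
    qed simp
    also have "\<dots> = ennreal (growth_const * h * (\<Sum>i<j. increment_const * h + A * (1 + growth_const * h) ^ i))"
      using A Bh increment_const_nonneg h by (subst sum_ennreal) (auto intro!: ennreal_mult[symmetric] sum_nonneg)
    also have "\<dots> \<le> ennreal (A * (1 + growth_const * h) ^ j)"
    proof (rule ennreal_leI)
      have "growth_const * h * (\<Sum>i<j. increment_const * h + A * (1 + growth_const * h) ^ i)
        = growth_const * increment_const * h * (real j * h) + A * (growth_const * h * (\<Sum>i<j. (1 + growth_const * h) ^ i))"
        by (simp add: sum.distrib sum_distrib_left algebra_simps)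
      also have "growth_const * h * (\<Sum>i<j. (1 + growth_const * h) ^ i) = (1 + growth_const * h) ^ j - 1"
        using power_diff_1_eq[of "1 + growth_const * h" j] by simp
      also have "growth_const * increment_const * h * (real j * h) \<le> growth_const * increment_const * h * T"
        using jT growth_const_nonneg increment_const_nonneg h by (intro mult_left_mono) auto
      finally show "growth_const * h * (\<Sum>i<j. increment_const * h + A * (1 + growth_const * h) ^ i) \<le> A * (1 + growth_const * h) ^ j"
        by (simp add: A_def algebra_simps)
    qed
    finally show ?case .
  qed
  have "mean_sq_dist M (X (real k * h)) (Y k) \<le> ennreal (A * (1 + growth_const * h) ^ k)" by (rule geometric) simp
  also have "\<dots> \<le> ennreal (grid_error_const * h)"
  proof (rule ennreal_leI)
    have "(1 + growth_const * h) ^ k \<le> exp (growth_const * h) ^ k" using Bh by (intro power_mono) auto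
    also have "\<dots> = exp (growth_const * (real k * h))" by (simp add: exp_of_nat_mult[symmetric] algebra_simps)
    also have "\<dots> \<le> exp (growth_const * T)" using k growth_const_nonneg by (simp add: mult_left_mono)
    finally have "A * (1 + growth_const * h) ^ k \<le> A * exp (growth_const * T)" using A by (rule mult_left_mono)
    then show "A * (1 + growth_const * h) ^ k \<le> grid_error_const * h" by (simp add: A_def grid_error_const_def algebra_simps)
  qed
  finally show ?thesis .
qed

definition error_const :: real where "error_const = 2 * (increment_const + grid_error_const)"

lemma error_const_nonneg: "0 \<le> error_const" using increment_const_nonneg grid_error_const_nonneg by (simp add: error_const_def)

theorem interpolated_strong_error:
  assumes "real k * h \<le> s" "s \<le> real (Suc k) * h" "s \<le> T"
  shows "mean_sq_dist M (X s) (Y k) \<le> ennreal (error_const * h)"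
proof -
  have "mean_sq_dist M (X s) (Y k) \<le> sq_error_bound k" by (rule solution_minus_euler_le[OF assms])
  also have "\<dots> \<le> 2 * (ennreal (increment_const * h) + ennreal (grid_error_const * h))"
    unfolding sq_error_bound_def using assms by (intro mult_left_mono add_left_mono euler_strong_error) auto
  also have "\<dots> = ennreal (error_const * h)"
    using increment_const_nonneg grid_error_const_nonneg h
    by (simp add: error_const_def ennreal_mult distrib_right mult.assoc del: distrib_left_numeral)
  finally show ?thesis .
qed

end

section \<open>Error of the costs\<close>

lemma le_ennreal_sqrt:
  fixes w :: ennreal
  assumes "w\<^sup>2 \<le> ennreal q" "0 \<le> q"
  shows "w \<le> ennreal (sqrt q)"
proof (cases w)
  case (real r)
  then have "r\<^sup>2 \<le> q" using assms by (simp add: ennreal_power)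
  then show ?thesis using real by (simp add: real_le_rsqrt ennreal_leI)
next
  case top
  then show ?thesis using assms by (simp add: power2_eq_square ennreal_top_mult top_unique)
qed

lemma num_steps_bounds:
  assumes "0 < T" "0 < h"
  shows "real (num_steps T h) * h \<le> T" "T < real (Suc (num_steps T h)) * h"
proof -
  have eq: "{n::nat. real n * h \<le> T} = {..grid_index h T}"
  proof (intro set_eqI iffI)
    fix n assume "n \<in> {n::nat. real n * h \<le> T}"
    then have "real n * h < real (Suc (grid_index h T)) * h"
      using grid_index_bounds(2)[of h T] assms by (intro le_less_trans[of "real n * h" T]) auto
    then have "real n < real (Suc (grid_index h T))"
      using assms(2) by (simp only: mult_less_cancel_right_pos)
    then show "n \<in> {..grid_index h T}" by simp
  next
    fix n assume "n \<in> {..grid_index h T}"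
    then have "real n * h \<le> real (grid_index h T) * h" using assms by simp
    also have "\<dots> \<le> T" using grid_index_bounds(1)[of h T] assms by simp
    finally show "n \<in> {n::nat. real n * h \<le> T}" by simp
  qed
  have "num_steps T h = grid_index h T"
    unfolding num_steps_def eq by (simp add: cSup_eq_Max)
  then show "real (num_steps T h) * h \<le> T" "T < real (Suc (num_steps T h)) * h"
    using grid_index_bounds[of h T] assms by simp_all
qed

locale euler_costs = euler_approximation M G W b \<sigma> m X x T h C1 C2
  for M :: "'w measure" and G :: "real \<Rightarrow> 'w measure" and W :: "real \<Rightarrow> 'w \<Rightarrow> real ^ 'n"
    and b :: "real ^ 'n \<Rightarrow> (real ^ 'n) measure \<Rightarrow> 'u::topological_space \<Rightarrow> real ^ 'n"
    and \<sigma> m X x T h C1 C2 +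
  fixes c :: "real ^ 'n \<Rightarrow> (real ^ 'n) measure \<Rightarrow> 'u \<Rightarrow> real"
    and c_T :: "real ^ 'n \<Rightarrow> (real ^ 'n) measure \<Rightarrow> real" and C3 C4 :: real
  assumes C3: "0 < C3" and C4: "0 < C4"
    and c: "Lipschitz_coefficient c C3 C4"
    and c_T_Lipschitz: "\<And>y z \<mu> \<nu>. \<mu> \<in> prob_measures \<Longrightarrow> \<nu> \<in> prob_measures \<Longrightarrow>
      ennreal \<bar>c_T y \<mu> - c_T z \<nu>\<bar> \<le> ennreal C3 * (ennreal (norm (y - z)) + W1 \<mu> \<nu>)"
    and c_T_le: "\<And>y \<mu>. \<mu> \<in> prob_measures \<Longrightarrow> \<bar>c_T y \<mu>\<bar> \<le> C4"
begin

abbreviation cost_rate :: "real \<Rightarrow> 'w \<Rightarrow> real" where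
  "cost_rate s \<omega> \<equiv> relaxed c (X s \<omega>) (law M (X s)) (m s \<omega>)"

abbreviation euler_cost_rate :: "nat \<Rightarrow> 'w \<Rightarrow> real" where
  "euler_cost_rate j \<omega> \<equiv> relaxed c (Y j \<omega>) (law M (Y j)) (m (real j * h) \<omega>)"

abbreviation clamp :: "real \<Rightarrow> real" where "clamp t \<equiv> max 0 (min T t)"

lemma W1_solution_le:
  "W1 (law M (X (clamp s))) (law M (X (clamp r))) \<le> ennreal (sqrt (increment_const * \<bar>s - r\<bar>))"
proof (rule le_ennreal_sqrt)
  have *: "mean_sq_dist M (X (clamp s)) (X (clamp r)) \<le> ennreal (increment_const * \<bar>s - r\<bar>)" if "r \<le> s" for s r
  proof -
    have "mean_sq_dist M (X (clamp s)) (X (clamp r)) \<le> ennreal (increment_const * (clamp s - clamp r))"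
      using that T by (intro solution_increment_le) auto
    also have "\<dots> \<le> ennreal (increment_const * \<bar>s - r\<bar>)"
      using that T increment_const_nonneg by (intro ennreal_leI mult_left_mono) auto
    finally show ?thesis .
  qed
  have "(W1 (law M (X (clamp s))) (law M (X (clamp r))))\<^sup>2 \<le> mean_sq_dist M (X (clamp s)) (X (clamp r))"
    unfolding mean_sq_dist_def by (intro W1_law_squared_le prob_space_axioms X_measurable clamp_in)
  also have "\<dots> \<le> ennreal (increment_const * \<bar>s - r\<bar>)"
    using *[of r s] *[of s r] by (cases "r \<le> s") (auto simp: mean_sq_dist_commute abs_minus_commute)
  finally show "(W1 (law M (X (clamp s))) (law M (X (clamp r))))\<^sup>2 \<le> ennreal (increment_const * \<bar>s - r\<bar>)" .
qed (use increment_const_nonneg in simp)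

text \<open>For a fixed control the running cost is continuous along every path: the path is continuous,
  and the law moves continuously in $W_1$ because \<open>X\<close> moves continuously in mean square.\<close>

lemma cost_along_path_continuous:
  assumes \<omega>: "\<omega> \<in> space M" and v: "v \<in> prob_measures"
  shows "continuous_on UNIV (\<lambda>t. relaxed c (X (clamp t) \<omega>) (law M (X (clamp t))) v)"
proof (rule continuous_at_imp_continuous_on, rule ballI)
  fix t
  define f where "f = (\<lambda>t. relaxed c (X (clamp t) \<omega>) (law M (X (clamp t))) v)"
  define d where "d = (\<lambda>r. norm (X (clamp r) \<omega> - X (clamp t) \<omega>))"
  define q where "q = (\<lambda>r. sqrt (increment_const * \<bar>r - t\<bar>))"
  have d0: "0 \<le> d r" for r unfolding d_def by simp
  have q0: "0 \<le> q r" for r unfolding q_def using increment_const_nonneg by simp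
  have le: "norm (f r - f t) \<le> C3 * (d r + q r)" for r
  proof -
    have "ennreal (norm (f r - f t)) \<le> ennreal C3 * (ennreal (d r) + W1 (law M (X (clamp r))) (law M (X (clamp t))))"
      unfolding f_def d_def by (rule Lipschitz_coefficient_diff_le[OF c law_X[OF clamp_in] law_X[OF clamp_in] v])
    also have "\<dots> \<le> ennreal C3 * (ennreal (d r) + ennreal (q r))"
      unfolding q_def by (intro mult_left_mono add_left_mono W1_solution_le) simp
    also have "\<dots> = ennreal (C3 * (d r + q r))" using C3 d0[of r] q0[of r] by (simp add: ennreal_mult)
    finally show ?thesis using C3 d0[of r] q0[of r] by (subst (asm) ennreal_le_iff) auto
  qed
  have "isCont (\<lambda>t. X (clamp t) \<omega>) t"
    using clamped_path_continuous[OF \<omega>] unfolding continuous_on_eq_continuous_at[OF open_UNIV] by (rule bspec) (rule UNIV_I)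
  then have "(\<lambda>r. X (clamp r) \<omega>) \<midarrow>t\<rightarrow> X (clamp t) \<omega>" by (rule isContD)
  then have d: "d \<midarrow>t\<rightarrow> 0" unfolding d_def by (rule tendsto_norm_zero[OF LIM_zero])
  have "isCont q t" unfolding q_def by (intro continuous_intros)
  then have "q \<midarrow>t\<rightarrow> q t" by (rule isContD)
  then have "q \<midarrow>t\<rightarrow> 0" unfolding q_def by simp
  from tendsto_mult_right_zero[OF tendsto_add_zero[OF d this], of C3]
  have "(\<lambda>r. f r - f t) \<midarrow>t\<rightarrow> 0"
    by (rule Lim_null_comparison[OF always_eventually[OF allI[OF le]]])
  then show "isCont (\<lambda>t. relaxed c (X (clamp t) \<omega>) (law M (X (clamp t))) v) t"
    unfolding isCont_def f_def[symmetric] by (rule LIM_zero_cancel)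
qed

text \<open>The running cost on all times, with the control evaluated at the grid points. Written this way,
  time enters through the cell index, which is countable, and through the continuous path of state and law.\<close>

definition cost_extended :: "'w \<times> real \<Rightarrow> real" where
  "cost_extended p = relaxed c (X_extended p) (law M (X (clamp (snd p)))) (m (real (grid_index h (snd p)) * h) (fst p))"

lemma cost_extended_eq:
  assumes "s \<in> {0..T}" "\<omega> \<in> space M" shows "cost_extended (\<omega>, s) = cost_rate s \<omega>"
  using assms m_grid[of s \<omega>] by (simp add: cost_extended_def X_extended_eq)

lemma m_grid_measurable: "m (real j * h) \<in> measurable M (prob_algebra borel)"
  using G_measurable_M[OF m_adapted[OF grid_nonneg order_refl] grid_nonneg] .

lemma cost_extended_measurable: "cost_extended \<in> borel_measurable (M \<Otimes>\<^sub>M lborel)"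
proof -
  have "(\<lambda>p. relaxed c (X (clamp (snd p)) (fst p)) (law M (X (clamp (snd p)))) (m (real (grid_index h (snd p)) * h) (fst p)))
    \<in> borel_measurable (M \<Otimes>\<^sub>M lborel)"
  proof (rule borel_measurable_Caratheodory[where Y = snd and f = "\<lambda>t p. relaxed c (X (clamp t) (fst p))
      (law M (X (clamp t))) (m (real (grid_index h (snd p)) * h) (fst p))"])
    fix p :: "'w \<times> real" assume "p \<in> space (M \<Otimes>\<^sub>M lborel)"
    then have "fst p \<in> space M" by (auto simp: space_pair_measure)
    then show "continuous_on UNIV (\<lambda>t. relaxed c (X (clamp t) (fst p)) (law M (X (clamp t)))
        (m (real (grid_index h (snd p)) * h) (fst p)))"
      by (intro cost_along_path_continuous m_prob grid_nonneg)
  next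
    fix t
    show "(\<lambda>p. relaxed c (X (clamp t) (fst p)) (law M (X (clamp t))) (m (real (grid_index h (snd p)) * h) (fst p)))
      \<in> borel_measurable (M \<Otimes>\<^sub>M lborel)"
    proof (rule measurable_compose_countable[where g = "\<lambda>p. grid_index h (snd p)"
        and f = "\<lambda>j p. relaxed c (X (clamp t) (fst p)) (law M (X (clamp t))) (m (real j * h) (fst p))"])
      fix j
      show "(\<lambda>p. relaxed c (X (clamp t) (fst p)) (law M (X (clamp t))) (m (real j * h) (fst p)))
        \<in> borel_measurable (M \<Otimes>\<^sub>M lborel)"
        using c C3
        by (intro measurable_compose[OF measurable_fst relaxed_along_measurable[of c C3 C4]]
            law_X X_measurable clamp_in m_grid_measurable) auto
    qed measurable
  qed simp
  then show ?thesis by (simp add: cost_extended_def[abs_def] X_extended_def)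
qed

lemma norm_cost_rate_le: "s \<in> {0..T} \<Longrightarrow> \<omega> \<in> space M \<Longrightarrow> \<bar>cost_rate s \<omega>\<bar> \<le> C4"
  using Lipschitz_coefficient_norm_le[OF c law_X[of s] m_prob[of s \<omega>], of "X s \<omega>"] by simp

lemma norm_euler_cost_rate_le: "\<omega> \<in> space M \<Longrightarrow> \<bar>euler_cost_rate j \<omega>\<bar> \<le> C4"
  using Lipschitz_coefficient_norm_le[OF c law_Y[of j] m_prob[OF grid_nonneg[of j], of \<omega>], of "Y j \<omega>"] by simp

lemma euler_cost_rate_measurable: "euler_cost_rate j \<in> borel_measurable M"
  using c C3 by (intro relaxed_along_measurable[of c C3 C4] law_Y Y_measurable m_grid_measurable) auto

lemma c_T_measurable: "\<mu> \<in> prob_measures \<Longrightarrow> (\<lambda>y. c_T y \<mu>) \<in> borel_measurable borel"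
  using c_T_Lipschitz[of \<mu> \<mu>] W1_self[of \<mu>] C3
  by (intro borel_measurable_continuous_onI continuous_on_ennreal_Lipschitz[of _ C3]) auto

lemma running_cost_integrable:
  assumes \<omega>: "\<omega> \<in> space M" shows "set_integrable lborel {0..T} (\<lambda>s. cost_rate s \<omega>)"
proof -
  have "integrable lborel (\<lambda>s. indicator {0..T} s *\<^sub>R cost_extended (\<omega>, s))"
  proof (rule integrableI_bounded_set_indicator[where B = C4])
    show "(\<lambda>s. cost_extended (\<omega>, s)) \<in> borel_measurable lborel"
      using measurable_compose[OF measurable_Pair1'[OF \<omega>] cost_extended_measurable] .
    show "AE s in lborel. s \<in> {0..T} \<longrightarrow> norm (cost_extended (\<omega>, s)) \<le> C4"
      using norm_cost_rate_le[OF _ \<omega>] cost_extended_eq[OF _ \<omega>] by auto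
  qed (use T in auto)
  then show ?thesis unfolding set_integrable_def
    by (rule Bochner_Integration.integrable_cong[THEN iffD1, rotated -1])
       (auto simp: cost_extended_eq[OF _ \<omega>] indicator_def)
qed

lemma running_cost_measurable: "(\<lambda>\<omega>. LINT s:{0..T}|lborel. cost_rate s \<omega>) \<in> borel_measurable M"
proof -
  have "(\<lambda>(\<omega>, s). indicator {0..T} s *\<^sub>R cost_extended (\<omega>, s)) \<in> borel_measurable (M \<Otimes>\<^sub>M lborel)"
    using cost_extended_measurable by measurable
  then have "(\<lambda>\<omega>. \<integral>s. indicator {0..T} s *\<^sub>R cost_extended (\<omega>, s) \<partial>lborel) \<in> borel_measurable M"
    by (rule lborel.borel_measurable_lebesgue_integral)
  then show ?thesis unfolding set_lebesgue_integral_def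
    by (rule measurable_cong[THEN iffD1, rotated])
       (auto simp: cost_extended_eq indicator_def intro!: Bochner_Integration.integral_cong)
qed

definition mean_error :: real where "mean_error = sqrt (error_const * h)"

lemma mean_error_nonneg: "0 \<le> mean_error" using error_const_nonneg h by (simp add: mean_error_def)

lemma mean_error_le:
  assumes "real k * h \<le> s" "s \<le> real (Suc k) * h" "s \<le> T"
  shows "(\<integral>\<^sup>+ \<omega>. ennreal (norm (X s \<omega> - Y k \<omega>)) \<partial>M) \<le> ennreal mean_error"
    and "W1 (law M (X s)) (law M (Y k)) \<le> ennreal mean_error"
proof -
  have s: "s \<in> {0..T}" using assms grid_nonneg[of k] by auto
  note [measurable] = X_measurable[OF s] Y_measurable[of k]
  have K3h: "0 \<le> error_const * h" using error_const_nonneg h by simp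
  have "(\<integral>\<^sup>+ \<omega>. ennreal (norm (X s \<omega> - Y k \<omega>)) \<partial>M)\<^sup>2 \<le> (\<integral>\<^sup>+ \<omega>. (ennreal (norm (X s \<omega> - Y k \<omega>)))\<^sup>2 \<partial>M)"
    by (rule nn_integral_squared_le_second_moment) measurable
  also have "\<dots> = mean_sq_dist M (X s) (Y k)" by (simp add: mean_sq_dist_def ennreal_power)
  finally show 1: "(\<integral>\<^sup>+ \<omega>. ennreal (norm (X s \<omega> - Y k \<omega>)) \<partial>M) \<le> ennreal mean_error"
    using interpolated_strong_error[OF assms] unfolding mean_error_def by (intro le_ennreal_sqrt K3h) (rule order_trans)
  show "W1 (law M (X s)) (law M (Y k)) \<le> ennreal mean_error"
    using W1_law_le[of "X s" M "Y k"] 1 by (simp add: dist_norm)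
qed

definition cost_gap :: "'w \<times> real \<Rightarrow> ennreal" where
  "cost_gap p = ennreal C3 * (ennreal (norm (X_extended p - Y (grid_index h (snd p)) (fst p))) + ennreal mean_error)"

lemma cost_gap_measurable: "cost_gap \<in> borel_measurable (M \<Otimes>\<^sub>M lborel)"
proof -
  note [measurable] = Y_grid_measurable X_extended_measurable
  show ?thesis unfolding cost_gap_def[abs_def] by measurable
qed

text \<open>\<open>cost_gap\<close> is the analogue for the cost of the squared gap of the coefficients: an upper bound
  whose dependence on the law is a constant.\<close>

lemma cost_rate_gap:
  assumes s: "0 \<le> s" "s \<le> T" and \<omega>: "\<omega> \<in> space M"
  shows "ennreal \<bar>cost_rate s \<omega> - euler_cost_rate (grid_index h s) \<omega>\<bar> \<le> cost_gap (\<omega>, s)"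
proof -
  let ?j = "grid_index h s"
  have sT: "s \<in> {0..T}" using s by auto
  have "ennreal \<bar>cost_rate s \<omega> - euler_cost_rate ?j \<omega>\<bar>
      \<le> ennreal C3 * (ennreal (norm (X s \<omega> - Y ?j \<omega>)) + W1 (law M (X s)) (law M (Y ?j)))"
    using Lipschitz_coefficient_diff_le[OF c law_X[OF sT] law_Y[of ?j] m_prob[OF s(1) \<omega>]] m_grid[OF s(1) \<omega>]
    by simp
  also have "\<dots> \<le> cost_gap (\<omega>, s)"
    unfolding cost_gap_def fst_conv snd_conv X_extended_eq[OF sT] using grid_index_bounds[OF h s(1)] s
    by (intro mult_left_mono add_left_mono mean_error_le) auto
  finally show ?thesis .
qed

lemma cost_gap_integral_le:
  assumes k: "real k * h \<le> T"
  shows "(\<integral>\<^sup>+ \<omega>. (\<integral>\<^sup>+ s\<in>{0..<real k * h}. cost_gap (\<omega>, s) \<partial>lborel) \<partial>M) \<le> ennreal (2 * C3 * mean_error * T)"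
proof -
  interpret P: pair_sigma_finite M lborel ..
  note [measurable] = cost_gap_measurable
  have "(\<integral>\<^sup>+ \<omega>. (\<integral>\<^sup>+ s\<in>{0..<real k * h}. cost_gap (\<omega>, s) \<partial>lborel) \<partial>M)
     = (\<integral>\<^sup>+ s. \<integral>\<^sup>+ \<omega>. cost_gap (\<omega>, s) * indicator {0..<real k * h} s \<partial>M \<partial>lborel)"
    by (rule P.Fubini'[symmetric]) measurable
  also have "\<dots> \<le> (\<integral>\<^sup>+ s. ennreal (2 * C3 * mean_error) * indicator {0..<real k * h} s \<partial>lborel)"
  proof (rule nn_integral_mono)
    fix s
    show "(\<integral>\<^sup>+ \<omega>. cost_gap (\<omega>, s) * indicator {0..<real k * h} s \<partial>M) \<le> ennreal (2 * C3 * mean_error) * indicator {0..<real k * h} s"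
    proof (cases "s \<in> {0..<real k * h}")
      case True
      then have s: "0 \<le> s" "s \<le> T" "s \<in> {0..T}" using k by auto
      note [measurable] = X_measurable[OF s(3)] Y_measurable
      have "(\<integral>\<^sup>+ \<omega>. cost_gap (\<omega>, s) \<partial>M)
        = ennreal C3 * ((\<integral>\<^sup>+ \<omega>. ennreal (norm (X s \<omega> - Y (grid_index h s) \<omega>)) \<partial>M) + ennreal mean_error)"
        unfolding cost_gap_def fst_conv snd_conv X_extended_eq[OF s(3)]
        by (simp add: nn_integral_cmult nn_integral_add emeasure_space_1)
      also have "\<dots> \<le> ennreal C3 * (ennreal mean_error + ennreal mean_error)"
        using grid_index_bounds[OF h s(1)] s by (intro mult_left_mono add_right_mono mean_error_le) auto
      also have "\<dots> = ennreal (2 * C3 * mean_error)" using C3 mean_error_nonneg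
        by (simp flip: ennreal_mult ennreal_plus)
      finally show ?thesis using True by simp
    qed simp
  qed
  also have "\<dots> = ennreal (2 * C3 * mean_error * (real k * h))"
    using grid_nonneg[of k] C3 mean_error_nonneg by (subst nn_integral_cmult_indicator) (auto simp: ennreal_mult)
  also have "\<dots> \<le> ennreal (2 * C3 * mean_error * T)"
    using k C3 mean_error_nonneg by (intro ennreal_leI mult_left_mono) auto
  finally show ?thesis .
qed

abbreviation N :: nat where "N \<equiv> num_steps T h"

lemma N_bounds: "real N * h \<le> T" "T < real (Suc N) * h"
  using num_steps_bounds[OF T h] by auto

text \<open>On complete cells the costs are compared; the rest $[Nh, T]$ has length at most $h$ and at
  most $T$, hence at most their geometric mean.\<close>

lemma pathwise_running_cost_error:
  assumes \<omega>: "\<omega> \<in> space M"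
  shows "ennreal \<bar>(LINT s:{0..T}|lborel. cost_rate s \<omega>) - (\<Sum>k<N. euler_cost_rate k \<omega> * h)\<bar>
    \<le> (\<integral>\<^sup>+ s\<in>{0..<real N * h}. cost_gap (\<omega>, s) \<partial>lborel) + ennreal (C4 * sqrt (T * h))"
proof -
  let ?t = "real N * h"
  let ?e = "\<lambda>s. euler_cost_rate (grid_index h s) \<omega>"
  let ?f = "\<lambda>s. indicator {0..T} s *\<^sub>R cost_rate s \<omega> - indicator {0..<?t} s *\<^sub>R ?e s"
  note int = running_cost_integrable[OF \<omega>] set_integrable_step_function[OF h, of N "\<lambda>j. euler_cost_rate j \<omega>"]
  have f: "integrable lborel ?f" using int unfolding set_integrable_def by (rule Bochner_Integration.integrable_diff)
  have gm: "(\<lambda>s. cost_gap (\<omega>, s)) \<in> borel_measurable lborel"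
    using measurable_compose[OF measurable_Pair1'[OF \<omega>] cost_gap_measurable] .
  have "(LINT s:{0..T}|lborel. cost_rate s \<omega>) - (\<Sum>k<N. euler_cost_rate k \<omega> * h) = (LINT s|lborel. ?f s)"
    using int set_integral_step_function[OF h, of N "\<lambda>j. euler_cost_rate j \<omega>"]
    unfolding set_lebesgue_integral_def set_integrable_def
    by (subst Bochner_Integration.integral_diff) (auto simp: mult.commute)
  then have "ennreal \<bar>(LINT s:{0..T}|lborel. cost_rate s \<omega>) - (\<Sum>k<N. euler_cost_rate k \<omega> * h)\<bar>
      \<le> (\<integral>\<^sup>+ s. ennreal (norm (?f s)) \<partial>lborel)"
    using integral_norm_bound_ennreal[OF f] by simp
  also have "\<dots> \<le> (\<integral>\<^sup>+ s. cost_gap (\<omega>, s) * indicator {0..<?t} s + ennreal C4 * indicator {?t..T} s \<partial>lborel)"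
  proof (rule nn_integral_mono)
    fix s
    consider "s \<in> {0..<?t}" | "s \<in> {?t..T}" | "s \<notin> {0..T}" by fastforce
    then show "ennreal (norm (?f s)) \<le> cost_gap (\<omega>, s) * indicator {0..<?t} s + ennreal C4 * indicator {?t..T} s"
    proof cases
      case 1
      then have "s \<in> {0..T}" "s \<notin> {?t..T}" using N_bounds by auto
      then show ?thesis using 1 cost_rate_gap[OF _ _ \<omega>, of s] by simp
    next
      case 2
      then have "s \<in> {0..T}" "s \<notin> {0..<?t}" using grid_nonneg[of N] by auto
      then show ?thesis using 2 norm_cost_rate_le[OF _ \<omega>, of s] by (simp add: ennreal_leI)
    next
      case 3
      then have "s \<notin> {0..<?t}" using N_bounds by auto
      then show ?thesis using 3 by simp
    qed
  qed
  also have "\<dots> = (\<integral>\<^sup>+ s\<in>{0..<?t}. cost_gap (\<omega>, s) \<partial>lborel) + ennreal C4 * ennreal (T - ?t)"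
    using gm N_bounds by (subst nn_integral_add) (auto simp: nn_integral_cmult_indicator)
  also have "ennreal C4 * ennreal (T - ?t) \<le> ennreal (C4 * sqrt (T * h))"
  proof -
    have "(T - ?t)\<^sup>2 \<le> T * h"
      unfolding power2_eq_square using N_bounds grid_nonneg[of N] T
      by (intro mult_mono) (auto simp: algebra_simps)
    then have "T - ?t \<le> sqrt (T * h)" by (rule real_le_rsqrt)
    then show ?thesis using C4 N_bounds
      by (simp add: ennreal_mult[symmetric] ennreal_leI)
  qed
  finally show ?thesis by (simp add: add_left_mono)
qed

lemma terminal_cost_error:
  "(\<integral>\<^sup>+ \<omega>. ennreal \<bar>c_T (X T \<omega>) (law M (X T)) - c_T (Y N \<omega>) (law M (Y N))\<bar> \<partial>M) \<le> ennreal (2 * C3 * mean_error)"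
proof -
  have TT: "T \<in> {0..T}" using T by simp
  note [measurable] = X_measurable[OF TT] Y_measurable
  have b: "real N * h \<le> T" "T \<le> real (Suc N) * h" "T \<le> T" using N_bounds by auto
  have "(\<integral>\<^sup>+ \<omega>. ennreal \<bar>c_T (X T \<omega>) (law M (X T)) - c_T (Y N \<omega>) (law M (Y N))\<bar> \<partial>M)
      \<le> (\<integral>\<^sup>+ \<omega>. ennreal C3 * (ennreal (norm (X T \<omega> - Y N \<omega>)) + ennreal mean_error) \<partial>M)"
    by (intro nn_integral_mono order_trans[OF c_T_Lipschitz[OF law_X[OF TT] law_Y[of N]]]
          mult_left_mono add_left_mono mean_error_le(2)[OF b]) simp
  also have "\<dots> = ennreal C3 * ((\<integral>\<^sup>+ \<omega>. ennreal (norm (X T \<omega> - Y N \<omega>)) \<partial>M) + ennreal mean_error)"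
    by (simp add: nn_integral_cmult nn_integral_add emeasure_space_1)
  also have "\<dots> \<le> ennreal C3 * (ennreal mean_error + ennreal mean_error)"
    by (intro mult_left_mono add_right_mono mean_error_le(1)[OF b]) simp
  also have "\<dots> = ennreal (2 * C3 * mean_error)" using C3 mean_error_nonneg
    by (simp flip: ennreal_mult ennreal_plus)
  finally show ?thesis .
qed

theorem cost_error:
  "\<bar>continuous_cost M c c_T T m X - discrete_cost M W b \<sigma> c c_T T h x m\<bar>
    \<le> (2 * C3 * sqrt error_const * (T + 1) + C4 * sqrt T) * h powr (1 / 2)"
proof -
  have TT: "T \<in> {0..T}" using T by simp
  let ?Z = "\<lambda>\<omega>. LINT s:{0..T}|lborel. cost_rate s \<omega>"
  let ?S = "\<lambda>\<omega>. \<Sum>k<N. euler_cost_rate k \<omega> * h"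
  let ?p = "\<lambda>\<omega>. c_T (X T \<omega>) (law M (X T))" and ?q = "\<lambda>\<omega>. c_T (Y N \<omega>) (law M (Y N))"
  have p: "?p \<in> borel_measurable M" and q: "?q \<in> borel_measurable M"
    using measurable_compose[OF X_measurable[OF TT] c_T_measurable[OF law_X[OF TT]]]
      measurable_compose[OF Y_measurable c_T_measurable[OF law_Y]] by auto
  note [measurable] = p q running_cost_measurable cost_gap_measurable
  have [measurable]: "?S \<in> borel_measurable M"
    using euler_cost_rate_measurable by measurable
  have Z_le: "\<bar>?Z \<omega>\<bar> \<le> C4 * T" if \<omega>: "\<omega> \<in> space M" for \<omega>
  proof -
    have "ennreal (norm (?Z \<omega>)) \<le> (\<integral>\<^sup>+ s. ennreal (norm (indicator {0..T} s *\<^sub>R cost_rate s \<omega>)) \<partial>lborel)"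
      using running_cost_integrable[OF \<omega>] unfolding set_integrable_def set_lebesgue_integral_def
      by (rule integral_norm_bound_ennreal)
    also have "\<dots> \<le> (\<integral>\<^sup>+ s. ennreal C4 * indicator {0..T} s \<partial>lborel)"
      using norm_cost_rate_le[OF _ \<omega>] by (intro nn_integral_mono) (simp add: ennreal_leI split: split_indicator)
    also have "\<dots> = ennreal (C4 * T)"
      using C4 T by (subst nn_integral_cmult_indicator) (auto simp: ennreal_mult)
    finally show ?thesis using C4 T by (simp add: ennreal_le_iff)
  qed
  have S_le: "\<bar>?S \<omega>\<bar> \<le> (\<Sum>k<N. C4 * h)" if \<omega>: "\<omega> \<in> space M" for \<omega>
    using norm_euler_cost_rate_le[OF \<omega>] h
    by (intro order_trans[OF sum_abs] sum_mono) (simp add: abs_mult)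
  have Zi: "integrable M ?Z" using Z_le by (intro integrable_const_bound[where B = "C4 * T"] AE_I2) auto
  have Si: "integrable M ?S" using S_le
    by (intro integrable_const_bound[where B = "\<Sum>k<N. C4 * h"] AE_I2) (auto simp del: sum_constant)
  have pi: "integrable M ?p" using c_T_le[OF law_X[OF TT]]
    by (intro integrable_const_bound[where B = C4] AE_I2) auto
  have qi: "integrable M ?q" using c_T_le[OF law_Y]
    by (intro integrable_const_bound[where B = C4] AE_I2) auto
  note int = Zi Si pi qi
  have "continuous_cost M c c_T T m X - discrete_cost M W b \<sigma> c c_T T h x m
      = (\<integral>\<omega>. (?Z \<omega> - ?S \<omega>) + (?p \<omega> - ?q \<omega>) \<partial>M)"
    unfolding continuous_cost_def discrete_cost_def Let_def using int by simp
  then have "ennreal \<bar>continuous_cost M c c_T T m X - discrete_cost M W b \<sigma> c c_T T h x m\<bar>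
      \<le> (\<integral>\<^sup>+ \<omega>. ennreal (norm ((?Z \<omega> - ?S \<omega>) + (?p \<omega> - ?q \<omega>))) \<partial>M)"
    using integral_norm_bound_ennreal[of M "\<lambda>\<omega>. (?Z \<omega> - ?S \<omega>) + (?p \<omega> - ?q \<omega>)"] int by simp
  also have "\<dots> \<le> (\<integral>\<^sup>+ \<omega>. (\<integral>\<^sup>+ s\<in>{0..<real N * h}. cost_gap (\<omega>, s) \<partial>lborel) + ennreal (C4 * sqrt (T * h))
       + ennreal \<bar>?p \<omega> - ?q \<omega>\<bar> \<partial>M)"
  proof (rule nn_integral_mono)
    fix \<omega> assume \<omega>: "\<omega> \<in> space M"
    have "ennreal (norm ((?Z \<omega> - ?S \<omega>) + (?p \<omega> - ?q \<omega>))) \<le> ennreal (\<bar>?Z \<omega> - ?S \<omega>\<bar> + \<bar>?p \<omega> - ?q \<omega>\<bar>)"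
      unfolding real_norm_def by (intro ennreal_leI abs_triangle_ineq)
    also have "\<dots> = ennreal \<bar>?Z \<omega> - ?S \<omega>\<bar> + ennreal \<bar>?p \<omega> - ?q \<omega>\<bar>" by simp
    finally show "ennreal (norm ((?Z \<omega> - ?S \<omega>) + (?p \<omega> - ?q \<omega>)))
      \<le> (\<integral>\<^sup>+ s\<in>{0..<real N * h}. cost_gap (\<omega>, s) \<partial>lborel) + ennreal (C4 * sqrt (T * h)) + ennreal \<bar>?p \<omega> - ?q \<omega>\<bar>"
      by (rule order_trans[OF _ add_right_mono[OF pathwise_running_cost_error[OF \<omega>]]])
  qed
  also have "\<dots> = (\<integral>\<^sup>+ \<omega>. (\<integral>\<^sup>+ s\<in>{0..<real N * h}. cost_gap (\<omega>, s) \<partial>lborel) \<partial>M) + ennreal (C4 * sqrt (T * h))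
       + (\<integral>\<^sup>+ \<omega>. ennreal \<bar>?p \<omega> - ?q \<omega>\<bar> \<partial>M)"
    by (simp add: nn_integral_add emeasure_space_1)
  also have "\<dots> \<le> ennreal (2 * C3 * mean_error * T) + ennreal (C4 * sqrt (T * h)) + ennreal (2 * C3 * mean_error)"
    by (intro add_mono cost_gap_integral_le N_bounds terminal_cost_error) simp
  also have "\<dots> = ennreal (2 * C3 * mean_error * T + C4 * sqrt (T * h) + 2 * C3 * mean_error)"
    using C3 C4 T h mean_error_nonneg by simp
  also have "2 * C3 * mean_error * T + C4 * sqrt (T * h) + 2 * C3 * mean_error
      = (2 * C3 * sqrt error_const * (T + 1) + C4 * sqrt T) * h powr (1 / 2)"
    using h by (simp add: mean_error_def real_sqrt_mult powr_half_sqrt algebra_simps)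
  finally show ?thesis
    using C3 C4 T h error_const_nonneg by (subst (asm) ennreal_le_iff) auto
qed

end

section \<open>Filtrations generated by non-anticipative policies\<close>

lemma preimages_subset: "Y \<in> measurable M N \<Longrightarrow> preimages M N Y \<subseteq> sets M"
  unfolding preimages_def by (auto intro: measurable_sets)

lemma preimages_const_subset: "preimages M N (\<lambda>_. y) \<subseteq> sets M"
proof -
  have "(\<lambda>_. y) -` A \<inter> space M \<in> sets M" for A
    by (cases "y \<in> A") auto
  then show ?thesis unfolding preimages_def by blast
qed

lemma measurable_sigma_preimages:
  assumes Y: "Y \<in> measurable M N" and A: "preimages M N Y \<subseteq> A" "A \<subseteq> sets M"
  shows "Y \<in> measurable (sigma (space M) A) N"
proof (rule measurableI)
  have "A \<subseteq> Pow (space M)" using A(2) sets.space_closed[of M] by (rule order_trans)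
  then have sets: "sets (sigma (space M) A) = sigma_sets (space M) A" by (rule sets_measure_of)
  have space: "space (sigma (space M) A) = space M" by (rule space_measure_of_conv)
  show "Y \<omega> \<in> space N" if "\<omega> \<in> space (sigma (space M) A)" for \<omega>
    using measurable_space[OF Y] that unfolding space by blast
  show "Y -` B \<inter> space (sigma (space M) A) \<in> sets (sigma (space M) A)" if "B \<in> sets N" for B
    using that A(1) unfolding sets space preimages_def by (intro sigma_sets.Basic) blast
qed

lemma policy_filtration_generators:
  assumes "X0 \<in> borel_measurable M" "policy M m" "\<And>r. 0 \<le> r \<Longrightarrow> W r \<in> borel_measurable M"
  shows "preimages M borel X0 \<union> preimages M (prob_algebra borel) (\<lambda>_. law M X0) \<union>
      (\<Union>r\<in>{0..s}. preimages M (prob_algebra borel) (m r) \<union> preimages M borel (W r)) \<union>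
      null_sets M \<subseteq> sets M"
proof (intro Un_least UN_least preimages_const_subset preimages_subset)
  show "X0 \<in> borel_measurable M" by fact
  show "null_sets M \<subseteq> sets M" by (rule null_setsD2[THEN subsetI])
  fix r assume "r \<in> {0..s}"
  then have "0 \<le> r" by simp
  then show "m r \<in> measurable M (prob_algebra borel)" "W r \<in> borel_measurable M"
    using assms unfolding policy_def by blast+
qed

lemma policy_filtration_adapted:
  assumes r: "0 \<le> r" "r \<le> s"
    and gen: "X0 \<in> borel_measurable M" "policy M m" "\<And>r. 0 \<le> r \<Longrightarrow> W r \<in> borel_measurable M"
  shows "W r \<in> borel_measurable (policy_filtration M W X0 m s)"
    and "m r \<in> measurable (policy_filtration M W X0 m s) (prob_algebra borel)"
proof -
  have rs: "r \<in> {0..s}" using r by simp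
  show "W r \<in> borel_measurable (policy_filtration M W X0 m s)"
    unfolding policy_filtration_def
    by (rule measurable_sigma_preimages[OF gen(3)[OF r(1)] _ policy_filtration_generators[OF gen]])
       (use rs in blast)
  have "m r \<in> measurable M (prob_algebra borel)" using gen(2) r(1) unfolding policy_def by blast
  then show "m r \<in> measurable (policy_filtration M W X0 m s) (prob_algebra borel)"
    unfolding policy_filtration_def
    by (rule measurable_sigma_preimages[OF _ _ policy_filtration_generators[OF gen]])
       (use rs in blast)
qed

lemma Brownian_motion_measurable:
  assumes U: "usual_conditions M F" and BM: "standard_Brownian_motion M F W" and r: "0 \<le> r"
  shows "W r \<in> borel_measurable M"
proof (rule measurable_from_subalg)
  show "subalgebra M (F r)" using U unfolding usual_conditions_def by blast
  show "W r \<in> borel_measurable (F r)" using BM r unfolding standard_Brownian_motion_def by blast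
qed

text \<open>The Brownian motion is given with respect to \<open>F\<close>, but the solution and its stochastic integral
  refer to the filtration of the policy; independence of the increments from the latter is the
  definition of a non-anticipative policy.\<close>

lemma adapted_increments_policy_filtration:
  assumes U: "usual_conditions M F" and BM: "standard_Brownian_motion M F W"
    and X0: "X0 \<in> borel_measurable M" and m: "policy M m" "non_anticipative M W X0 m"
  shows "adapted_increments M (policy_filtration M W X0 m) W"
proof -
  have "prob_space M" using U unfolding usual_conditions_def by blast
  then interpret prob_space M .
  have W: "W r \<in> borel_measurable M" if "0 \<le> r" for r
    by (rule Brownian_motion_measurable[OF U BM that])
  note gen = policy_filtration_generators[OF X0 m(1) W]
  have sets: "sets (policy_filtration M W X0 m s) = sigma_sets (space M) (preimages M borel X0 \<union>
      preimages M (prob_algebra borel) (\<lambda>_. law M X0) \<union>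
      (\<Union>r\<in>{0..s}. preimages M (prob_algebra borel) (m r) \<union> preimages M borel (W r)) \<union> null_sets M)" for s
    unfolding policy_filtration_def
    by (rule sets_measure_of) (rule order_trans[OF gen sets.space_closed])
  show ?thesis
  proof
    show "space (policy_filtration M W X0 m s) = space M" for s
      unfolding policy_filtration_def by (rule space_measure_of_conv)
    show "sets (policy_filtration M W X0 m s) \<subseteq> events" for s
      unfolding sets by (rule sets.sigma_sets_subset[OF gen])
    show "sets (policy_filtration M W X0 m s) \<subseteq> sets (policy_filtration M W X0 m t)" if "s \<le> t" for s t
      unfolding sets using that by (intro sigma_sets_mono' Un_mono UN_mono order_refl) simp
    show "W s \<in> borel_measurable (policy_filtration M W X0 m s)" if "0 \<le> s" for s
      by (rule policy_filtration_adapted(1)[OF that order_refl X0 m(1) W])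
    fix s t :: real assume st: "0 \<le> s" "s < t"
    show "indep_set (preimages M borel (\<lambda>\<omega>. W t \<omega> - W s \<omega>)) (sets (policy_filtration M W X0 m s))"
      using m(2) st unfolding non_anticipative_def by blast
    show "indep_vars (\<lambda>_. borel) (\<lambda>i \<omega>. (W t \<omega> - W s \<omega>) $ i) UNIV"
      using BM st unfolding standard_Brownian_motion_def by blast
    show "distributed M lborel (\<lambda>\<omega>. (W t \<omega> - W s \<omega>) $ i) (normal_density 0 (sqrt (t - s)))" for i
      using BM st unfolding standard_Brownian_motion_def by blast
  qed
qed

theorem corollary4p8:
  fixes T C1 C2 C3 C4 :: real
  assumes "T > 0" "C1 > 0" "C2 > 0" "C3 > 0" "C4 > 0"
    and "compact (UNIV :: 'u::metric_space set)"
  shows "\<exists>C::real.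
    \<forall>(M :: 'w measure) (F :: real \<Rightarrow> 'w measure) (W :: real \<Rightarrow> 'w \<Rightarrow> real ^ 'n)
      (b :: real ^ 'n \<Rightarrow> (real ^ 'n) measure \<Rightarrow> 'u \<Rightarrow> real ^ 'n)
      (\<sigma> :: real ^ 'n \<Rightarrow> (real ^ 'n) measure \<Rightarrow> real ^ 'n ^ 'n)
      (c :: real ^ 'n \<Rightarrow> (real ^ 'n) measure \<Rightarrow> 'u \<Rightarrow> real)
      (c_T :: real ^ 'n \<Rightarrow> (real ^ 'n) measure \<Rightarrow> real)
      (x :: real ^ 'n) (h :: real).
      usual_conditions M F \<and> standard_Brownian_motion M F W \<and>
      jointly_continuous b \<and>
      (\<forall>x y. \<forall>\<mu>\<in>prob_measures. \<forall>\<nu>\<in>prob_measures. \<forall>\<zeta>.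
         ennreal (norm (b x \<mu> \<zeta> - b y \<nu> \<zeta>) + norm (\<sigma> x \<mu> - \<sigma> y \<nu>))
           \<le> ennreal C1 * (ennreal (norm (x - y)) + W1 \<mu> \<nu>)) \<and>
      (\<forall>x. \<forall>\<mu>\<in>prob_measures. \<forall>\<zeta>. norm (b x \<mu> \<zeta>) + norm (\<sigma> x \<mu>) \<le> C2) \<and>
      jointly_continuous c \<and>
      (\<forall>x y. \<forall>\<mu>\<in>prob_measures. \<forall>\<nu>\<in>prob_measures. \<forall>\<zeta>.
         ennreal (\<bar>c x \<mu> \<zeta> - c y \<nu> \<zeta>\<bar> + \<bar>c_T x \<mu> - c_T y \<nu>\<bar>)
           \<le> ennreal C3 * (ennreal (norm (x - y)) + W1 \<mu> \<nu>)) \<and>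
      (\<forall>x. \<forall>\<mu>\<in>prob_measures. \<forall>\<zeta>. \<bar>c x \<mu> \<zeta>\<bar> + \<bar>c_T x \<mu>\<bar> \<le> C4) \<and>
      h > 0 \<longrightarrow>
      (SUP (m, X) \<in> {(m, X). policy M m \<and> non_anticipative M W (\<lambda>_. x) m \<and>
                          piecewise_constant M h m \<and> controlled_solution M W b \<sigma> T x m X}.
         ereal \<bar>continuous_cost M c c_T T m X - discrete_cost M W b \<sigma> c c_T T h x m\<bar>)
        \<le> ereal (C * h powr (1 / 2))"
proof (intro exI allI impI, elim conjE)
  fix M :: "'w measure" and F :: "real \<Rightarrow> 'w measure" and W :: "real \<Rightarrow> 'w \<Rightarrow> real ^ 'n"
    and b :: "real ^ 'n \<Rightarrow> (real ^ 'n) measure \<Rightarrow> 'u \<Rightarrow> real ^ 'n"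
    and \<sigma> :: "real ^ 'n \<Rightarrow> (real ^ 'n) measure \<Rightarrow> real ^ 'n ^ 'n"
    and c :: "real ^ 'n \<Rightarrow> (real ^ 'n) measure \<Rightarrow> 'u \<Rightarrow> real"
    and c_T :: "real ^ 'n \<Rightarrow> (real ^ 'n) measure \<Rightarrow> real"
    and x :: "real ^ 'n" and h :: real
  assume U: "usual_conditions M F" and BM: "standard_Brownian_motion M F W"
    and b_cont: "jointly_continuous b"
    and b\<sigma>_Lip: "\<forall>x y. \<forall>\<mu>\<in>prob_measures. \<forall>\<nu>\<in>prob_measures. \<forall>\<zeta>.
         ennreal (norm (b x \<mu> \<zeta> - b y \<nu> \<zeta>) + norm (\<sigma> x \<mu> - \<sigma> y \<nu>))
           \<le> ennreal C1 * (ennreal (norm (x - y)) + W1 \<mu> \<nu>)"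
    and b\<sigma>_le: "\<forall>x. \<forall>\<mu>\<in>prob_measures. \<forall>\<zeta>. norm (b x \<mu> \<zeta>) + norm (\<sigma> x \<mu>) \<le> C2"
    and c_cont: "jointly_continuous c"
    and c_Lip: "\<forall>x y. \<forall>\<mu>\<in>prob_measures. \<forall>\<nu>\<in>prob_measures. \<forall>\<zeta>.
         ennreal (\<bar>c x \<mu> \<zeta> - c y \<nu> \<zeta>\<bar> + \<bar>c_T x \<mu> - c_T y \<nu>\<bar>)
           \<le> ennreal C3 * (ennreal (norm (x - y)) + W1 \<mu> \<nu>)"
    and c_le: "\<forall>x. \<forall>\<mu>\<in>prob_measures. \<forall>\<zeta>. \<bar>c x \<mu> \<zeta>\<bar> + \<bar>c_T x \<mu>\<bar> \<le> C4"
    and h: "h > 0"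
  have b: "Lipschitz_coefficient b C1 C2"
    unfolding Lipschitz_coefficient_def
  proof (intro conjI ballI allI)
    fix \<mu> \<nu> :: "(real ^ 'n) measure" and y z :: "real ^ 'n" and \<zeta> :: 'u
    assume \<mu>: "\<mu> \<in> prob_measures"
    show "b y \<mu> \<in> borel_measurable borel" by (rule jointly_continuous_imp_measurable[OF b_cont \<mu>])
    have "norm (b y \<mu> \<zeta>) + norm (\<sigma> y \<mu>) \<le> C2" using b\<sigma>_le \<mu> by blast
    then show "norm (b y \<mu> \<zeta>) \<le> C2" using norm_ge_zero[of "\<sigma> y \<mu>"] by linarith
    assume \<nu>: "\<nu> \<in> prob_measures"
    have "ennreal (norm (b y \<mu> \<zeta> - b z \<nu> \<zeta>)) \<le> ennreal (norm (b y \<mu> \<zeta> - b z \<nu> \<zeta>) + norm (\<sigma> y \<mu> - \<sigma> z \<nu>))"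
      by (intro ennreal_leI) simp
    also have "\<dots> \<le> ennreal C1 * (ennreal (norm (y - z)) + W1 \<mu> \<nu>)" using b\<sigma>_Lip \<mu> \<nu> by blast
    finally show "ennreal (norm (b y \<mu> \<zeta> - b z \<nu> \<zeta>)) \<le> ennreal C1 * (ennreal (norm (y - z)) + W1 \<mu> \<nu>)" .
  qed
  have c: "Lipschitz_coefficient c C3 C4"
    unfolding Lipschitz_coefficient_def
  proof (intro conjI ballI allI)
    fix \<mu> \<nu> :: "(real ^ 'n) measure" and y z :: "real ^ 'n" and \<zeta> :: 'u
    assume \<mu>: "\<mu> \<in> prob_measures"
    show "c y \<mu> \<in> borel_measurable borel" by (rule jointly_continuous_imp_measurable[OF c_cont \<mu>])
    have "\<bar>c y \<mu> \<zeta>\<bar> + \<bar>c_T y \<mu>\<bar> \<le> C4" using c_le \<mu> by blast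
    then show "norm (c y \<mu> \<zeta>) \<le> C4" by simp
    assume \<nu>: "\<nu> \<in> prob_measures"
    have "ennreal (norm (c y \<mu> \<zeta> - c z \<nu> \<zeta>)) \<le> ennreal (\<bar>c y \<mu> \<zeta> - c z \<nu> \<zeta>\<bar> + \<bar>c_T y \<mu> - c_T z \<nu>\<bar>)"
      by (intro ennreal_leI) simp
    also have "\<dots> \<le> ennreal C3 * (ennreal (norm (y - z)) + W1 \<mu> \<nu>)" using c_Lip \<mu> \<nu> by blast
    finally show "ennreal (norm (c y \<mu> \<zeta> - c z \<nu> \<zeta>)) \<le> ennreal C3 * (ennreal (norm (y - z)) + W1 \<mu> \<nu>)" .
  qed
  note W = Brownian_motion_measurable[OF U BM]
  (* error_const is a function of T, C1 and C2 alone, so the constant is uniform in all remaining data. *)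
  show "(SUP (m, X) \<in> {(m, X). policy M m \<and> non_anticipative M W (\<lambda>_. x) m \<and>
                          piecewise_constant M h m \<and> controlled_solution M W b \<sigma> T x m X}.
         ereal \<bar>continuous_cost M c c_T T m X - discrete_cost M W b \<sigma> c c_T T h x m\<bar>)
        \<le> ereal ((2 * C3 * sqrt (euler_approximation.error_const T C1 C2) * (T + 1) + C4 * sqrt T) * h powr (1 / 2))"
  proof (rule SUP_least, clarsimp)
    fix m X
    assume m: "policy M m" "non_anticipative M W (\<lambda>_. x) m" "piecewise_constant M h m"
      and X: "controlled_solution M W b \<sigma> T x m X"
    let ?G = "policy_filtration M W (\<lambda>_. x) m"
    interpret adapted_increments M ?G W
      by (rule adapted_increments_policy_filtration[OF U BM _ m(1,2)]) simp
    interpret euler_costs M ?G W b \<sigma> m X x T h C1 C2 c c_T C3 C4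
    proof
      show "m r \<in> measurable (?G s) (prob_algebra borel)" if "0 \<le> r" "r \<le> s" for r s
        by (rule policy_filtration_adapted(2)[OF that _ m(1) W]) simp_all
      fix y z :: "real ^ 'n" and \<mu> \<nu> :: "(real ^ 'n) measure"
      assume \<mu>: "\<mu> \<in> prob_measures"
      (* The bounds on b and \<sigma> are joint and quantified over controls; any control yields the one on \<sigma>. Likewise for c and c_T. *)
      have "norm (b y \<mu> undefined) + norm (\<sigma> y \<mu>) \<le> C2" using b\<sigma>_le \<mu> by blast
      then show "norm (\<sigma> y \<mu>) \<le> C2" using norm_ge_zero[of "b y \<mu> undefined"] by linarith
      have "\<bar>c y \<mu> undefined\<bar> + \<bar>c_T y \<mu>\<bar> \<le> C4" using c_le \<mu> by blast
      then show "\<bar>c_T y \<mu>\<bar> \<le> C4" by simp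
      assume \<nu>: "\<nu> \<in> prob_measures"
      have "ennreal (norm (\<sigma> y \<mu> - \<sigma> z \<nu>)) \<le> ennreal (norm (b y \<mu> undefined - b z \<nu> undefined) + norm (\<sigma> y \<mu> - \<sigma> z \<nu>))"
        by (intro ennreal_leI) simp
      also have "\<dots> \<le> ennreal C1 * (ennreal (norm (y - z)) + W1 \<mu> \<nu>)" using b\<sigma>_Lip \<mu> \<nu> by blast
      finally show "ennreal (norm (\<sigma> y \<mu> - \<sigma> z \<nu>)) \<le> ennreal C1 * (ennreal (norm (y - z)) + W1 \<mu> \<nu>)" .
      have "ennreal \<bar>c_T y \<mu> - c_T z \<nu>\<bar> \<le> ennreal (\<bar>c y \<mu> undefined - c z \<nu> undefined\<bar> + \<bar>c_T y \<mu> - c_T z \<nu>\<bar>)"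
        by (intro ennreal_leI) simp
      also have "\<dots> \<le> ennreal C3 * (ennreal (norm (y - z)) + W1 \<mu> \<nu>)" using c_Lip \<mu> \<nu> by blast
      finally show "ennreal \<bar>c_T y \<mu> - c_T z \<nu>\<bar> \<le> ennreal C3 * (ennreal (norm (y - z)) + W1 \<mu> \<nu>)" .
    next
      show "X t \<in> borel_measurable (?G t)" if "t \<in> {0..T}" for t
        using X that unfolding controlled_solution_def Let_def by blast
      show "continuous_on {0..T} (\<lambda>t. X t \<omega>)" if "\<omega> \<in> space M" for \<omega>
        using X that unfolding controlled_solution_def Let_def by blast
      show "\<exists>I. has_Ito_integral M ?G W (\<lambda>s \<omega>. \<sigma> (X s \<omega>) (law M (X s))) t I \<and>
        (AE \<omega> in M. set_integrable lborel {0..t} (\<lambda>s. relaxed b (X s \<omega>) (law M (X s)) (m s \<omega>)) \<and>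
          X t \<omega> = x + (LINT s:{0..t}|lborel. relaxed b (X s \<omega>) (law M (X s)) (m s \<omega>)) + I \<omega>)"
        if "t \<in> {0..T}" for t
        using X that unfolding controlled_solution_def Let_def by blast
    qed (fact assms(1-5) h b c m(3))+
    show "\<bar>continuous_cost M c c_T T m X - discrete_cost M W b \<sigma> c c_T T h x m\<bar>
      \<le> (2 * C3 * sqrt (euler_approximation.error_const T C1 C2) * (T + 1) + C4 * sqrt T) * h powr (1 / 2)"
      by (rule cost_error)
  qed
qed

end
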